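(* Let $\mathcal X$ be a real separable Hilbert space, let $C\in L_1^+(\mathcal X)$, let $U\colon\mathcal X\to\mathbb R$ be Fréchet differentiable, and let $P,Q$ be Borel probability measures on $\mathcal X$ such that $P\ll N_C$ with $\frac{dP}{dN_C}\propto \exp(-U)$, and $$\mathbb E_Q[\|X\|_{\mathcal X}^2]<\infty,\quad \mathbb E_Q[\|C\,DU(X)\|_{\mathcal X}]<\infty,\quad e^{-U/2}\in W^{1,2}_C(\mathcal X),\quad \mathbb E_{N_C}[\|C^{1/2}DU(X)\|_{\mathcal X}^2]<\infty .$$ Let $T\in L(\mathcal X)$ be such that its adjoint $T^*$ is surjective. Let $k$ be either the kernel $k(x,y)=e^{-\frac12\|Tx-Ty\|_{\mathcal X}^2}$ (SE-$T$) or the kernel $k(x,y)=(\|Tx-Ty\|_{\mathcal X}^2+1)^{-1/2}$ (IMQ-$T$), and set $K(x,y)=k(x,y)I_{\mathcal X}$. Then $$\mathrm{KSD}_{\mathcal A_v,K}(Q,P)=0\iff Q=P.$$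
   Context: Spaces and measures. $\mathcal X$ may be finite or infinite dimensional. $L(\mathcal X)$ is the space of bounded linear operators on $\mathcal X$, $I_{\mathcal X}$ the identity; $L_1^+(\mathcal X)$ is the set of symmetric, positive definite (in the sense $\langle Cx,x\rangle_{\mathcal X}\ge 0$; injectivity is stated separately when required), trace class operators. $N_C$ is the centred Gaussian measure on $\mathcal X$ with covariance operator $C$. In $\mathbb E_Q[f(X)]$, $X$ has law $Q$. Derivatives. $D$ is the Fréchet derivative; for real-valued $f$, $Df(x)$ is identified with an element of $\mathcal X$ by Riesz representation. $W^{1,2}_C(\mathcal X)$ is the Malliavin–Sobolev space of $f\in L^2(\mathcal X;N_C)$ whose Malliavin derivative $C^{1/2}Df$ lies in $L^2(\mathcal X,\mathcal X;N_C)$. Kernels. $\mathcal H_k$ is the reproducing kernel Hilbert space of $k$, with norm $\|\cdot\|_k$. For $K=kI_{\mathcal X}$, $\mathcal H_K$ is the Hilbert space of functions $F\colon\mathcal X\to\mathcal X$ with $F_i=\langle F(\cdot),e_i\rangle_{\mathcal X}\in\mathcal H_k$ for all $i$ and $\|F\|_K^2=\sum_i\|F_i\|_k^2<\infty$, for any orthonormal basis $\{e_i\}$ of $\mathcal X$ (independent of the basis). Operator and discrepancy. For $F\in\mathcal H_K$, $$\mathcal A_vF(x)=\mathrm{Tr}[C\,DF(x)]-\langle F(x),x+C\,DU(x)\rangle_{\mathcal X},\qquad \mathrm{KSD}_{\mathcal A_v,K}(Q,P)=\sup_{F\in\mathcal H_K,\|F\|_K\le1}|\mathbb E_Q[\mathcal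 A_vF(X)]|.$$ *)

theory Defs
  imports "HOL-Probability.Probability"
begin

text \<open>
  A real separable Hilbert space is a type of sort
  \<open>{real_inner, banach, second_countable_topology}\<close>; its dimension may be finite
  (including zero) or infinite. \<open>L(X)\<close> is the type of bounded linear functions
  \<open>'a \<Rightarrow>\<^sub>L 'a\<close>.
\<close>

section \<open>Orthonormal bases, traces and square roots\<close>

definition hilbert_basis :: "'a::real_inner set \<Rightarrow> bool" where
  "hilbert_basis E \<longleftrightarrow>
     pairwise orthogonal E \<and> (\<forall>e\<in>E. norm e = 1) \<and> closure (span E) = UNIV"

text \<open>The trace of a trace class operator does not depend on the basis.\<close>

definition op_trace :: "('a::real_inner \<Rightarrow> 'a) \<Rightarrow> real" where
  "op_trace A = (\<Sum>\<^sub>\<infinity>e\<in>(SOME E. hilbert_basis E). inner (A e) e)"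

definition nonneg_symmetric :: "('a::real_inner \<Rightarrow>\<^sub>L 'a) \<Rightarrow> bool" where
  "nonneg_symmetric A \<longleftrightarrow>
     (\<forall>x y. inner (A x) y = inner x (A y)) \<and> (\<forall>x. 0 \<le> inner (A x) x)"

text \<open>
  \<open>L1_plus\<close> is the set \<open>L\<^sub>1\<^sup>+(X)\<close>. Being trace class means that \<open>|C|\<close> has finite trace;
  here \<open>|C| = C\<close> because \<open>C\<close> is symmetric and nonnegative.
\<close>

definition L1_plus :: "('a::real_inner \<Rightarrow>\<^sub>L 'a) set" where
  "L1_plus = {C. nonneg_symmetric C \<and>
     (\<forall>E. hilbert_basis E \<longrightarrow> (\<lambda>e. inner (C e) e) summable_on E)}"

definition op_sqrt :: "('a::real_inner \<Rightarrow>\<^sub>L 'a) \<Rightarrow> ('a \<Rightarrow>\<^sub>L 'a)" where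
  "op_sqrt C = (THE R. nonneg_symmetric R \<and> R o\<^sub>L R = C)"

section \<open>Gaussian measures\<close>

definition normal_law :: "real \<Rightarrow> real measure" where
  "normal_law v =
     (if v = 0 then return borel 0 else density lborel (normal_density 0 (sqrt v)))"

text \<open>
  \<open>N\<close> is the measure \<open>N\<^sub>C\<close>: every continuous linear functional is a centred, possibly
  degenerate, normal variable, with variance given by the covariance operator \<open>C\<close>. The
  covariances of two functionals follow by polarization.
\<close>

definition centred_gaussian :: "('a::real_inner \<Rightarrow>\<^sub>L 'a) \<Rightarrow> 'a measure \<Rightarrow> bool" where
  "centred_gaussian C N \<longleftrightarrow> prob_space N \<and> sets N = sets borel \<and>
     (\<forall>h. distr N borel (\<lambda>x. inner x h) = normal_law (inner (C h) h))"

section \<open>Gradients and the Malliavin--Sobolev space\<close>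

text \<open>The Riesz representative of the Frechet derivative of a real-valued function.\<close>

definition gradient :: "('a::real_inner \<Rightarrow> real) \<Rightarrow> 'a \<Rightarrow> 'a" where
  "gradient f x = (THE g. GDERIV f x :> g)"

text \<open>
  The Malliavin derivative is the closure in \<open>L\<^sup>2(N\<^sub>C)\<close> of the operator \<open>C\<^sup>1\<^sup>/\<^sup>2 D\<close>
  defined on the linear span of the real and imaginary parts of the functions
  \<open>x \<mapsto> exp (i \<langle>h, x\<rangle>)\<close>.
\<close>

definition exponential_functions :: "('a::real_inner \<Rightarrow> real) set" where
  "exponential_functions =
     {\<lambda>x. \<Sum>j<n. a j * cos (inner (h j) x) + b j * sin (inner (h j) x)
      | (n::nat) a b h. True}"

definition has_malliavin_derivative ::
  "('a::{real_inner, banach, second_countable_topology} \<Rightarrow>\<^sub>L 'a) \<Rightarrow> 'a measure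
     \<Rightarrow> ('a \<Rightarrow> real) \<Rightarrow> ('a \<Rightarrow> 'a) \<Rightarrow> bool" where
  "has_malliavin_derivative C N f G \<longleftrightarrow>
     (\<exists>\<phi>. (\<forall>n::nat. \<phi> n \<in> exponential_functions) \<and>
       (\<lambda>n. \<integral>x. (\<phi> n x - f x)\<^sup>2 \<partial>N) \<longlonglongrightarrow> 0 \<and>
       (\<lambda>n. \<integral>x. (norm (op_sqrt C (gradient (\<phi> n) x) - G x))\<^sup>2 \<partial>N) \<longlonglongrightarrow> 0)"

definition malliavin_sobolev ::
  "('a::{real_inner, banach, second_countable_topology} \<Rightarrow>\<^sub>L 'a) \<Rightarrow> 'a measure
     \<Rightarrow> ('a \<Rightarrow> real) set" where
  "malliavin_sobolev C N =
     {f \<in> borel_measurable N. integrable N (\<lambda>x. (f x)\<^sup>2) \<and>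
       (\<exists>G\<in>borel_measurable N. integrable N (\<lambda>x. (norm (G x))\<^sup>2) \<and>
          has_malliavin_derivative C N f G)}"

section \<open>Reproducing kernel Hilbert spaces\<close>

text \<open>
  A Hilbert space of functions under the pointwise operations, with carrier \<open>H\<close> and inner
  product \<open>ip\<close>, in which \<open>k\<close> has the reproducing property. For a given kernel \<open>k\<close> such
  \<open>H\<close> and \<open>ip\<close> (restricted to \<open>H\<close>) exist and are unique by the Moore--Aronszajn theorem;
  values of \<open>ip\<close> outside \<open>H\<close> are irrelevant.
\<close>

locale rkhs =
  fixes k :: "'a \<Rightarrow> 'a \<Rightarrow> real"
    and H :: "('a \<Rightarrow> real) set"
    and ip :: "('a \<Rightarrow> real) \<Rightarrow> ('a \<Rightarrow> real) \<Rightarrow> real"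
  assumes zero_mem: "(\<lambda>x. 0) \<in> H"
    and add_mem: "f \<in> H \<Longrightarrow> g \<in> H \<Longrightarrow> (\<lambda>x. f x + g x) \<in> H"
    and scale_mem: "f \<in> H \<Longrightarrow> (\<lambda>x. c * f x) \<in> H"
    and ip_commute: "f \<in> H \<Longrightarrow> g \<in> H \<Longrightarrow> ip f g = ip g f"
    and ip_add: "f \<in> H \<Longrightarrow> f' \<in> H \<Longrightarrow> g \<in> H \<Longrightarrow> ip (\<lambda>x. f x + f' x) g = ip f g + ip f' g"
    and ip_scale: "f \<in> H \<Longrightarrow> g \<in> H \<Longrightarrow> ip (\<lambda>x. c * f x) g = c * ip f g"
    and ip_nonneg: "f \<in> H \<Longrightarrow> 0 \<le> ip f f"
    and ip_definite: "f \<in> H \<Longrightarrow> ip f f = 0 \<Longrightarrow> f = (\<lambda>x. 0)"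
    and complete: "\<And>s :: nat \<Rightarrow> 'a \<Rightarrow> real.
      (\<And>n. s n \<in> H) \<Longrightarrow>
      (\<And>e. e > 0 \<Longrightarrow> \<exists>M. \<forall>m\<ge>M. \<forall>n\<ge>M.
          sqrt (ip (\<lambda>x. s m x - s n x) (\<lambda>x. s m x - s n x)) < e) \<Longrightarrow>
      \<exists>f\<in>H. (\<lambda>n. sqrt (ip (\<lambda>x. s n x - f x) (\<lambda>x. s n x - f x))) \<longlonglongrightarrow> 0"
    and kernel_mem: "(\<lambda>y. k y x) \<in> H"
    and reproducing: "f \<in> H \<Longrightarrow> ip f (\<lambda>y. k y x) = f x"

text \<open>
  The space \<open>H\<^sub>K\<close> of vector-valued functions for \<open>K = k I\<close>, where \<open>H\<close>, \<open>ip\<close> is the RKHS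
  of \<open>k\<close>, and its norm, which does not depend on the basis chosen.
\<close>

definition vv_rkhs ::
  "('a \<Rightarrow> real) set \<Rightarrow> (('a \<Rightarrow> real) \<Rightarrow> ('a \<Rightarrow> real) \<Rightarrow> real) \<Rightarrow> ('a::real_inner \<Rightarrow> 'a) set"
  where
  "vv_rkhs H ip =
     {F. \<forall>E. hilbert_basis E \<longrightarrow> (\<forall>e\<in>E. (\<lambda>x. inner (F x) e) \<in> H) \<and>
       (\<lambda>e. ip (\<lambda>x. inner (F x) e) (\<lambda>x. inner (F x) e)) summable_on E}"

definition vv_norm ::
  "(('a \<Rightarrow> real) \<Rightarrow> ('a \<Rightarrow> real) \<Rightarrow> real) \<Rightarrow> ('a::real_inner \<Rightarrow> 'a) \<Rightarrow> real" where
  "vv_norm ip F = sqrt (\<Sum>\<^sub>\<infinity>e\<in>(SOME E. hilbert_basis E).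
     ip (\<lambda>x. inner (F x) e) (\<lambda>x. inner (F x) e))"

definition se_kernel :: "('a::real_inner \<Rightarrow>\<^sub>L 'a) \<Rightarrow> 'a \<Rightarrow> 'a \<Rightarrow> real" where
  "se_kernel T x y = exp (- (1/2) * (norm (T x - T y))\<^sup>2)"

definition imq_kernel :: "('a::real_inner \<Rightarrow>\<^sub>L 'a) \<Rightarrow> 'a \<Rightarrow> 'a \<Rightarrow> real" where
  "imq_kernel T x y = ((norm (T x - T y))\<^sup>2 + 1) powr (- (1/2))"

section \<open>Stein operator and kernel Stein discrepancy\<close>

definition stein_op ::
  "('a::real_inner \<Rightarrow>\<^sub>L 'a) \<Rightarrow> ('a \<Rightarrow> real) \<Rightarrow> ('a \<Rightarrow> 'a) \<Rightarrow> 'a \<Rightarrow> real" where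
  "stein_op C U F x =
     op_trace (\<lambda>h. C (frechet_derivative F (at x) h)) - inner (F x) (x + C (gradient U x))"

text \<open>The target \<open>P\<close> enters only through \<open>C\<close> and \<open>U\<close>, the kernel through its RKHS.\<close>

definition ksd ::
  "('a::{real_inner, banach, second_countable_topology} \<Rightarrow>\<^sub>L 'a) \<Rightarrow> ('a \<Rightarrow> real)
     \<Rightarrow> ('a \<Rightarrow> real) set \<Rightarrow> (('a \<Rightarrow> real) \<Rightarrow> ('a \<Rightarrow> real) \<Rightarrow> real) \<Rightarrow> 'a measure \<Rightarrow> ennreal"
  where
  "ksd C U H ip Q =
     (SUP F\<in>{F \<in> vv_rkhs H ip. vv_norm ip F \<le> 1}. ennreal \<bar>\<integral>x. stein_op C U F x \<partial>Q\<bar>)"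

end

theory Submission imports Defs "HOL-Library.Diagonal_Subsequence"
begin

text \<open>
  Let \<open>e\<^sub>i\<close> be an orthonormal basis of eigenvectors of \<open>C\<close> with eigenvalues \<open>l\<^sub>i\<close>. If \<open>Q = P\<close>, the
  discrepancy vanishes by Gaussian integration by parts along every \<open>e\<^sub>i\<close>: members of the
  vector-valued RKHS are bounded and differentiable with bounded derivative, and \<open>P\<close> has density
  \<open>exp (- U)\<close>.

  Conversely, if the discrepancy vanishes, inserting Gaussian kernel sections times \<open>e\<^sub>i\<close> gives an
  identity in the centre of the kernel. It is analytic in the centre, and continuing it to imaginary
  arguments yields the same integration by parts formula for \<open>Q\<close> against trigonometric functions,
  because the range of \<open>T\<^sup>* T\<close> is dense. Hence the conditional law of \<open>Q\<close> on lines parallel to \<open>e\<^sub>i\<close>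
  is explicit, and \<open>exp U \<cdot> Q\<close> is invariant under replacing finitely many coordinates by those of
  an independent Gaussian sample. Replacing more and more coordinates, Fatou's lemma and the
  continuity of \<open>U\<close> show that \<open>exp U \<cdot> Q\<close> is finite and a multiple of \<open>N\<close>.
\<close>

section \<open>Orthonormal sequences in Hilbert spaces\<close>

text \<open>What shapes the converse is a lack of regularity: the space has no Lebesgue measure,
  \<open>U\<close> is merely differentiable, so that its directional derivatives need not be locally
  integrable on lines, and exp U is not known to be integrable under \<open>Q\<close>. Densities are
  therefore taken on lines only, against a reference measure built from the measure under study. The
  Gaussian kernel leaves a weight w(x) = exp(-s |T x|^2) on \<open>Q\<close>. It provides the
  exponential moments needed for the continuation; its effect on the logarithmic derivative, the
  term 2 s <T x, T e>, is undone by adding s |T x|^2 to \<open>U\<close>. The Fourier identity is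
  divided by 1 + i theta and not by i theta because the quotient is again the transform of a finite
  measure; it exhibits the weighted measure as an average over lines, hence as absolutely continuous
  along them. Invariance is stated with nonnegative integrals because exp U times \<open>Q\<close>
  may at first be infinite. In the other direction the obstacle is the differentiability of
  vector-valued functions in the RKHS. It is read off from the norms of first and second differences
  of kernel sections.\<close>

definition onseq :: "(nat \<Rightarrow> 'a::real_inner) \<Rightarrow> bool" where
  "onseq e \<longleftrightarrow> (\<forall>i j. i \<noteq> j \<longrightarrow> inner (e i) (e j) = 0) \<and> (\<forall>i. norm (e i) = 1 \<or> e i = 0)"

definition proj_upto :: "(nat \<Rightarrow> 'a::real_inner) \<Rightarrow> nat \<Rightarrow> 'a \<Rightarrow> 'a" where
  "proj_upto e n x = (\<Sum>i<n. inner x (e i) *\<^sub>R e i)"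

definition complete_onseq :: "(nat \<Rightarrow> 'a::real_inner) \<Rightarrow> bool" where
  "complete_onseq e \<longleftrightarrow> onseq e \<and> (\<forall>x. (\<lambda>n. proj_upto e n x) \<longlonglongrightarrow> x)"

text \<open>The factor is 1 or 0, and in the second case \<open>e i\<close> vanishes too; the
  identity spares later case distinctions.\<close>

lemma onseq_inner_self:
  assumes "onseq e" shows "inner (e i) (e i) *\<^sub>R e i = e i"
  using assms unfolding onseq_def by (metis norm_eq_1 scaleR_one scaleR_zero_right)

lemma inner_proj_upto:
  assumes "onseq e"
  shows "inner (proj_upto e n x) (e i) = (if i < n then inner x (e i) else 0)"
proof -
  have "inner (proj_upto e n x) (e i) = (\<Sum>j<n. inner x (e j) * inner (e j) (e i))"
    by (simp add: proj_upto_def inner_sum_left)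
  also have "\<dots> = (\<Sum>j<n. if j = i then inner x (e i) * inner (e i) (e i) else 0)"
    using assms by (intro sum.cong) (auto simp: onseq_def)
  also have "\<dots> = (if i < n then inner x (e i) * inner (e i) (e i) else 0)"
    by (simp add: sum.delta)
  also have "inner x (e i) * inner (e i) (e i) = inner x (e i)"
    using onseq_inner_self[OF assms, of i] by (metis inner_scaleR_right mult.commute)
  finally show ?thesis .
qed

lemma inner_proj_upto_self:
  assumes "onseq e"
  shows "inner (proj_upto e n x) (proj_upto e n y) = (\<Sum>i<n. inner x (e i) * inner y (e i))"
proof -
  have "inner (proj_upto e n x) (proj_upto e n y)
      = (\<Sum>i<n. inner y (e i) * inner (proj_upto e n x) (e i))"
    by (simp add: proj_upto_def[of e n y] inner_sum_right)
  then show ?thesis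
    by (simp add: inner_proj_upto[OF assms] mult.commute)
qed

lemma inner_proj_upto_right:
  "inner x (proj_upto e n y) = (\<Sum>i<n. inner x (e i) * inner y (e i))"
  by (simp add: proj_upto_def inner_sum_right mult.commute)

lemma bessel:
  assumes "onseq e"
  shows "(\<Sum>i<n. (inner x (e i))\<^sup>2) \<le> (norm x)\<^sup>2"
proof -
  let ?p = "proj_upto e n x"
  have "0 \<le> inner (x - ?p) (x - ?p)" by simp
  also have "\<dots> = inner x x - 2 * inner x ?p + inner ?p ?p"
    by (simp add: inner_diff_left inner_diff_right inner_commute)
  also have "\<dots> = (norm x)\<^sup>2 - (\<Sum>i<n. (inner x (e i))\<^sup>2)"
    unfolding inner_proj_upto_self[OF assms]
    by (simp add: inner_proj_upto_right power2_eq_square power2_norm_eq_inner[unfolded power2_eq_square])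
  finally show ?thesis by simp
qed

lemma norm_proj_upto_le:
  assumes "onseq e" shows "norm (proj_upto e n x) \<le> norm x"
proof -
  have "(norm (proj_upto e n x))\<^sup>2 \<le> (norm x)\<^sup>2"
    using bessel[OF assms, where n=n and x=x] inner_proj_upto_self[OF assms, of n x x]
    by (simp add: dot_square_norm power2_eq_square)
  then show ?thesis by (simp add: power2_le_iff_abs_le)
qed

lemma bessel_finite:
  fixes B :: "'a::real_inner set"
  assumes "finite B" "\<And>b. b \<in> B \<Longrightarrow> norm b = 1" "pairwise orthogonal B"
  shows "(\<Sum>b\<in>B. (inner x b)\<^sup>2) \<le> (norm x)\<^sup>2"
proof -
  obtain h n where h: "bij_betw h {..<n::nat} B"
    using ex_bij_betw_nat_finite[OF assms(1)] by (auto simp: atLeast0LessThan)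
  define e where "e i = (if i < n then h i else 0)" for i
  have "onseq e" unfolding onseq_def
  proof (intro conjI allI impI)
    fix i j :: nat assume "i \<noteq> j"
    show "inner (e i) (e j) = 0"
    proof (cases "i < n \<and> j < n")
      case True
      then have "h i \<in> B" "h j \<in> B" "h i \<noteq> h j"
        using h \<open>i \<noteq> j\<close> by (auto simp: bij_betw_def inj_on_def)
      then show ?thesis using assms(3) True by (auto simp: pairwise_def orthogonal_def e_def)
    qed (auto simp: e_def)
  next
    fix i show "norm (e i) = 1 \<or> e i = 0"
      using h assms(2) by (auto simp: e_def bij_betw_def)
  qed
  moreover have "(\<Sum>b\<in>B. (inner x b)\<^sup>2) = (\<Sum>i<n. (inner x (e i))\<^sup>2)"
    using sum.reindex_bij_betw[OF h, of "\<lambda>b. (inner x b)\<^sup>2"] by (simp add: e_def)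
  ultimately show ?thesis using bessel by metis
qed

lemma summable_inner_sq:
  assumes "onseq e" shows "summable (\<lambda>i. (inner x (e i))\<^sup>2)"
  by (rule bounded_imp_summable[of _ "(norm x)\<^sup>2"])
    (simp_all only: lessThan_Suc_atMost[symmetric] bessel[OF assms] zero_le_power2)

lemma proj_upto_diff:
  assumes "m \<le> n"
  shows "proj_upto e n x - proj_upto e m x = (\<Sum>i\<in>{m..<n}. inner x (e i) *\<^sub>R e i)"
  using assms by (simp add: proj_upto_def sum_diff[symmetric] lessThan_minus_lessThan)

text \<open>By Pythagoras, blocks of the vector series are controlled by blocks of the series of
  squares, so the Cauchy criterion carries over. Zero entries make this an inequality.\<close>

lemma onseq_sum_convergent:
  fixes e :: "nat \<Rightarrow> 'a::{real_inner, banach}"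
  assumes e: "onseq e" and c: "summable (\<lambda>i. (c i)\<^sup>2)"
  shows "convergent (\<lambda>n. \<Sum>i<n. c i *\<^sub>R e i)"
proof -
  have ns: "(norm (\<Sum>i\<in>{m..<n}. c i *\<^sub>R e i))\<^sup>2 \<le> (\<Sum>i\<in>{m..<n}. (c i)\<^sup>2)" for m n
  proof -
    have "(norm (\<Sum>i\<in>{m..<n}. c i *\<^sub>R e i))\<^sup>2 = (\<Sum>i\<in>{m..<n}. (norm (c i *\<^sub>R e i))\<^sup>2)"
      by (rule norm_sum_Pythagorean) (use e in \<open>auto simp: pairwise_def orthogonal_def onseq_def\<close>)
    also have "\<dots> \<le> (\<Sum>i\<in>{m..<n}. (c i)\<^sup>2)"
    proof (rule sum_mono)
      fix i
      have "norm (e i) = 1 \<or> e i = 0" using e by (auto simp: onseq_def)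
      then show "(norm (c i *\<^sub>R e i))\<^sup>2 \<le> (c i)\<^sup>2" by auto
    qed
    finally show ?thesis .
  qed
  have "summable (\<lambda>i. c i *\<^sub>R e i)"
  proof (subst summable_Cauchy, intro allI impI)
    fix \<epsilon> :: real assume "\<epsilon> > 0"
    then have "\<epsilon>\<^sup>2 > 0" by simp
    then obtain N where N: "\<And>m n. m \<ge> N \<Longrightarrow> norm (\<Sum>i\<in>{m..<n}. (c i)\<^sup>2) < \<epsilon>\<^sup>2"
      using c unfolding summable_Cauchy by blast
    have "norm (\<Sum>i\<in>{m..<n}. c i *\<^sub>R e i) < \<epsilon>" if "m \<ge> N" for m n
    proof -
      have "(norm (\<Sum>i\<in>{m..<n}. c i *\<^sub>R e i))\<^sup>2 < \<epsilon>\<^sup>2"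
        using ns[where m=m and n=n] N[OF that, of n] by (simp add: abs_less_iff)
      then show ?thesis using \<open>\<epsilon> > 0\<close> by (simp add: power_less_imp_less_base)
    qed
    then show "\<exists>N. \<forall>m\<ge>N. \<forall>n. norm (\<Sum>i\<in>{m..<n}. c i *\<^sub>R e i) < \<epsilon>" by blast
  qed
  then show ?thesis by (simp add: summable_iff_convergent)
qed

text \<open>The limit is the orthogonal projection onto the closed span, whether or not the sequence
  is complete. Completeness is later proved by showing that the residual \<open>x - p\<close>
  vanishes.\<close>

lemma proj_convergent:
  fixes e :: "nat \<Rightarrow> 'a::{real_inner, banach}"
  assumes e: "onseq e"
  obtains p where "(\<lambda>n. proj_upto e n x) \<longlonglongrightarrow> p" "\<And>i. inner (x - p) (e i) = 0"
proof -
  obtain p where p: "(\<lambda>n. proj_upto e n x) \<longlonglongrightarrow> p"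
    using onseq_sum_convergent[OF e summable_inner_sq[OF e, of x]]
    unfolding convergent_def proj_upto_def by blast
  have "inner (x - p) (e i) = 0" for i
  proof -
    have "(\<lambda>n. inner (proj_upto e n x) (e i)) \<longlonglongrightarrow> inner p (e i)"
      by (intro tendsto_intros p)
    moreover have "(\<lambda>n. inner (proj_upto e n x) (e i)) \<longlonglongrightarrow> inner x (e i)"
      by (rule tendsto_eventually, rule eventually_sequentiallyI[of "Suc i"])
        (simp add: inner_proj_upto[OF e])
    ultimately have "inner p (e i) = inner x (e i)" by (rule LIMSEQ_unique)
    then show ?thesis by (simp add: inner_diff_left)
  qed
  with p that show thesis by blast
qed

text \<open>Distinct orthonormal vectors have distance sqrt 2, so the balls of radius 1/2 around
  them are disjoint, and a second countable space has only countably many disjoint nonempty open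
  sets.\<close>

lemma orthonormal_countable:
  fixes B :: "'a::{real_inner, second_countable_topology} set"
  assumes "\<And>b. b \<in> B \<Longrightarrow> norm b = 1" "pairwise orthogonal B"
  shows "countable B"
proof -
  have d: "dist b c \<ge> 1" if "b \<in> B" "c \<in> B" "b \<noteq> c" for b c
  proof -
    have "orthogonal b c" using assms(2) that by (auto simp: pairwise_def)
    then have "(norm (b - c))\<^sup>2 = 2"
      using assms(1) that by (simp add: power2_norm_eq_inner inner_diff_left inner_diff_right
          orthogonal_def inner_commute norm_eq_1)
    then show ?thesis
      by (metis dist_norm norm_ge_zero one_le_numeral one_power2 power2_le_imp_le)
  qed
  let ?F = "(\<lambda>b. ball b (1/2)) ` B"
  have "disjnt (ball b (1/2)) (ball c (1/2))" if "b \<in> B" "c \<in> B" "b \<noteq> c" for b c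
  proof -
    have "x \<notin> ball c (1/2)" if "x \<in> ball b (1/2)" for x
      using d[OF \<open>b \<in> B\<close> \<open>c \<in> B\<close> \<open>b \<noteq> c\<close>] that dist_triangle2[of b c x]
      by (auto simp: dist_commute)
    then show ?thesis by (auto simp: disjnt_def)
  qed
  then have "pairwise disjnt ?F" by (auto simp: pairwise_def)
  then have "countable ?F"
    by (intro countable_disjoint_open_subsets) auto
  moreover have "inj_on (\<lambda>b. ball b (1/2)) B"
  proof (rule inj_onI, rule ccontr)
    fix b c assume "b \<in> B" "c \<in> B" "ball b (1/2) = ball c (1/2)" "b \<noteq> c"
    then have "c \<in> ball b (1/2)" by auto
    with d[of b c] \<open>b \<in> B\<close> \<open>c \<in> B\<close> \<open>b \<noteq> c\<close> show False by auto
  qed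
  ultimately show ?thesis using countable_image_inj_on by blast
qed

lemma orthonormal_enumeration:
  fixes B :: "'a::{real_inner, second_countable_topology} set"
  assumes "\<And>b. b \<in> B \<Longrightarrow> norm b = 1" "pairwise orthogonal B"
  obtains e :: "nat \<Rightarrow> 'a" and J where "onseq e" "bij_betw e J B" "\<And>i. i \<notin> J \<Longrightarrow> e i = 0"
proof -
  have c: "countable B" by (rule orthonormal_countable) (use assms in auto)
  define J where "J = to_nat_on B ` B"
  define e where "e i = (if i \<in> J then from_nat_into B i else 0)" for i
  have bij: "bij_betw e J B"
  proof (rule bij_betw_byWitness[where f' = "to_nat_on B"])
    show "\<forall>a\<in>J. to_nat_on B (e a) = a" using c by (auto simp: e_def J_def)
    show "\<forall>a'\<in>B. e (to_nat_on B a') = a'" using c by (auto simp: e_def J_def)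
    show "e ` J \<subseteq> B" using c by (auto simp: e_def J_def)
    show "to_nat_on B ` B \<subseteq> J" by (auto simp: J_def)
  qed
  have "onseq e" unfolding onseq_def
  proof (intro conjI allI impI)
    fix i j :: nat assume "i \<noteq> j"
    show "inner (e i) (e j) = 0"
    proof (cases "i \<in> J \<and> j \<in> J")
      case True
      then have "e i \<in> B" "e j \<in> B" "e i \<noteq> e j"
        using bij \<open>i \<noteq> j\<close> by (auto simp: bij_betw_def inj_on_def)
      then show ?thesis using assms(2) by (auto simp: pairwise_def orthogonal_def)
    qed (auto simp: e_def)
  next
    fix i show "norm (e i) = 1 \<or> e i = 0"
      using bij assms(1) by (cases "i \<in> J") (auto simp: bij_betw_def e_def)
  qed
  with bij that show thesis by (auto simp: e_def)
qed

text \<open>Zorn's lemma for orthonormal sets within a predicate. It is used for membership in a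
  closed subspace and for being an eigenvector; maximality means that no unit vector with
  \<open>p\<close> is orthogonal to the whole sequence.\<close>

lemma maximal_onseq:
  fixes p :: "'a::{real_inner, second_countable_topology} \<Rightarrow> bool"
  obtains e :: "nat \<Rightarrow> 'a" where "onseq e" "\<And>i. e i = 0 \<or> p (e i)"
    "\<And>x. p x \<Longrightarrow> norm x = 1 \<Longrightarrow> \<exists>i. inner x (e i) \<noteq> 0"
proof -
  define A where "A = {B. (\<forall>b\<in>B. norm b = 1 \<and> p b) \<and> pairwise orthogonal (B::'a set)}"
  have "\<exists>M\<in>A. \<forall>X\<in>A. M \<subseteq> X \<longrightarrow> X = M"
  proof (rule subset_Zorn')
    fix \<C> assume ch: "subset.chain A \<C>"
    then have sub: "\<C> \<subseteq> A" and tot: "\<And>X Y. X \<in> \<C> \<Longrightarrow> Y \<in> \<C> \<Longrightarrow> X \<subseteq> Y \<or> Y \<subseteq> X"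
      by (auto simp: subset_chain_def)
    have "pairwise orthogonal (\<Union>\<C>)"
    proof (clarsimp simp: pairwise_def)
      fix x y X Y assume *: "x \<in> X" "X \<in> \<C>" "y \<in> Y" "Y \<in> \<C>" "x \<noteq> y"
      then obtain Z where "Z \<in> \<C>" "x \<in> Z" "y \<in> Z" using tot[of X Y] by blast
      with sub \<open>x \<noteq> y\<close> show "orthogonal x y" by (auto simp: A_def pairwise_def)
    qed
    with sub show "\<Union>\<C> \<in> A" by (auto simp: A_def)
  qed
  then obtain B where B: "B \<in> A" and mx: "\<And>X. X \<in> A \<Longrightarrow> B \<subseteq> X \<Longrightarrow> X = B" by blast
  obtain e :: "nat \<Rightarrow> 'a" and J where e: "onseq e" "bij_betw e J B" "\<And>i. i \<notin> J \<Longrightarrow> e i = 0"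
    using orthonormal_enumeration[of B] B by (auto simp: A_def)
  show thesis
  proof (rule that[of e])
    show "onseq e" by fact
    show "e i = 0 \<or> p (e i)" for i
      using e(2,3) B by (cases "i \<in> J") (auto simp: bij_betw_def A_def)
    fix x assume x: "p x" "norm x = 1"
    show "\<exists>i. inner x (e i) \<noteq> 0"
    proof (rule ccontr)
      assume "\<not> ?thesis"
      then have o: "inner x b = 0" if "b \<in> B" for b
        using that e(2) by (auto simp: bij_betw_def)
      have "insert x B \<in> A"
        using B x o by (auto simp: A_def pairwise_insert orthogonal_def inner_commute)
      then have "x \<in> B" using mx[of "insert x B"] by auto
      with o[of x] x show False by auto
    qed
  qed
qed

text \<open>The residual of the projection stays in \<open>S\<close> because \<open>S\<close> is
  closed; were it nonzero, its normalization would contradict maximality.\<close>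

lemma onseq_closed_subspace:
  fixes S :: "'a::{real_inner, banach, second_countable_topology} set"
  assumes S: "subspace S" "closed S"
  obtains e :: "nat \<Rightarrow> 'a" where "onseq e" "\<And>i. e i \<in> S"
    "\<And>x. x \<in> S \<Longrightarrow> (\<lambda>n. proj_upto e n x) \<longlonglongrightarrow> x"
proof -
  obtain e :: "nat \<Rightarrow> 'a" where e: "onseq e" "\<And>i. e i = 0 \<or> e i \<in> S"
    "\<And>x. x \<in> S \<Longrightarrow> norm x = 1 \<Longrightarrow> \<exists>i. inner x (e i) \<noteq> 0"
    using maximal_onseq[where p = "\<lambda>x. x \<in> S"] by blast
  have eS: "e i \<in> S" for i using e(2)[of i] S(1) by (auto simp: subspace_0)
  show thesis
  proof (rule that[OF e(1) eS])
    fix x assume x: "x \<in> S"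
    obtain p where p: "(\<lambda>n. proj_upto e n x) \<longlonglongrightarrow> p" "\<And>i. inner (x - p) (e i) = 0"
      using proj_convergent[OF e(1), of x] by blast
    have "proj_upto e n x \<in> S" for n
      unfolding proj_upto_def using S(1) eS by (intro subspace_sum subspace_scale) auto
    then have "p \<in> S" using closed_sequentially[OF S(2) _ p(1)] by blast
    then have d: "x - p \<in> S" using x S(1) by (simp add: subspace_diff)
    have "x - p = 0"
    proof (rule ccontr)
      assume "x - p \<noteq> 0"
      then have "norm ((x - p) /\<^sub>R norm (x - p)) = 1" by simp
      moreover have "(x - p) /\<^sub>R norm (x - p) \<in> S" using d S(1) by (simp add: subspace_scale)
      ultimately show False using e(3)[of "(x - p) /\<^sub>R norm (x - p)"] p(2) by auto
    qed
    with p(1) show "(\<lambda>n. proj_upto e n x) \<longlonglongrightarrow> x" by simp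
  qed
qed

lemma complete_onseq_exists:
  obtains e :: "nat \<Rightarrow> 'a::{real_inner, banach, second_countable_topology}" where "complete_onseq e"
  using onseq_closed_subspace[of "UNIV::'a set"] by (auto simp: complete_onseq_def)

text \<open>The residual of \<open>x\<close> is the required normal vector. Density of a subspace
  thereby becomes a statement about vectors orthogonal to it.\<close>

lemma closed_subspace_orthogonal:
  fixes S :: "'a::{real_inner, banach, second_countable_topology} set"
  assumes S: "subspace S" "closed S" "x \<notin> S"
  obtains z where "z \<noteq> 0" "\<And>y. y \<in> S \<Longrightarrow> inner z y = 0"
proof -
  obtain e :: "nat \<Rightarrow> 'a" where e: "onseq e" "\<And>i. e i \<in> S"
    "\<And>x. x \<in> S \<Longrightarrow> (\<lambda>n. proj_upto e n x) \<longlonglongrightarrow> x"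
    using onseq_closed_subspace[OF S(1,2)] by blast
  obtain p where p: "(\<lambda>n. proj_upto e n x) \<longlonglongrightarrow> p" "\<And>i. inner (x - p) (e i) = 0"
    using proj_convergent[OF e(1), of x] by blast
  have "proj_upto e n x \<in> S" for n
    unfolding proj_upto_def using S(1) e(2) by (intro subspace_sum subspace_scale) auto
  then have "p \<in> S" using closed_sequentially[OF S(2) _ p(1)] by blast
  show thesis
  proof (rule that[of "x - p"])
    show "x - p \<noteq> 0" using \<open>p \<in> S\<close> S(3) by auto
    fix y assume y: "y \<in> S"
    have "(\<lambda>n. inner (x - p) (proj_upto e n y)) \<longlonglongrightarrow> inner (x - p) y"
      by (intro tendsto_intros e(3) y)
    moreover have "(\<lambda>n. inner (x - p) (proj_upto e n y)) = (\<lambda>n. 0)"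
      by (simp add: inner_proj_upto_right p(2))
    ultimately show "inner (x - p) y = 0" using LIMSEQ_unique tendsto_const by metis
  qed
qed

lemma parseval:
  assumes "complete_onseq e"
  shows "(\<lambda>i. inner x (e i) * inner y (e i)) sums inner x y"
proof -
  have "(\<lambda>n. inner x (proj_upto e n y)) \<longlonglongrightarrow> inner x y"
    by (intro tendsto_intros) (use assms in \<open>auto simp: complete_onseq_def\<close>)
  then show ?thesis by (simp add: inner_proj_upto_right sums_def)
qed

lemma parseval_norm:
  assumes "complete_onseq e"
  shows "(\<lambda>i. (inner x (e i))\<^sup>2) sums (norm x)\<^sup>2"
  using parseval[OF assms, of x x] by (simp add: power2_eq_square dot_square_norm)

text \<open>Bridge from the basis sets of the definitions to padded sequences. The vectors
  orthogonal to a residual form a closed subspace containing \<open>E\<close>, hence everything, so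
  the residual is orthogonal to itself.\<close>

lemma hilbert_basis_enumeration:
  fixes E :: "'a::{real_inner, banach, second_countable_topology} set"
  assumes E: "hilbert_basis E"
  obtains e :: "nat \<Rightarrow> 'a" and J where "complete_onseq e" "bij_betw e J E" "\<And>i. i \<notin> J \<Longrightarrow> e i = 0"
proof -
  obtain e :: "nat \<Rightarrow> 'a" and J where e: "onseq e" "bij_betw e J E" "\<And>i. i \<notin> J \<Longrightarrow> e i = 0"
    using orthonormal_enumeration[of E] E by (auto simp: hilbert_basis_def)
  have "(\<lambda>n. proj_upto e n x) \<longlonglongrightarrow> x" for x
  proof -
    obtain p where p: "(\<lambda>n. proj_upto e n x) \<longlonglongrightarrow> p" "\<And>i. inner (x - p) (e i) = 0"
      using proj_convergent[OF e(1), of x] by blast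
    let ?W = "{y. inner (x - p) y = 0}"
    have "subspace ?W" by (auto simp: subspace_def inner_add_right)
    moreover have "E \<subseteq> ?W" using p(2) e(2) by (auto simp: bij_betw_def)
    ultimately have "span E \<subseteq> ?W" by (rule span_minimal[rotated])
    moreover have "closed ?W"
      by (intro closed_Collect_eq continuous_intros)
    ultimately have "closure (span E) \<subseteq> ?W" by (rule closure_minimal)
    then have "x - p \<in> ?W" using E unfolding hilbert_basis_def by blast
    then show ?thesis using p(1) by simp
  qed
  with e that show thesis by (auto simp: complete_onseq_def)
qed

lemma complete_onseq_hilbert_basis:
  assumes "complete_onseq e"
  shows "hilbert_basis (range e - {0})"
  unfolding hilbert_basis_def
proof (intro conjI)
  have e: "onseq e" using assms by (simp add: complete_onseq_def)
  show "pairwise orthogonal (range e - {0})"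
    using e unfolding pairwise_def orthogonal_def onseq_def by (metis Diff_iff imageE)
  show "\<forall>b\<in>range e - {0}. norm b = 1" using e by (auto simp: onseq_def)
  have "proj_upto e n x \<in> span (range e - {0})" for n x
    unfolding proj_upto_def
    by (intro span_sum span_scale) (metis Diff_iff rangeI singleton_iff span_base span_zero)
  moreover have "(\<lambda>n. proj_upto e n x) \<longlonglongrightarrow> x" for x
    using assms by (auto simp: complete_onseq_def)
  ultimately have "x \<in> closure (span (range e - {0}))" for x
    unfolding closure_sequential by (intro exI[of _ "\<lambda>n. proj_upto e n x"]) simp
  then show "closure (span (range e - {0})) = UNIV" by auto
qed

text \<open>The choice made in \<open>op_trace\<close> and \<open>vv_norm\<close> therefore denotes
  a genuine basis.\<close>

lemma hilbert_basis_some: "hilbert_basis (SOME E. hilbert_basis (E :: 'a::{real_inner, banach, second_countable_topology} set))"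
  using complete_onseq_exists complete_onseq_hilbert_basis by (metis someI)

text \<open>The representing vector must have the coordinates \<open>f (e i)\<close>. Their partial
  sums of squares are values of \<open>f\<close>, and boundedness of \<open>f\<close> makes the
  coordinates square summable.\<close>

lemma riesz_representation:
  fixes f :: "'a::{real_inner, banach, second_countable_topology} \<Rightarrow> real"
  assumes "bounded_linear f"
  obtains g where "\<And>x. f x = inner x g"
proof -
  interpret bounded_linear f by fact
  obtain e :: "nat \<Rightarrow> 'a" where ce: "complete_onseq e" using complete_onseq_exists by blast
  then have e: "onseq e" by (simp add: complete_onseq_def)
  obtain K where K: "K \<ge> 0" "\<And>x. norm (f x) \<le> norm x * K"
    using nonneg_bounded by blast
  let ?g = "\<lambda>n. \<Sum>i<n. f (e i) *\<^sub>R e i"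
  have "(\<Sum>i<n. (f (e i))\<^sup>2) \<le> K\<^sup>2" for n
  proof -
    let ?s = "\<Sum>i<n. (f (e i))\<^sup>2"
    have s: "?s = f (?g n)" by (simp add: sum scaleR power2_eq_square)
    have "(norm (?g n))\<^sup>2 = (\<Sum>i<n. (norm (f (e i) *\<^sub>R e i))\<^sup>2)"
      by (rule norm_sum_Pythagorean) (use e in \<open>auto simp: pairwise_def orthogonal_def onseq_def\<close>)
    also have "\<dots> \<le> ?s"
    proof (rule sum_mono)
      fix i
      have "norm (e i) = 1 \<or> e i = 0" using e by (auto simp: onseq_def)
      then show "(norm (f (e i) *\<^sub>R e i))\<^sup>2 \<le> (f (e i))\<^sup>2" by auto
    qed
    finally have "(norm (?g n))\<^sup>2 \<le> ?s" .
    moreover have "?s\<^sup>2 \<le> (norm (?g n))\<^sup>2 * K\<^sup>2"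
      using K(2)[of "?g n"] s power_mono[of "norm (f (?g n))" "norm (?g n) * K" 2]
      by (simp add: power_mult_distrib)
    \<comment> \<open>With S the sum of squares and g the partial vector, |g|^2 \<le> S and S^2
      \<le> |g|^2 K^2; afterwards one factor S cancels.\<close>
    ultimately have "?s * ?s \<le> ?s * K\<^sup>2"
      by (smt (verit) mult_right_mono power2_eq_square zero_le_power2)
    then show ?thesis
      by (metis K(1) mult_le_cancel_left_pos sum_nonneg zero_le_power2 order_le_less)
  qed
  then have "summable (\<lambda>i. (f (e i))\<^sup>2)"
    by (intro bounded_imp_summable[of _ "K\<^sup>2"])
      (simp_all only: lessThan_Suc_atMost[symmetric] zero_le_power2)
  then obtain g where g: "?g \<longlonglongrightarrow> g"
    using onseq_sum_convergent[OF e, of "\<lambda>i. f (e i)"] unfolding convergent_def by blast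
  show thesis
  proof (rule that[of g])
    fix x
    have "(\<lambda>n. f (proj_upto e n x)) \<longlonglongrightarrow> f x"
      by (intro tendsto) (use ce in \<open>auto simp: complete_onseq_def\<close>)
    moreover have "(\<lambda>n. inner x (?g n)) \<longlonglongrightarrow> inner x g" by (intro tendsto_intros g)
    moreover have "f (proj_upto e n x) = inner x (?g n)" for n
      by (simp add: proj_upto_def sum scaleR inner_sum_right mult.commute)
    ultimately show "f x = inner x g" by (simp add: LIMSEQ_unique)
  qed
qed

section \<open>Spectral theorem for nonnegative trace class operators\<close>

text \<open>Common source of the Cauchy-Schwarz inequalities below, for forms that may be
  degenerate. A negative \<open>c\<close> is ruled out by large t; for positive \<open>c\<close> the
  polynomial is evaluated at its minimum.\<close>

lemma quadratic_nonneg_discriminant: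
  fixes a b c :: real
  assumes "\<And>t. 0 \<le> a + 2 * t * b + t\<^sup>2 * c"
  shows "b\<^sup>2 \<le> a * c"
proof (cases "c = 0")
  case True
  have "b = 0"
  proof (rule ccontr)
    assume "b \<noteq> 0"
    \<comment> \<open>With c = 0 this argument gives the polynomial the value -1.\<close>
    with assms[of "- (a + 1) / (2 * b)"] True show False by (simp add: field_simps)
  qed
  then show ?thesis using True by simp
next
  case False
  have "c > 0"
  proof (rule ccontr)
    assume "\<not> c > 0"
    with False have c: "c < 0" by simp
    \<comment> \<open>Large enough that t^2 |c| exceeds |a| + 2 t |b|; the 1 in the numerator makes
      the comparison strict, and the last summand ensures t \<ge> 1.\<close>
    define t where "t = (1 + \<bar>a\<bar> + 2 * \<bar>b\<bar>) / \<bar>c\<bar> + 1"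
    have "0 \<le> (1 + \<bar>a\<bar> + 2 * \<bar>b\<bar>) / \<bar>c\<bar>" by (intro divide_nonneg_nonneg) auto
    then have t1: "t \<ge> 1" unfolding t_def by linarith
    have "t * \<bar>c\<bar> \<ge> 1 + \<bar>a\<bar> + 2 * \<bar>b\<bar>" unfolding t_def using c by (simp add: field_simps)
    then have "t * (t * \<bar>c\<bar>) \<ge> t * (1 + \<bar>a\<bar> + 2 * \<bar>b\<bar>)" using t1 by (intro mult_left_mono) auto
    moreover have "t * (1 + \<bar>a\<bar>) \<ge> 1 * (1 + \<bar>a\<bar>)" using t1 by (intro mult_right_mono) auto
    moreover have "t * b \<le> t * \<bar>b\<bar>" using t1 by (intro mult_left_mono) simp_all
    moreover have "a \<le> \<bar>a\<bar>" by simp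
    moreover have "t\<^sup>2 * c = - (t * (t * \<bar>c\<bar>))" using c by (simp add: power2_eq_square)
    ultimately show False using assms[of t] t1 by (simp only: distrib_left)
  qed
  with assms[of "- b / c"] show ?thesis by (simp add: field_simps power2_eq_square)
qed

lemma nonneg_symmetricD:
  assumes "nonneg_symmetric C"
  shows "inner (C x) y = inner x (C y)" "0 \<le> inner (C x) x"
  using assms unfolding nonneg_symmetric_def by blast+

lemma nonneg_symmetric_cauchy_schwarz:
  assumes "nonneg_symmetric C"
  shows "(inner (C x) y)\<^sup>2 \<le> inner (C x) x * inner (C y) y"
proof (rule quadratic_nonneg_discriminant)
  fix t
  have "0 \<le> inner (C (x + t *\<^sub>R y)) (x + t *\<^sub>R y)" using assms unfolding nonneg_symmetric_def by blast
  also have "\<dots> = inner (C x) x + t * (inner (C x) y + inner (C y) x) + t\<^sup>2 * inner (C y) y"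
    by (simp add: blinfun.add_right blinfun.scaleR_right inner_add_left inner_add_right
        power2_eq_square algebra_simps)
  also have "inner (C y) x = inner (C x) y"
    using assms by (simp add: nonneg_symmetric_def inner_commute)
  finally show "0 \<le> inner (C x) x + 2 * t * inner (C x) y + t\<^sup>2 * inner (C y) y"
    by (simp add: algebra_simps)
qed

text \<open>Cauchy-Schwarz for the form of \<open>C\<close> at the pair \<open>x\<close>,
  \<open>C x\<close>. Only a bound on the form at the vector \<open>C x\<close> enters, so
  \<open>s\<close> may be a supremum over an invariant subspace.\<close>

lemma nonneg_symmetric_norm_bound:
  assumes C: "nonneg_symmetric C" and s: "inner (C (C x)) (C x) \<le> s * (norm (C x))\<^sup>2"
  shows "(norm (C x))\<^sup>2 \<le> s * inner (C x) x"
proof (cases "C x = 0")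
  case False
  have "(norm (C x))\<^sup>2 * (norm (C x))\<^sup>2 = (inner (C x) (C x))\<^sup>2"
    unfolding power2_norm_eq_inner by (simp add: power2_eq_square)
  also have "\<dots> \<le> inner (C x) x * inner (C (C x)) (C x)"
    by (rule nonneg_symmetric_cauchy_schwarz[OF C])
  also have "\<dots> \<le> inner (C x) x * (s * (norm (C x))\<^sup>2)"
    using C s by (intro mult_left_mono) (auto simp: nonneg_symmetric_def)
  finally have "(norm (C x))\<^sup>2 * (norm (C x))\<^sup>2 \<le> (s * inner (C x) x) * (norm (C x))\<^sup>2"
    by (simp add: ac_simps)
  then show ?thesis by (rule mult_right_le_imp_le) (use False in simp)
qed simp

lemma nonneg_symmetric_norm_bound':
  assumes C: "nonneg_symmetric C"
  shows "(norm (C x))\<^sup>2 \<le> norm C * inner (C x) x"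
proof (rule nonneg_symmetric_norm_bound[OF C])
  have "inner (C (C x)) (C x) \<le> norm (C (C x)) * norm (C x)" by (rule norm_cauchy_schwarz)
  also have "\<dots> \<le> norm C * norm (C x) * norm (C x)"
    by (intro mult_right_mono norm_blinfun) auto
  finally show "inner (C (C x)) (C x) \<le> norm C * (norm (C x))\<^sup>2"
    by (simp add: power2_eq_square ac_simps)
qed

section \<open>Compactness of nonnegative trace class operators\<close>

lemma summable_on_onseq:
  fixes f :: "'a::real_inner \<Rightarrow> real"
  assumes e: "onseq e" and f: "f summable_on (range e - {0})" "f 0 = 0"
  shows "summable (\<lambda>i. f (e i))"
proof -
  let ?J = "{i. e i \<noteq> 0}"
  have inj: "inj_on e ?J"
  proof (rule inj_onI, rule ccontr)
    fix i j assume "i \<in> ?J" "j \<in> ?J" "e i = e j" "i \<noteq> j"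
    then show False using e unfolding onseq_def by (metis inner_eq_zero_iff mem_Collect_eq)
  qed
  have "bij_betw e ?J (range e - {0})" using inj by (auto simp: bij_betw_def)
  then have "(\<lambda>i. f (e i)) summable_on ?J" using f(1) by (simp add: summable_on_reindex_bij_betw)
  then have "(\<lambda>i. f (e i)) summable_on UNIV"
    by (rule summable_on_cong_neutral[THEN iffD1, rotated -1]) (auto simp: f(2))
  then show ?thesis by (rule summable_on_imp_summable)
qed

lemma L1_plus_summable:
  assumes "C \<in> L1_plus" and "complete_onseq e"
  shows "summable (\<lambda>i. inner (C (e i)) (e i))"
  by (rule summable_on_onseq[where f = "\<lambda>x. inner (C x) x"])
    (use assms complete_onseq_hilbert_basis[OF assms(2)] in
      \<open>auto simp: L1_plus_def nonneg_symmetric_def complete_onseq_def\<close>)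

text \<open>Only weak convergence against the countable family \<open>d\<close> is extracted, by a
  diagonal argument on bounded scalar sequences.\<close>

lemma bounded_weakly_convergent_subsequence:
  fixes x d :: "nat \<Rightarrow> 'a::real_inner"
  assumes x: "\<And>n. norm (x n) \<le> 1"
  obtains r :: "nat \<Rightarrow> nat" where "strict_mono r" "\<And>i. convergent (\<lambda>n. inner (x (r n)) (d i))"
proof -
  interpret s: subseqs "\<lambda>i s. convergent (\<lambda>n. inner (x (s n)) (d i))"
  proof
    fix i and s :: "nat \<Rightarrow> nat" assume "strict_mono s"
    have "\<bar>inner (x (s n)) (d i)\<bar> \<le> 1 * norm (d i)" for n
      by (rule order_trans[OF Cauchy_Schwarz_ineq2]) (intro mult_right_mono x norm_ge_zero)
    then have "bounded (range (\<lambda>n. inner (x (s n)) (d i)))"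
      unfolding bounded_iff by (intro exI[of _ "norm (d i)"]) auto
    then obtain l r where "strict_mono r" "((\<lambda>n. inner (x (s n)) (d i)) \<circ> r) \<longlonglongrightarrow> l"
      using bounded_imp_convergent_subsequence by blast
    then show "\<exists>r'. strict_mono r' \<and> convergent (\<lambda>n. inner (x ((s \<circ> r') n)) (d i))"
      unfolding convergent_def o_def by blast
  qed
  \<comment> \<open>The diagonal sequence is a subsequence of the \<open>i\<close>-th one only from
    index \<open>Suc i\<close> on; the initial segment is discarded here and restored below.\<close>
  have "convergent (\<lambda>n. inner (x ((s.diagseq \<circ> (+) (Suc i)) n)) (d i))" for i
  proof (rule s.diagseq_holds)
    fix r s :: "nat \<Rightarrow> nat" and n assume r: "strict_mono r" and "convergent (\<lambda>k. inner (x (s k)) (d n))"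
    then obtain l where "(\<lambda>k. inner (x (s k)) (d n)) \<longlonglongrightarrow> l" by (auto simp: convergent_def)
    from LIMSEQ_subseq_LIMSEQ[OF this r]
    show "convergent (\<lambda>k. inner (x ((s \<circ> r) k)) (d n))" by (auto simp: convergent_def o_def)
  qed
  then have "convergent (\<lambda>n. inner (x (s.diagseq (n + Suc i))) (d i))" for i
    unfolding o_def by (subst add.commute)
  then have "convergent (\<lambda>n. inner (x (s.diagseq n)) (d i))" for i
    using convergent_ignore_initial_segment[of "\<lambda>n. inner (x (s.diagseq n)) (d i)" "Suc i"] by blast
  with s.subseq_diagseq that show thesis by blast
qed

text \<open>Trace class makes \<open>C\<close> Hilbert-Schmidt, since |C d|^2 is at most a multiple
  of <C d, d>. Hence, uniformly on the unit ball, \<open>C\<close> is close to its composition with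
  a projection onto finitely many coordinates, where weak convergence suffices.\<close>

lemma L1_plus_compact:
  fixes C :: "'a::{real_inner, banach, second_countable_topology} \<Rightarrow>\<^sub>L 'a"
  assumes C: "C \<in> L1_plus" and x: "\<And>n. norm (x n) \<le> 1"
  obtains r :: "nat \<Rightarrow> nat" where "strict_mono r" "convergent (\<lambda>n. C (x (r n)))"
proof -
  obtain d :: "nat \<Rightarrow> 'a" where d: "complete_onseq d" using complete_onseq_exists by blast
  obtain r where r: "strict_mono r" "\<And>i. convergent (\<lambda>n. inner (x (r n)) (d i))"
    using bounded_weakly_convergent_subsequence[of x d] x by blast
  have ns: "nonneg_symmetric C" using C by (simp add: L1_plus_def)
  have sm: "summable (\<lambda>i. (norm (C (d i)))\<^sup>2)"
    by (rule summable_comparison_test'[OF summable_mult[OF L1_plus_summable[OF C d], of "norm C"], of 0])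
      (use nonneg_symmetric_norm_bound'[OF ns] in auto)
  have os: "onseq d" using d by (simp add: complete_onseq_def)
  have tail: "norm (C u - C (proj_upto d M u)) \<le> norm u * \<epsilon>"
    if M: "\<And>m n. m \<ge> M \<Longrightarrow> norm (\<Sum>i\<in>{m..<n}. (norm (C (d i)))\<^sup>2) < \<epsilon>\<^sup>2" and "\<epsilon> > 0" for u M \<epsilon>
  proof -
    have b: "norm (C (proj_upto d N u) - C (proj_upto d M u)) \<le> norm u * \<epsilon>" if "N \<ge> M" for N
    proof -
      have "C (proj_upto d N u) - C (proj_upto d M u) = (\<Sum>i\<in>{M..<N}. inner u (d i) *\<^sub>R C (d i))"
        unfolding blinfun.diff_right[symmetric] proj_upto_diff[OF that]
        by (simp add: blinfun.sum_right blinfun.scaleR_right)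
      also have "norm \<dots> \<le> (\<Sum>i\<in>{M..<N}. \<bar>inner u (d i)\<bar> * norm (C (d i)))"
        by (rule order_trans[OF norm_sum]) simp
      \<comment> \<open>Cauchy-Schwarz separates the coordinates of \<open>u\<close>, bounded by
        Bessel, from the Hilbert-Schmidt tail.\<close>
      also have "\<dots> \<le> L2_set (\<lambda>i. inner u (d i)) {M..<N} * L2_set (\<lambda>i. norm (C (d i))) {M..<N}"
        using L2_set_mult_ineq[of "\<lambda>i. inner u (d i)" "\<lambda>i. norm (C (d i))"] by simp
      also have "\<dots> \<le> norm u * \<epsilon>"
      proof (rule mult_mono)
        have "(\<Sum>i\<in>{M..<N}. (inner u (d i))\<^sup>2) \<le> (\<Sum>i<N. (inner u (d i))\<^sup>2)"
          by (rule sum_mono2) auto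
        also have "\<dots> \<le> (norm u)\<^sup>2" by (rule bessel[OF os])
        finally show "L2_set (\<lambda>i. inner u (d i)) {M..<N} \<le> norm u"
          unfolding L2_set_def by (simp add: real_le_lsqrt)
        show "L2_set (\<lambda>i. norm (C (d i))) {M..<N} \<le> \<epsilon>"
          unfolding L2_set_def using M[OF order_refl, of N] \<open>\<epsilon> > 0\<close> 
          by (intro real_le_lsqrt) (auto intro: sum_nonneg simp: abs_less_iff)
      qed auto
      finally show ?thesis .
    qed
    have "(\<lambda>N. norm (C (proj_upto d N u) - C (proj_upto d M u))) \<longlonglongrightarrow> norm (C u - C (proj_upto d M u))"
      by (intro tendsto_intros) (use d in \<open>auto simp: complete_onseq_def\<close>)
    then show ?thesis
      by (rule Lim_bounded[where M = M]) (use b in auto)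
  qed
  have "Cauchy (\<lambda>n. C (x (r n)))"
  proof (rule metric_CauchyI)
    fix \<epsilon> :: real assume "\<epsilon> > 0"
    then have "(\<epsilon> / 4)\<^sup>2 > 0" by simp
    then obtain M where M: "\<And>m n. m \<ge> M \<Longrightarrow> norm (\<Sum>i\<in>{m..<n}. (norm (C (d i)))\<^sup>2) < (\<epsilon>/4)\<^sup>2"
      using sm unfolding summable_Cauchy by blast
    have "convergent (\<lambda>n. C (proj_upto d M (x (r n))))"
    proof -
      obtain l where l: "\<And>i. (\<lambda>n. inner (x (r n)) (d i)) \<longlonglongrightarrow> l i"
        using r(2) unfolding convergent_def by metis
      have "(\<lambda>n. C (proj_upto d M (x (r n)))) \<longlonglongrightarrow> C (\<Sum>i<M. l i *\<^sub>R d i)"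
        unfolding proj_upto_def by (intro tendsto_intros l)
      then show ?thesis by (auto simp: convergent_def)
    qed
    then have "Cauchy (\<lambda>n. C (proj_upto d M (x (r n))))" by (rule convergent_Cauchy)
    then obtain K where K: "\<And>m n. m \<ge> K \<Longrightarrow> n \<ge> K \<Longrightarrow>
        dist (C (proj_upto d M (x (r m)))) (C (proj_upto d M (x (r n)))) < \<epsilon> / 2"
      using \<open>\<epsilon> > 0\<close> by (metis half_gt_zero metric_CauchyD)
    have t: "norm (C (x n) - C (proj_upto d M (x n))) \<le> \<epsilon> / 4" for n
    proof -
      have "norm (C (x n) - C (proj_upto d M (x n))) \<le> norm (x n) * (\<epsilon> / 4)"
        by (rule tail[OF M]) (use \<open>\<epsilon> > 0\<close> in auto)
      also have "\<dots> \<le> 1 * (\<epsilon> / 4)" using x[of n] \<open>\<epsilon> > 0\<close> by (intro mult_right_mono) auto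
      finally show ?thesis by simp
    qed
    have "dist (C (x (r m))) (C (x (r n))) < \<epsilon>" if "m \<ge> K" "n \<ge> K" for m n
    proof -
      have "C (x (r m)) - C (x (r n)) =
        (C (x (r m)) - C (proj_upto d M (x (r m)))) + (C (proj_upto d M (x (r m))) - C (proj_upto d M (x (r n))))
        - (C (x (r n)) - C (proj_upto d M (x (r n))))" by simp
      then have "norm (C (x (r m)) - C (x (r n))) \<le>
         norm (C (x (r m)) - C (proj_upto d M (x (r m)))) + 
         norm (C (proj_upto d M (x (r m))) - C (proj_upto d M (x (r n))))
        + norm (C (x (r n)) - C (proj_upto d M (x (r n))))"
        by (simp only:) (intro norm_triangle_le_diff add_right_mono norm_triangle_ineq)
      with t[of "r m"] t[of "r n"] K[OF that] show ?thesis by (simp add: dist_norm)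
    qed
    then show "\<exists>K. \<forall>m\<ge>K. \<forall>n\<ge>K. dist (C (x (r m))) (C (x (r n))) < \<epsilon>" by blast
  qed
  then show thesis using that[OF r(1)] Cauchy_convergent by blast
qed

text \<open>The quadratic form attains its supremum \<open>s\<close> on the unit sphere of
  \<open>W\<close>: a maximizing sequence consists of approximate eigenvectors, and compactness of
  \<open>C\<close> makes a subsequence converge.\<close>

lemma L1_plus_eigenvector:
  fixes C :: "'a::{real_inner, banach, second_countable_topology} \<Rightarrow>\<^sub>L 'a"
  assumes C: "C \<in> L1_plus" and W: "subspace W" "closed W" "\<And>x. x \<in> W \<Longrightarrow> C x \<in> W"
    and w: "w \<in> W" "C w \<noteq> 0"
  obtains x s where "x \<in> W" "norm x = 1" "C x = s *\<^sub>R x"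
proof -
  have ns: "nonneg_symmetric C" using C by (simp add: L1_plus_def)
  let ?q = "\<lambda>x. inner (C x) x"
  let ?B = "?q ` {x \<in> W. norm x = 1}"
  define s where "s = Sup ?B"
  have le: "?q x \<le> norm C" if "norm x = 1" for x
  proof -
    have "?q x \<le> norm (C x) * norm x" by (rule norm_cauchy_schwarz)
    with norm_blinfun[of C x] that show ?thesis by simp
  qed
  then have bdd: "bdd_above ?B" by (auto intro!: bdd_aboveI2)
  have q_le: "?q y \<le> s * (norm y)\<^sup>2" if "y \<in> W" for y
  proof (cases "y = 0")
    case False
    have "y /\<^sub>R norm y \<in> {x \<in> W. norm x = 1}" using that W(1) False by (simp add: subspace_scale)
    then have "?q (y /\<^sub>R norm y) \<le> s" unfolding s_def by (intro cSup_upper[OF _ bdd] imageI)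
    with False show ?thesis by (simp add: blinfun.scaleR_right field_simps power2_eq_square)
  qed simp
  have "w \<noteq> 0" using w(2) by auto
  \<comment> \<open>Positivity is needed to recover the limit of \<open>x\<close> from that of
    \<open>C x\<close>; this is where \<open>C w \<noteq> 0\<close> enters.\<close>
  have "s > 0"
  proof -
    have "0 < (norm (C w))\<^sup>2" using w(2) by simp
    also have "\<dots> \<le> s * inner (C w) w"
      by (rule nonneg_symmetric_norm_bound[OF ns]) (intro q_le W w)
    finally have "0 < s * inner (C w) w" .
    moreover have "inner (C w) w \<ge> 0" by (rule nonneg_symmetricD[OF ns])
    ultimately show ?thesis by (auto simp: zero_less_mult_iff)
  qed
  have ne: "?B \<noteq> {}"
  proof -
    have "w /\<^sub>R norm w \<in> {x \<in> W. norm x = 1}" using w(1) W(1) \<open>w \<noteq> 0\<close> by (simp add: subspace_scale)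
    then show ?thesis by blast
  qed
  have "\<exists>x\<in>W. norm x = 1 \<and> ?q x > s - 1 / real (Suc n)" for n
    using less_cSup_iff[OF ne bdd, of "s - 1 / real (Suc n)"] by (auto simp: s_def)
  then obtain x where x: "\<And>n. x n \<in> W" "\<And>n. norm (x n) = 1"
      "\<And>n. ?q (x n) > s - 1 / real (Suc n)" by metis
  obtain r :: "nat \<Rightarrow> nat" where r: "strict_mono r" "convergent (\<lambda>n. C (x (r n)))"
    using L1_plus_compact[OF C, of x] x(2) by (metis order_refl)
  have b: "(norm (C (x n) - s *\<^sub>R x n))\<^sup>2 \<le> s * (1 / real (Suc n))" for n
  proof -
    have "(norm (C (x n) - s *\<^sub>R x n))\<^sup>2 = (norm (C (x n)))\<^sup>2 - 2 * s * ?q (x n) + s\<^sup>2"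
      using x(2)[of n] unfolding power2_norm_eq_inner norm_eq_1
      by (simp add: inner_diff_left inner_diff_right inner_commute power2_eq_square)
    moreover have "(norm (C (x n)))\<^sup>2 \<le> s * ?q (x n)"
      by (rule nonneg_symmetric_norm_bound[OF ns]) (intro q_le W x)
    ultimately have "(norm (C (x n) - s *\<^sub>R x n))\<^sup>2 \<le> s * (s - ?q (x n))"
      by (simp add: algebra_simps power2_eq_square)
    also have "\<dots> \<le> s * (1 / real (Suc n))"
      using x(3)[of n] \<open>s > 0\<close> by (intro mult_left_mono) auto
    finally show ?thesis .
  qed
  have l: "(\<lambda>n. s * (1 / real (Suc n))) \<longlonglongrightarrow> 0"
    using LIMSEQ_inverse_real_of_nat by (intro tendsto_mult_right_zero) (simp add: inverse_eq_divide)
  have "(\<lambda>n. (norm (C (x n) - s *\<^sub>R x n))\<^sup>2) \<longlonglongrightarrow> 0"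
    by (rule tendsto_sandwich[OF _ _ tendsto_const l]) (use b in auto)
  then have "(\<lambda>n. C (x n) - s *\<^sub>R x n) \<longlonglongrightarrow> 0"
    by (simp add: tendsto_norm_zero_iff)
  then have "(\<lambda>n. C (x (r n)) - s *\<^sub>R x (r n)) \<longlonglongrightarrow> 0"
    using LIMSEQ_subseq_LIMSEQ[OF _ r(1)] by (fastforce simp: o_def)
  moreover obtain y where y: "(\<lambda>n. C (x (r n))) \<longlonglongrightarrow> y" using r(2) by (auto simp: convergent_def)
  \<comment> \<open>The vector s x is written as C x minus the eigenvector error; both converge
    along \<open>r\<close>.\<close>
  ultimately have "(\<lambda>n. C (x (r n)) - (C (x (r n)) - s *\<^sub>R x (r n))) \<longlonglongrightarrow> y - 0"
    by (intro tendsto_diff)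
  then have "(\<lambda>n. inverse s *\<^sub>R (s *\<^sub>R x (r n))) \<longlonglongrightarrow> inverse s *\<^sub>R y"
    by (intro tendsto_intros) simp
  then have lim: "(\<lambda>n. x (r n)) \<longlonglongrightarrow> inverse s *\<^sub>R y" using \<open>s > 0\<close> by simp
  show thesis
  proof (rule that[of "inverse s *\<^sub>R y" s])
    show "inverse s *\<^sub>R y \<in> W" using closed_sequentially[OF W(2) _ lim] x(1) by blast
    show "norm (inverse s *\<^sub>R y) = 1"
      using tendsto_norm[OF lim] by (simp add: x(2) LIMSEQ_const_iff)
    have "(\<lambda>n. C (x (r n))) \<longlonglongrightarrow> C (inverse s *\<^sub>R y)" by (intro tendsto_intros lim)
    then have "C (inverse s *\<^sub>R y) = y" using y by (rule LIMSEQ_unique)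
    then show "C (inverse s *\<^sub>R y) = s *\<^sub>R (inverse s *\<^sub>R y)" using \<open>s > 0\<close> by simp
  qed
qed

text \<open>A maximal orthonormal system of eigenvectors has an invariant orthogonal complement. A
  nonzero vector there would produce a further unit eigenvector, either because \<open>C\<close>
  kills it or by the preceding lemma.\<close>

lemma L1_plus_eigenbasis:
  fixes C :: "'a::{real_inner, banach, second_countable_topology} \<Rightarrow>\<^sub>L 'a"
  assumes C: "C \<in> L1_plus"
  obtains e l where "complete_onseq e" "\<And>i. C (e i) = l i *\<^sub>R e i" "\<And>i. l i \<ge> 0" "summable l"
proof -
  have ns: "nonneg_symmetric C" using C by (simp add: L1_plus_def)
  obtain e :: "nat \<Rightarrow> 'a" where e: "onseq e" "\<And>i. e i = 0 \<or> (\<exists>l. C (e i) = l *\<^sub>R e i)"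
    "\<And>x. \<exists>l. C x = l *\<^sub>R x \<Longrightarrow> norm x = 1 \<Longrightarrow> \<exists>i. inner x (e i) \<noteq> 0"
    using maximal_onseq[where p = "\<lambda>x. \<exists>l. C x = l *\<^sub>R x"] by metis
  define l where "l i = inner (C (e i)) (e i)" for i
  have Ce: "C (e i) = l i *\<^sub>R e i" for i
  proof (cases "e i = 0")
    case False
    then have "inner (e i) (e i) = 1" using e(1) by (auto simp: onseq_def norm_eq_1)
    then show ?thesis using e(2)[of i] False by (auto simp: l_def)
  qed (simp add: l_def)
  define W where "W = {x. \<forall>i. inner x (e i) = 0}"
  have W: "subspace W" "closed W"
  proof -
    show "subspace W" by (auto simp: W_def subspace_def inner_add_left)
    have "W = (\<Inter>i. {x. inner x (e i) = 0})" by (auto simp: W_def)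
    then show "closed W" by (auto intro!: closed_INT closed_Collect_eq continuous_intros)
  qed
  have inv: "C x \<in> W" if "x \<in> W" for x
  proof -
    have "inner (C x) (e i) = inner x (C (e i))" for i using ns by (simp add: nonneg_symmetric_def)
    then show ?thesis using that by (simp add: W_def Ce)
  qed
  have W0: "x = 0" if x: "x \<in> W" for x
  proof (rule ccontr)
    assume "x \<noteq> 0"
    have "\<exists>y\<in>W. norm y = 1 \<and> (\<exists>l. C y = l *\<^sub>R y)"
    proof (cases "C x = 0")
      case True
      have "x /\<^sub>R norm x \<in> W" using x W(1) by (simp add: subspace_scale)
      moreover have "C (x /\<^sub>R norm x) = 0 *\<^sub>R (x /\<^sub>R norm x)" using True by (simp add: blinfun.scaleR_right)
      ultimately show ?thesis using \<open>x \<noteq> 0\<close> by (intro bexI[of _ "x /\<^sub>R norm x"]) (auto intro: exI[of _ 0])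
    next
      case False
      then show ?thesis using L1_plus_eigenvector[OF C W inv x] by metis
    qed
    then show False using e(3) by (auto simp: W_def)
  qed
  have "(\<lambda>n. proj_upto e n x) \<longlonglongrightarrow> x" for x
  proof -
    obtain p where p: "(\<lambda>n. proj_upto e n x) \<longlonglongrightarrow> p" "\<And>i. inner (x - p) (e i) = 0"
      using proj_convergent[OF e(1), of x] by blast
    then have "x - p \<in> W" by (simp add: W_def)
    from W0[OF this] p(1) show ?thesis by simp
  qed
  then have ce: "complete_onseq e" using e(1) by (simp add: complete_onseq_def)
  have "l i \<ge> 0" for i unfolding l_def by (rule nonneg_symmetricD[OF ns])
  moreover have "summable l" using L1_plus_summable[OF C ce] by (simp add: l_def[abs_def])
  ultimately show thesis using that[OF ce Ce] by blast
qed

section \<open>Uniqueness of characteristic functionals\<close>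

text \<open>The signed measure with density \<open>u\<close> is split into positive and negative
  parts. They have the same mass by the hypothesis at t = 0, so after normalization Levy's
  uniqueness theorem applies to their images under \<open>\<zeta>\<close>.\<close>

lemma signed_char_real:
  fixes u \<zeta> :: "'b \<Rightarrow> real"
  assumes [measurable]: "\<zeta> \<in> borel_measurable M" and u: "integrable M u"
    and c: "\<And>t. (\<integral>x. u x * cos (t * \<zeta> x) \<partial>M) = 0"
    and s: "\<And>t. (\<integral>x. u x * sin (t * \<zeta> x) \<partial>M) = 0"
    and A[measurable]: "A \<in> sets borel"
  shows "(\<integral>x. u x * indicator A (\<zeta> x) \<partial>M) = 0"
proof -
  have [measurable]: "u \<in> borel_measurable M" using u by auto
  define up where "up x = max 0 (u x)" for x
  define un where "un x = max 0 (- u x)" for x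
  have [measurable]: "up \<in> borel_measurable M" "un \<in> borel_measurable M"
    unfolding up_def un_def by measurable
  have uu: "u x = up x - un x" for x by (simp add: up_def un_def)
  have nn: "up x \<ge> 0" "un x \<ge> 0" for x by (simp_all add: up_def un_def)
  have i: "integrable M up" "integrable M un"
    by (rule Bochner_Integration.integrable_bound[OF u]; simp add: up_def un_def)+
  have eq: "(\<integral>x. up x \<partial>M) = (\<integral>x. un x \<partial>M)"
  proof -
    have "(\<integral>x. up x - un x \<partial>M) = 0" using c[of 0] by (simp add: uu)
    then show ?thesis using i by simp
  qed
  show ?thesis
  proof (cases "(\<integral>x. up x \<partial>M) = 0")
    case True
    then have "AE x in M. up x = 0" "AE x in M. un x = 0"
      using eq integral_nonneg_eq_0_iff_AE[OF i(1)] integral_nonneg_eq_0_iff_AE[OF i(2)] nn by simp_all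
    then have "AE x in M. u x * indicator A (\<zeta> x) = 0" by eventually_elim (simp add: uu)
    then show ?thesis by (rule integral_eq_zero_AE)
  next
    case False
    define k where "k = (\<integral>x. up x \<partial>M)"
    have k: "k > 0" using False nn by (simp add: k_def integral_nonneg less_le)
    define D where "D v = distr (density M (\<lambda>x. ennreal (v x / k))) borel \<zeta>" for v :: "'b \<Rightarrow> real"
    have rd: "real_distribution (D v)" and
      ch: "char (D v) t = (\<integral>x. (v x / k) *\<^sub>R iexp (t * \<zeta> x) \<partial>M)" and
      me: "measure (D v) A = (\<integral>x. v x / k * indicator A (\<zeta> x) \<partial>M)"
      if [measurable]: "v \<in> borel_measurable M" and v: "integrable M v" "\<And>x. v x \<ge> 0" "(\<integral>x. v x \<partial>M) = k"
      for v t
    proof -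
      have "(\<integral>\<^sup>+x. ennreal (v x / k) \<partial>M) = ennreal (\<integral>x. v x / k \<partial>M)"
        using v k by (intro nn_integral_eq_integral) auto
      also have "(\<integral>x. v x / k \<partial>M) = 1" using v k by simp
      finally have "prob_space (density M (\<lambda>x. ennreal (v x / k)))"
        by (intro prob_spaceI) (simp add: emeasure_density cong: nn_integral_cong)
      then interpret prob_space "density M (\<lambda>x. ennreal (v x / k))" .
      have "prob_space (D v)" unfolding D_def by (rule prob_space_distr) simp
      then show "real_distribution (D v)"
        by (simp add: real_distribution_def real_distribution_axioms_def D_def)
      show "char (D v) t = (\<integral>x. (v x / k) *\<^sub>R iexp (t * \<zeta> x) \<partial>M)"
        unfolding char_def D_def using v k
        by (subst integral_distr) (auto simp: integral_density)
      have "measure (D v) A = (\<integral>y. indicator A y \<partial>(D v))" by (simp add: D_def)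
      also have "\<dots> = (\<integral>x. v x / k * indicator A (\<zeta> x) \<partial>M)"
        unfolding D_def using v k by (subst integral_distr) (auto simp: integral_density)
      finally show "measure (D v) A = (\<integral>x. v x / k * indicator A (\<zeta> x) \<partial>M)" .
    qed
    have ci: "integrable M (\<lambda>x. (v x / k) *\<^sub>R iexp (t * \<zeta> x))" 
      if [measurable]: "v \<in> borel_measurable M" and v: "integrable M v" for v t
    proof (rule Bochner_Integration.integrable_bound[where f = "\<lambda>x. v x / k"])
      show "(\<lambda>x. (v x / k) *\<^sub>R iexp (t * \<zeta> x)) \<in> borel_measurable M" by measurable
    qed (use v in auto)
    have "char (D up) = char (D un)"
    proof
      fix t
      have "char (D up) t - char (D un) t = (\<integral>x. (u x / k) *\<^sub>R iexp (t * \<zeta> x) \<partial>M)"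
        using i nn k_def eq ci[of up t] ci[of un t]
        by (simp add: ch uu diff_divide_distrib scaleR_left_diff_distrib flip: Bochner_Integration.integral_diff)
      also have "\<dots> = 0"
      proof (rule complex_eqI)
        have 1: "integrable M (\<lambda>x. (u x / k) *\<^sub>R iexp (t * \<zeta> x))" by (rule ci) (use u in auto)
        have "Re (\<integral>x. (u x / k) *\<^sub>R iexp (t * \<zeta> x) \<partial>M) = (\<integral>x. u x * cos (t * \<zeta> x) / k \<partial>M)"
          by (subst integral_Re[OF 1, symmetric]) (simp add: Re_exp)
        then show "Re (\<integral>x. (u x / k) *\<^sub>R iexp (t * \<zeta> x) \<partial>M) = Re 0" using c[of t] by simp
        have "Im (\<integral>x. (u x / k) *\<^sub>R iexp (t * \<zeta> x) \<partial>M) = (\<integral>x. u x * sin (t * \<zeta> x) / k \<partial>M)"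
          by (subst integral_Im[OF 1, symmetric]) (simp add: Im_exp)
        then show "Im (\<integral>x. (u x / k) *\<^sub>R iexp (t * \<zeta> x) \<partial>M) = Im 0" using s[of t] by simp
      qed
      finally show "char (D up) t = char (D un) t" by simp
    qed
    then have "D up = D un"
      by (intro Levy_uniqueness rd) (use i nn k_def eq in auto)
    then have "measure (D up) A = measure (D un) A" by simp
    then have "(\<integral>x. up x / k * indicator A (\<zeta> x) \<partial>M) = (\<integral>x. un x / k * indicator A (\<zeta> x) \<partial>M)"
      by (subst (asm) (1 2) me) (use i nn k_def eq in auto)
    moreover have ii: "integrable M (\<lambda>x. v x * indicator A (\<zeta> x))" if "integrable M v" for v :: "'b \<Rightarrow> real"
      using that by (rule Bochner_Integration.integrable_bound) (use that in \<open>auto simp: indicator_def\<close>)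
    ultimately have "(\<integral>x. up x * indicator A (\<zeta> x) \<partial>M) = (\<integral>x. un x * indicator A (\<zeta> x) \<partial>M)"
      using k by (simp only: times_divide_eq_left Bochner_Integration.integral_divide_zero) simp
    then show ?thesis using ii[OF i(1)] ii[OF i(2)] by (simp add: uu left_diff_distrib)
  qed
qed

text \<open>Conditions on finitely many inner products, added one at a time because
  \<open>signed_char_unique\<close> imposes them in this way.\<close>

inductive_set cylinder_sets :: "'a::real_inner set set" where
  UNIV_cylinder: "UNIV \<in> cylinder_sets"
| Int_cylinder: "S \<in> cylinder_sets \<Longrightarrow> A \<in> sets borel \<Longrightarrow> S \<inter> {x. inner x g \<in> A} \<in> cylinder_sets"

lemma Int_stable_cylinder_sets: "Int_stable cylinder_sets"
proof (rule Int_stableI)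
  fix S R :: "'a set" assume S: "S \<in> cylinder_sets" and "R \<in> cylinder_sets"
  from this(2) show "S \<inter> R \<in> cylinder_sets"
  proof induct
    case (Int_cylinder R A g)
    from Int_cylinder(2,3) show ?case by (metis Int_assoc cylinder_sets.Int_cylinder)
  qed (use S in simp)
qed

lemma cylinder_sets_borel: "cylinder_sets \<subseteq> sets (borel :: 'a::{real_inner, second_countable_topology} measure)"
proof
  fix S :: "'a set" assume "S \<in> cylinder_sets"
  then show "S \<in> sets borel"
  proof induct
    case (Int_cylinder S A g)
    have "(\<lambda>x. inner x g) -` A \<inter> space borel \<in> sets borel"
      by (rule measurable_sets[OF _ Int_cylinder(3)]) simp
    then have "{x. inner x g \<in> A} \<in> sets borel" by (simp add: vimage_def)
    with Int_cylinder(2) show ?case by blast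
  qed simp
qed

text \<open>Each \<open>proj_upto e n\<close> involves finitely many inner products, and these
  projections converge pointwise to the identity, which is therefore measurable from the cylinder
  sigma-algebra to the Borel one.\<close>

lemma borel_eq_sigma_cylinder_sets:
  "sets (borel :: 'a::{real_inner, banach, second_countable_topology} measure) = sigma_sets UNIV cylinder_sets"
proof
  let ?M = "sigma UNIV (cylinder_sets :: 'a set set)"
  have [measurable]: "(\<lambda>x. inner x g) \<in> borel_measurable ?M" for g :: 'a
  proof (rule measurableI)
    fix A :: "real set" assume "A \<in> sets borel"
    from cylinder_sets.Int_cylinder[OF UNIV_cylinder this, of g]
    show "(\<lambda>x. inner x g) -` A \<inter> space ?M \<in> sets ?M"
      by (auto simp: vimage_def intro: sigma_sets.Basic)
  qed simp
  obtain e :: "nat \<Rightarrow> 'a" where e: "complete_onseq e" using complete_onseq_exists by blast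
  have "(\<lambda>x. proj_upto e n x) \<in> borel_measurable ?M" for n
    unfolding proj_upto_def by measurable
  then have "(\<lambda>x. x) \<in> borel_measurable ?M"
    by (rule borel_measurable_LIMSEQ_metric) (use e in \<open>auto simp: complete_onseq_def\<close>)
  then have "S \<in> sets ?M" if "S \<in> sets borel" for S :: "'a set"
    using measurable_sets[of "\<lambda>x. x" ?M borel S] that by simp
  then show "sets (borel :: 'a measure) \<subseteq> sigma_sets UNIV cylinder_sets" by auto
  show "sigma_sets UNIV cylinder_sets \<subseteq> sets (borel :: 'a measure)"
    using sets.sigma_sets_subset[OF cylinder_sets_borel] by simp
qed

text \<open>Restricting \<open>u\<close> by a condition on one further inner product preserves the
  vanishing of all trigonometric integrals: by the product formulas, a second trigonometric factor
  only changes h to h + t g and h - t g, and the one-dimensional case replaces that factor by an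
  indicator. Cylinders follow by iteration, Borel sets by Dynkin's lemma. Keeping
  \<open>\<xi>\<close> apart from the base space allows product spaces below.\<close>

lemma signed_char_unique:
  fixes u :: "'b \<Rightarrow> real" and \<xi> :: "'b \<Rightarrow> 'a::{real_inner, banach, second_countable_topology}"
  assumes \<xi>[measurable]: "\<xi> \<in> borel_measurable M" and u: "integrable M u"
    and c: "\<And>h. (\<integral>x. u x * cos (inner (\<xi> x) h) \<partial>M) = 0"
    and s: "\<And>h. (\<integral>x. u x * sin (inner (\<xi> x) h) \<partial>M) = 0"
    and S: "S \<in> sets borel"
  shows "(\<integral>x. u x * indicator S (\<xi> x) \<partial>M) = 0"
proof -
  have bi: "integrable M (\<lambda>x. u x * b x)" if "integrable M u" "b \<in> borel_measurable M" "\<And>x. \<bar>b x\<bar> \<le> 1"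
    for u b :: "'b \<Rightarrow> real"
    by (rule Bochner_Integration.integrable_bound[OF that(1)])
      (use that in \<open>auto simp: abs_mult mult_left_le\<close>)
  define Z where "Z u \<longleftrightarrow> integrable M u \<and> (\<forall>h. (\<integral>x. u x * cos (inner (\<xi> x) h) \<partial>M) = 0)
     \<and> (\<forall>h. (\<integral>x. u x * sin (inner (\<xi> x) h) \<partial>M) = 0)" for u
  have ZD: "integrable M u" "(\<integral>x. u x * cos (inner (\<xi> x) h) \<partial>M) = 0"
     "(\<integral>x. u x * sin (inner (\<xi> x) h) \<partial>M) = 0" if "Z u" for u h
    using that by (auto simp: Z_def)
  have step: "Z (\<lambda>x. u x * indicator A (inner (\<xi> x) g))" if Z: "Z u" and A[measurable]: "A \<in> sets borel" for u A g
  proof -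
    have [measurable]: "u \<in> borel_measurable M" using ZD(1)[OF Z] by auto
    have ic: "integrable M (\<lambda>x. u x * cos (inner (\<xi> x) h))" 
      and isn: "integrable M (\<lambda>x. u x * sin (inner (\<xi> x) h))" for h
      by (rule bi[OF ZD(1)[OF Z]]; simp)+
    note di = ic isn Bochner_Integration.integral_add[OF ic ic] Bochner_Integration.integral_diff[OF ic ic]
      Bochner_Integration.integral_add[OF isn isn] Bochner_Integration.integral_diff[OF isn isn]
    have 1: "(\<integral>x. u x * cos (inner (\<xi> x) h) * cos (t * inner (\<xi> x) g) \<partial>M) = 0" for h t
    proof -
      have E: "u x * cos (inner (\<xi> x) h) * cos (t * inner (\<xi> x) g) =
        (u x * cos (inner (\<xi> x) (h - t *\<^sub>R g)) + u x * cos (inner (\<xi> x) (h + t *\<^sub>R g))) / 2" for x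
        by (simp add: mult.assoc cos_times_cos inner_diff_right inner_add_right distrib_left)
      show ?thesis unfolding E by (simp add: di ZD(2,3)[OF Z])
    qed
    have 2: "(\<integral>x. u x * cos (inner (\<xi> x) h) * sin (t * inner (\<xi> x) g) \<partial>M) = 0" for h t
    proof -
      have E: "u x * cos (inner (\<xi> x) h) * sin (t * inner (\<xi> x) g) =
        (u x * sin (inner (\<xi> x) (h + t *\<^sub>R g)) - u x * sin (inner (\<xi> x) (h - t *\<^sub>R g))) / 2" for x
        by (simp add: mult.assoc cos_times_sin inner_diff_right inner_add_right right_diff_distrib)
      show ?thesis unfolding E by (simp add: di ZD(2,3)[OF Z])
    qed
    have 3: "(\<integral>x. u x * sin (inner (\<xi> x) h) * cos (t * inner (\<xi> x) g) \<partial>M) = 0" for h t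
    proof -
      have E: "u x * sin (inner (\<xi> x) h) * cos (t * inner (\<xi> x) g) =
        (u x * sin (inner (\<xi> x) (h + t *\<^sub>R g)) + u x * sin (inner (\<xi> x) (h - t *\<^sub>R g))) / 2" for x
        by (simp add: mult.assoc sin_times_cos inner_diff_right inner_add_right distrib_left)
      show ?thesis unfolding E by (simp add: di ZD(2,3)[OF Z])
    qed
    have 4: "(\<integral>x. u x * sin (inner (\<xi> x) h) * sin (t * inner (\<xi> x) g) \<partial>M) = 0" for h t
    proof -
      have E: "u x * sin (inner (\<xi> x) h) * sin (t * inner (\<xi> x) g) =
        (u x * cos (inner (\<xi> x) (h - t *\<^sub>R g)) - u x * cos (inner (\<xi> x) (h + t *\<^sub>R g))) / 2" for x
        by (simp add: mult.assoc sin_times_sin inner_diff_right inner_add_right right_diff_distrib)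
      show ?thesis unfolding E by (simp add: di ZD(2,3)[OF Z])
    qed
    show ?thesis unfolding Z_def
    proof (intro conjI allI)
      show "integrable M (\<lambda>x. u x * indicator A (inner (\<xi> x) g))"
        by (rule bi[OF ZD(1)[OF Z]]) (auto simp: indicator_def)
      fix h
      have "(\<integral>x. u x * cos (inner (\<xi> x) h) * indicator A (inner (\<xi> x) g) \<partial>M) = 0"
        by (rule signed_char_real[OF _ ic 1 2 A]) simp
      then show "(\<integral>x. u x * indicator A (inner (\<xi> x) g) * cos (inner (\<xi> x) h) \<partial>M) = 0"
        by (simp add: mult_ac)
      have "(\<integral>x. u x * sin (inner (\<xi> x) h) * indicator A (inner (\<xi> x) g) \<partial>M) = 0"
        by (rule signed_char_real[OF _ isn 3 4 A]) simp
      then show "(\<integral>x. u x * indicator A (inner (\<xi> x) g) * sin (inner (\<xi> x) h) \<partial>M) = 0"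
        by (simp add: mult_ac)
    qed
  qed
  have Zu: "Z u" using u c s by (simp add: Z_def)
  have cyl: "Z (\<lambda>x. u x * indicator S (\<xi> x))" if "S \<in> cylinder_sets" for S
    using that
  proof induct
    case UNIV_cylinder
    then show ?case using Zu by simp
  next
    case (Int_cylinder S A g)
    have "indicator (S \<inter> {x. inner x g \<in> A}) y = (indicator S y * indicator A (inner y g) :: real)" for y
      by (auto simp: indicator_def)
    with step[OF Int_cylinder(2,3), of g] show ?case by (simp add: mult.assoc)
  qed
  have [measurable]: "u \<in> borel_measurable M" using u by auto
  have ind: "integrable M (\<lambda>x. u x * indicator S (\<xi> x))" if [measurable]: "S \<in> sets borel" for S
    by (rule bi[OF u]) (auto simp: indicator_def)
  from S[unfolded borel_eq_sigma_cylinder_sets] show ?thesis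
  proof (induct rule: sigma_sets_induct_disjoint[OF Int_stable_cylinder_sets subset_Pow_Union[THEN subset_trans[OF _ Pow_mono[OF subset_UNIV]]], consumes 1, case_names basic empty compl union])
    \<comment> \<open>At h = 0 the cosine is 1, which leaves the plain integral.\<close>
    case (basic S) then show ?case using ZD(2)[OF cyl, of S 0] by simp
  next
    case empty show ?case by simp
  next
    case (compl S)
    then have "S \<in> sets borel" unfolding borel_eq_sigma_cylinder_sets by simp
    have "(\<integral>x. u x * indicator (UNIV - S) (\<xi> x) \<partial>M) = (\<integral>x. u x - u x * indicator S (\<xi> x) \<partial>M)"
      by (rule Bochner_Integration.integral_cong) (auto simp: indicator_def)
    also have "\<dots> = 0" using compl u ind[OF \<open>S \<in> sets borel\<close>] ZD(2)[OF Zu, of 0] by simp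
    finally show ?case .
  next
    case (union S)
    then have [measurable]: "S i \<in> sets borel" for i unfolding borel_eq_sigma_cylinder_sets by auto
    have "(\<lambda>n. \<integral>x. u x * indicator (\<Union>i<n. S i) (\<xi> x) \<partial>M) \<longlonglongrightarrow> (\<integral>x. u x * indicator (\<Union>i. S i) (\<xi> x) \<partial>M)"
    proof (rule integral_dominated_convergence[where w = "\<lambda>x. \<bar>u x\<bar>"])
      show "AE x in M. (\<lambda>n. u x * indicator (\<Union>i<n. S i) (\<xi> x)) \<longlonglongrightarrow> u x * indicator (\<Union>i. S i) (\<xi> x)"
        by (intro AE_I2 tendsto_mult tendsto_const LIMSEQ_indicator_UN)
    qed (use u in \<open>auto simp: indicator_def\<close>)
    moreover have "(\<integral>x. u x * indicator (\<Union>i<n. S i) (\<xi> x) \<partial>M) = 0" for n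
    proof -
      have "(\<integral>x. u x * indicator (\<Union>i<n. S i) (\<xi> x) \<partial>M) = (\<integral>x. (\<Sum>i<n. u x * indicator (S i) (\<xi> x)) \<partial>M)"
      proof (rule Bochner_Integration.integral_cong[OF refl])
        fix x
        have "indicator (\<Union>i<n. S i) (\<xi> x) = (\<Sum>i<n. indicator (S i) (\<xi> x) :: real)"
          using union(1) by (intro indicator_UN_disjoint) (auto simp: disjoint_family_on_def)
        then show "u x * indicator (\<Union>i<n. S i) (\<xi> x) = (\<Sum>i<n. u x * indicator (S i) (\<xi> x))"
          by (simp add: sum_distrib_left)
      qed
      also have "\<dots> = (\<Sum>i<n. \<integral>x. u x * indicator (S i) (\<xi> x) \<partial>M)"
        by (rule Bochner_Integration.integral_sum) (rule ind, simp)
      finally show ?thesis using union(3) by simp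
    qed
    ultimately show ?case by (simp add: LIMSEQ_const_iff)
  qed
qed

text \<open>The difference of the two measures is realized as one signed density on the product with
  a two-point space; the boolean selects both the sign \<open>u\<close> and the position
  \<open>\<xi>\<close>.\<close>

lemma char_unique:
  fixes M1 M2 :: "'a::{real_inner, banach, second_countable_topology} measure"
  assumes "prob_space M1" "prob_space M2" and [measurable_cong, simp]: "sets M1 = sets borel" "sets M2 = sets borel"
    and c: "\<And>h. (\<integral>x. cos (inner x h) \<partial>M1) = (\<integral>x. cos (inner x h) \<partial>M2)"
    and s: "\<And>h. (\<integral>x. sin (inner x h) \<partial>M1) = (\<integral>x. sin (inner x h) \<partial>M2)"
  shows "M1 = M2"
proof -
  interpret M1: prob_space M1 by fact
  interpret M2: prob_space M2 by fact
  interpret P: pair_prob_space M1 M2 ..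
  interpret B: finite_measure "count_space (UNIV :: bool set)" by (rule finite_measure_count_space) simp
  interpret PB: pair_sigma_finite "M1 \<Otimes>\<^sub>M M2" "count_space (UNIV :: bool set)" ..
  let ?M = "(M1 \<Otimes>\<^sub>M M2) \<Otimes>\<^sub>M count_space (UNIV :: bool set)"
  have fin: "finite_measure ?M"
    by (rule finite_measureI) (metis B.emeasure_finite B.emeasure_pair_measure_Times P.emeasure_finite
        ennreal_mult_eq_top_iff sets.top space_pair_measure infinity_ennreal_def)
  interpret F: finite_measure ?M by (rule fin)
  have [measurable]: "Measurable.pred ?M snd" by (rule measurable_snd)
  define \<xi> where "\<xi> p = (if snd p then fst (fst p) else snd (fst p))" for p :: "('a \<times> 'a) \<times> bool"
  define u where "u p = (if snd p then 1 else - 1 :: real)" for p :: "('a \<times> 'a) \<times> bool"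
  have [measurable]: "\<xi> \<in> borel_measurable ?M" unfolding \<xi>_def by measurable
  have [measurable]: "u \<in> borel_measurable ?M" unfolding u_def by measurable
  have eq: "(\<integral>p. u p * f (\<xi> p) \<partial>?M) = (\<integral>x. f x \<partial>M1) - (\<integral>x. f x \<partial>M2)"
    if [measurable]: "f \<in> borel_measurable borel" and f: "\<And>x. \<bar>f x\<bar> \<le> 1" for f :: "'a \<Rightarrow> real"
  proof -
    have i: "integrable ?M (\<lambda>p. u p * f (\<xi> p))"
      by (rule F.integrable_const_bound[where B = 1]) (auto simp: f abs_mult u_def)
    have "(\<integral>p. u p * f (\<xi> p) \<partial>?M) = (\<integral>q. (\<integral>b. u (q, b) * f (\<xi> (q, b)) \<partial>count_space UNIV) \<partial>(M1 \<Otimes>\<^sub>M M2))"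
      by (rule PB.integral_fst'[OF i, symmetric])
    also have "\<dots> = (\<integral>q. f (fst q) - f (snd q) \<partial>(M1 \<Otimes>\<^sub>M M2))"
      by (intro Bochner_Integration.integral_cong refl)
        (auto simp: lebesgue_integral_count_space_finite UNIV_bool u_def \<xi>_def)
    also have "\<dots> = (\<integral>q. f (fst q) \<partial>(M1 \<Otimes>\<^sub>M M2)) - (\<integral>q. f (snd q) \<partial>(M1 \<Otimes>\<^sub>M M2))"
      by (intro Bochner_Integration.integral_diff P.integrable_const_bound[where B = 1]) (auto simp: f)
    also have "(\<integral>q. f (fst q) \<partial>(M1 \<Otimes>\<^sub>M M2)) = (\<integral>x. f x \<partial>M1)"
      by (subst M2.distr_pair_fst[of M1, symmetric], subst integral_distr) simp_all
    also have "(\<integral>q. f (snd q) \<partial>(M1 \<Otimes>\<^sub>M M2)) = (\<integral>x. f x \<partial>M2)"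
    proof -
      have "(\<integral>q. f (snd q) \<partial>(M1 \<Otimes>\<^sub>M M2)) = (\<integral>x. (\<integral>y. f y \<partial>M2) \<partial>M1)"
        by (subst P.integral_fst'[symmetric]) (auto intro!: P.integrable_const_bound[where B = 1] simp: f)
      then show ?thesis by (simp add: M1.prob_space)
    qed
    finally show ?thesis .
  qed
  have "integrable ?M u"
    by (rule F.integrable_const_bound[where B = 1]) (simp_all, auto simp: u_def)
  note z = signed_char_unique[OF \<open>\<xi> \<in> borel_measurable ?M\<close> this]
  show ?thesis
  proof (rule measure_eqI)
    fix S assume "S \<in> sets M1"
    then have S[measurable]: "S \<in> sets borel" by simp
    have "(\<integral>p. u p * indicator S (\<xi> p) \<partial>?M) = 0"
      by (rule z[OF _ _ S]; subst eq) (simp_all add: c s)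
    then have "measure M1 S = measure M2 S" by (subst (asm) eq) (auto simp: indicator_def)
    then show "emeasure M1 S = emeasure M2 S"
      by (simp add: M1.emeasure_eq_measure M2.emeasure_eq_measure)
  qed simp
qed

section \<open>Gaussian measures and resampling of a coordinate\<close>

lemma normal_law_trig:
  assumes "v \<ge> 0"
  shows "(\<integral>y. cos y \<partial>normal_law v) = exp (- v / 2)" "(\<integral>y. sin y \<partial>normal_law v) = 0"
proof -
  have "(\<integral>y. cos y \<partial>normal_law v) = exp (- v / 2) \<and> (\<integral>y. sin y \<partial>normal_law v) = 0"
  proof (cases "v = 0")
    case True
    then show ?thesis by (simp add: normal_law_def integral_return)
  next
    case False
    with assms have v: "sqrt v > 0" by simp
    interpret std: prob_space std_normal_distribution by (rule prob_space_normal_density) simp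
    have "distributed std_normal_distribution lborel (\<lambda>x. x) std_normal_density"
      by (auto simp: distributed_def distr_id2)
    from std.normal_density_affine[OF this _ , of "sqrt v" 0]
    have "distributed std_normal_distribution lborel (\<lambda>x. sqrt v * x) (normal_density 0 (sqrt v))"
      using v by simp
    then have d: "normal_law v = distr std_normal_distribution lborel (\<lambda>x. sqrt v * x)"
      using False by (simp add: distributed_def normal_law_def)
    have C: "(\<integral>x. iexp (sqrt v * x) \<partial>std_normal_distribution) = exp (- v / 2)"
      using char_std_normal_distribution v unfolding char_def fun_eq_iff
      by (auto dest!: spec[of _ "sqrt v"])
    have i: "integrable std_normal_distribution (\<lambda>x. iexp (sqrt v * x))"
      by (rule std.integrable_const_bound[where B = 1]) auto
    have "(\<integral>y. cos y \<partial>normal_law v) = (\<integral>x. Re (iexp (sqrt v * x)) \<partial>std_normal_distribution)"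
      unfolding d by (subst integral_distr) (auto simp: Re_exp)
    also have "\<dots> = exp (- v / 2)" by (subst integral_Re[OF i]) (simp only: C Re_complex_of_real)
    finally have 1: "(\<integral>y. cos y \<partial>normal_law v) = exp (- v / 2)" .
    have "(\<integral>y. sin y \<partial>normal_law v) = (\<integral>x. Im (iexp (sqrt v * x)) \<partial>std_normal_distribution)"
      unfolding d by (subst integral_distr) (auto simp: Im_exp)
    also have "\<dots> = 0" by (subst integral_Im[OF i]) (simp only: C Im_complex_of_real)
    finally show ?thesis using 1 by simp
  qed
  then show "(\<integral>y. cos y \<partial>normal_law v) = exp (- v / 2)" "(\<integral>y. sin y \<partial>normal_law v) = 0" by auto
qed

lemma centred_gaussian_trig:
  fixes C :: "'a::{real_inner, second_countable_topology} \<Rightarrow>\<^sub>L 'a"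
  assumes N: "centred_gaussian C N" and C: "nonneg_symmetric C"
  shows "(\<integral>x. cos (inner x h) \<partial>N) = exp (- inner (C h) h / 2)" "(\<integral>x. sin (inner x h) \<partial>N) = 0"
proof -
  have [measurable_cong, simp]: "sets N = sets borel" using N by (simp add: centred_gaussian_def)
  have d: "distr N borel (\<lambda>x. inner x h) = normal_law (inner (C h) h)"
    using N by (simp add: centred_gaussian_def)
  have "(\<integral>x. f (inner x h) \<partial>N) = (\<integral>y. f y \<partial>normal_law (inner (C h) h))"
    if "f \<in> borel_measurable borel" for f :: "real \<Rightarrow> real"
    unfolding d[symmetric] using that by (subst integral_distr) auto
  then show "(\<integral>x. cos (inner x h) \<partial>N) = exp (- inner (C h) h / 2)" "(\<integral>x. sin (inner x h) \<partial>N) = 0"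
    using normal_law_trig[OF nonneg_symmetricD(2)[OF C, of h]] by simp_all
qed

text \<open>For a unit vector the coordinate of \<open>x\<close> along \<open>e\<close> is exchanged
  for that of \<open>z\<close>; for e = 0 nothing changes, which suits the padding of orthonormal
  sequences.\<close>

definition resample :: "'a::real_inner \<Rightarrow> 'a \<Rightarrow> 'a \<Rightarrow> 'a" where
  "resample e x z = x - inner x e *\<^sub>R e + inner z e *\<^sub>R e"

lemma borel_measurable_resample[measurable (raw)]:
  fixes f g :: "'b \<Rightarrow> 'a::{real_inner, second_countable_topology}"
  assumes "f \<in> borel_measurable M" "g \<in> borel_measurable M"
  shows "(\<lambda>x. resample e (f x) (g x)) \<in> borel_measurable M"
  using assms unfolding resample_def by measurable

text \<open>The coordinate along an eigenvector is uncorrelated with the complement, hence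
  independent of it under a Gaussian law. For characteristic functionals this says that the
  quadratic form of \<open>C\<close> splits along \<open>h - inner h e *\<^sub>R e\<close> and
  \<open>inner h e *\<^sub>R e\<close>.\<close>

lemma gaussian_resample:
  fixes C :: "'a::{real_inner, banach, second_countable_topology} \<Rightarrow>\<^sub>L 'a"
  assumes N: "centred_gaussian C N" and C: "nonneg_symmetric C"
    and e: "norm e = 1 \<or> e = 0" and Ce: "C e = l *\<^sub>R e"
  shows "distr (N \<Otimes>\<^sub>M N) borel (\<lambda>(x, z). resample e x z) = N"
proof -
  have [measurable_cong, simp]: "sets N = sets borel" and "prob_space N"
    using N by (simp_all add: centred_gaussian_def)
  interpret N: prob_space N by fact
  interpret NN: pair_prob_space N N ..
  let ?D = "distr (N \<Otimes>\<^sub>M N) borel (\<lambda>(x, z). resample e x z)"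
  note tr = centred_gaussian_trig[OF N C]
  have prod: "(\<integral>p. f (fst p) * g (snd p) \<partial>(N \<Otimes>\<^sub>M N)) = (\<integral>x. f x \<partial>N) * (\<integral>z. g z \<partial>N)"
     "integrable (N \<Otimes>\<^sub>M N) (\<lambda>p. f (fst p) * g (snd p))"
    if [measurable]: "f \<in> borel_measurable borel" "g \<in> borel_measurable borel"
      and b: "\<And>x. \<bar>f x\<bar> \<le> 1" "\<And>x. \<bar>g x\<bar> \<le> 1" for f g :: "'a \<Rightarrow> real"
  proof -
    show i: "integrable (N \<Otimes>\<^sub>M N) (\<lambda>p. f (fst p) * g (snd p))"
      by (rule NN.integrable_const_bound[where B = 1])
        (use b in \<open>auto simp: abs_mult intro!: mult_le_one\<close>)
    show "(\<integral>p. f (fst p) * g (snd p) \<partial>(N \<Otimes>\<^sub>M N)) = (\<integral>x. f x \<partial>N) * (\<integral>z. g z \<partial>N)"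
      by (subst NN.integral_fst'[OF i, symmetric]) simp
  qed
  have q: "inner (C (h - inner h e *\<^sub>R e)) (h - inner h e *\<^sub>R e) + inner (C (inner h e *\<^sub>R e)) (inner h e *\<^sub>R e)
      = inner (C h) h" for h
  proof -
    have 1: "inner (C h) e = l * inner h e"
      using nonneg_symmetricD(1)[OF C, of h e] by (simp add: Ce)
    have 2: "inner h e * inner e e = inner h e" using e by (auto simp: norm_eq_1)
    have 3: "inner (C (h - s *\<^sub>R e)) (h - s *\<^sub>R e)
      = inner (C h) h - s * inner (C h) e - s * inner (C e) h + s * s * inner (C e) e" for s
      by (simp add: blinfun.diff_right blinfun.scaleR_right inner_diff_left inner_diff_right algebra_simps del: Ce)
    have "inner (C (h - inner h e *\<^sub>R e)) (h - inner h e *\<^sub>R e) + inner (C (inner h e *\<^sub>R e)) (inner h e *\<^sub>R e)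
      = inner (C h) h - 2 * inner h e * (l * inner h e) + 2 * l * inner h e * (inner h e * inner e e)"
      unfolding 3 1 by (simp add: blinfun.scaleR_right Ce inner_commute[of e h] algebra_simps)
    then show ?thesis by (simp add: 2)
  qed
  have rs: "inner (resample e x z) h = inner x (h - inner h e *\<^sub>R e) + inner z (inner h e *\<^sub>R e)" for x z h
    by (simp add: resample_def inner_diff_left inner_diff_right inner_add_left inner_commute[of e])
  have cc: "integrable (N \<Otimes>\<^sub>M N) (\<lambda>p. cos (inner (fst p) a) * cos (inner (snd p) b))"
    "(\<integral>p. cos (inner (fst p) a) * cos (inner (snd p) b) \<partial>(N \<Otimes>\<^sub>M N)) = exp (- inner (C a) a / 2) * exp (- inner (C b) b / 2)"
    and ss: "integrable (N \<Otimes>\<^sub>M N) (\<lambda>p. sin (inner (fst p) a) * sin (inner (snd p) b))"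
    "(\<integral>p. sin (inner (fst p) a) * sin (inner (snd p) b) \<partial>(N \<Otimes>\<^sub>M N)) = 0"
    and sc: "integrable (N \<Otimes>\<^sub>M N) (\<lambda>p. sin (inner (fst p) a) * cos (inner (snd p) b))"
    "(\<integral>p. sin (inner (fst p) a) * cos (inner (snd p) b) \<partial>(N \<Otimes>\<^sub>M N)) = 0"
    and cs: "integrable (N \<Otimes>\<^sub>M N) (\<lambda>p. cos (inner (fst p) a) * sin (inner (snd p) b))"
    "(\<integral>p. cos (inner (fst p) a) * sin (inner (snd p) b) \<partial>(N \<Otimes>\<^sub>M N)) = 0" for a b
    by (rule prod(2) | subst prod(1) | simp add: tr)+
  show ?thesis
  proof (rule char_unique)
    show "prob_space ?D" by (rule NN.prob_space_distr) measurable
    fix h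
    let ?a = "h - inner h e *\<^sub>R e" and ?b = "inner h e *\<^sub>R e"
    have "(\<integral>x. cos (inner x h) \<partial>?D) = (\<integral>p. cos (inner (fst p) ?a) * cos (inner (snd p) ?b)
        - sin (inner (fst p) ?a) * sin (inner (snd p) ?b) \<partial>(N \<Otimes>\<^sub>M N))"
      by (subst integral_distr) (auto simp: rs cos_add split_beta intro!: Bochner_Integration.integral_cong)
    also have "\<dots> = exp (- inner (C ?a) ?a / 2) * exp (- inner (C ?b) ?b / 2)"
      by (subst Bochner_Integration.integral_diff[OF cc(1) ss(1)]) (simp only: cc ss diff_zero)
    also have "\<dots> = (\<integral>x. cos (inner x h) \<partial>N)"
      unfolding tr q[of h, symmetric] by (simp add: exp_add[symmetric] field_simps)
    finally show "(\<integral>x. cos (inner x h) \<partial>?D) = (\<integral>x. cos (inner x h) \<partial>N)" .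
    have "(\<integral>x. sin (inner x h) \<partial>?D) = (\<integral>p. sin (inner (fst p) ?a) * cos (inner (snd p) ?b)
        + cos (inner (fst p) ?a) * sin (inner (snd p) ?b) \<partial>(N \<Otimes>\<^sub>M N))"
      by (subst integral_distr) (auto simp: rs sin_add split_beta intro!: Bochner_Integration.integral_cong)
    also have "\<dots> = 0"
      by (subst Bochner_Integration.integral_add[OF sc(1) cs(1)]) (simp only: sc cs add_0)
    finally show "(\<integral>x. sin (inner x h) \<partial>?D) = (\<integral>x. sin (inner x h) \<partial>N)" by (simp add: tr)
  qed (use \<open>prob_space N\<close> in auto)
qed

lemma gaussian_resample_nn_integral:
  fixes C :: "'a::{real_inner, banach, second_countable_topology} \<Rightarrow>\<^sub>L 'a"
  assumes N: "centred_gaussian C N" and C: "nonneg_symmetric C"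
    and e: "norm e = 1 \<or> e = 0" and Ce: "C e = l *\<^sub>R e" and f[measurable]: "f \<in> borel_measurable borel"
  shows "(\<integral>\<^sup>+x. (\<integral>\<^sup>+z. f (resample e x z) \<partial>N) \<partial>N) = (\<integral>\<^sup>+x. f x \<partial>N)"
proof -
  have [measurable_cong, simp]: "sets N = sets borel" and "prob_space N"
    using N by (simp_all add: centred_gaussian_def)
  interpret N: prob_space N by fact
  have "(\<integral>\<^sup>+x. f x \<partial>N) = (\<integral>\<^sup>+p. f (case p of (x, z) \<Rightarrow> resample e x z) \<partial>(N \<Otimes>\<^sub>M N))"
    by (subst gaussian_resample[OF N C e Ce, symmetric], subst nn_integral_distr) auto
  also have "\<dots> = (\<integral>\<^sup>+x. (\<integral>\<^sup>+z. f (resample e x z) \<partial>N) \<partial>N)"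
    by (subst N.nn_integral_fst[symmetric]) auto
  finally show ?thesis by simp
qed

section \<open>A first order linear equation for densities on the line\<close>

text \<open>Passes from Lebesgue integrals over half-lines, which the disintegration produces, to
  the gauge integral, in which every derivative is integrable over an interval.\<close>

lemma lborel_integral_interval:
  fixes f :: "real \<Rightarrow> real"
  assumes f: "integrable lborel (\<lambda>s. f s * indicator {a<..} s)" and "a \<le> t"
  shows "(\<integral>s. f s * indicator {a<..} s \<partial>lborel) - (\<integral>s. f s * indicator {t<..} s \<partial>lborel) = integral {a..t} f"
proof -
  have eq: "f s * indicator {t<..} s = indicator {t<..} s *\<^sub>R (f s * indicator {a<..} s)"
    "f s * indicator {a<..} s - f s * indicator {t<..} s = indicator {a<..t} s *\<^sub>R (f s * indicator {a<..} s)"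
    "indicator {a<..t} s *\<^sub>R (f s * indicator {a<..} s) = indicator {a<..t} s *\<^sub>R f s" for s
    using \<open>a \<le> t\<close> by (auto simp: indicator_def)
  have "(\<integral>s. f s * indicator {a<..} s \<partial>lborel) - (\<integral>s. f s * indicator {t<..} s \<partial>lborel)
      = (\<integral>s. f s * indicator {a<..} s - f s * indicator {t<..} s \<partial>lborel)"
    by (rule Bochner_Integration.integral_diff[symmetric, OF f], unfold eq(1))
      (intro integrable_mult_indicator f, simp)
  also have "\<dots> = (LINT s:{a<..t}|lborel. f s)" unfolding eq(2,3) set_lebesgue_integral_def ..
  also have "\<dots> = integral {a<..t} f"
  proof (rule set_borel_integral_eq_integral(2))
    have "integrable lborel (\<lambda>s. indicator {a<..t} s *\<^sub>R (f s * indicator {a<..} s))"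
      by (intro integrable_mult_indicator f) simp
    then show "set_integrable lborel {a<..t} f" unfolding set_integrable_def eq(3) .
  qed
  also have "\<dots> = integral {a..t} f"
    by (rule integral_subset_negligible) (auto intro: negligible_subset[of "{a}"])
  finally show ?thesis .
qed

text \<open>A nonzero limit would bound |g| from below on a half-line, which has infinite
  measure.\<close>

lemma integrable_tendsto_0:
  fixes g :: "real \<Rightarrow> real"
  assumes g: "integrable lborel g" and l: "(g \<longlongrightarrow> A) at_top"
  shows "A = 0"
proof (rule ccontr)
  assume "A \<noteq> 0"
  have "((\<lambda>t. \<bar>g t\<bar>) \<longlongrightarrow> \<bar>A\<bar>) at_top" by (intro tendsto_intros l)
  then have "eventually (\<lambda>t. \<bar>g t\<bar> > \<bar>A\<bar> / 2) at_top"
    using \<open>A \<noteq> 0\<close> by (intro order_tendstoD) auto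
  then obtain b where b: "\<And>t. t \<ge> b \<Longrightarrow> \<bar>g t\<bar> > \<bar>A\<bar> / 2" by (auto simp: eventually_at_top_linorder)
  have "(\<integral>\<^sup>+t. ennreal (\<bar>A\<bar> / 2) * indicator {b..} t \<partial>lborel) \<le> (\<integral>\<^sup>+t. ennreal (norm (g t)) \<partial>lborel)"
    using b by (intro nn_integral_mono) (auto simp: indicator_def intro!: ennreal_leI less_imp_le)
  also have "\<dots> < \<infinity>" using g by (simp add: integrable_iff_bounded)
  also have "(\<integral>\<^sup>+t. ennreal (\<bar>A\<bar> / 2) * indicator {b..} t \<partial>lborel) = ennreal (\<bar>A\<bar> / 2) * emeasure lborel {b..}"
    by (rule nn_integral_cmult_indicator) simp
  also have "emeasure lborel {b..} = \<infinity>"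
  proof (rule ccontr)
    assume "emeasure lborel {b..} \<noteq> \<infinity>"
    then obtain r where r: "emeasure lborel {b..} = ennreal r" "r \<ge> 0" by (cases "emeasure lborel {b..}") auto
    have "ennreal (r + 1) = emeasure lborel {b..b + (r + 1)}" using r by simp
    also have "\<dots> \<le> emeasure lborel {b..}" by (intro emeasure_mono) auto
    finally show False using r by simp
  qed
  finally show False using \<open>A \<noteq> 0\<close> by (simp add: ennreal_mult_top)
qed

lemma integral_deriv_half_line_tendsto:
  fixes g g' :: "real \<Rightarrow> real"
  assumes d: "\<And>t. DERIV g t :> g' t" and g': "integrable lborel (\<lambda>s. g' s * indicator {0<..} s)"
  shows "((\<lambda>b. g b - g 0) \<longlongrightarrow> (\<integral>s. g' s * indicator {0<..} s \<partial>lborel)) at_top"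
proof -
  let ?I = "\<integral>s. g' s * indicator {0<..} s \<partial>lborel"
  have "((\<lambda>b. \<integral>s. indicator {..b} s *\<^sub>R (g' s * indicator {0<..} s) \<partial>lborel) \<longlongrightarrow> ?I) at_top"
    by (rule tendsto_integral_at_top[OF _ g']) simp
  moreover have "eventually (\<lambda>b. (\<integral>s. indicator {..b} s *\<^sub>R (g' s * indicator {0<..} s) \<partial>lborel) = g b - g 0) at_top"
    using eventually_ge_at_top[of 0]
  proof eventually_elim
    case (elim b)
    have eq: "g' s * indicator {b<..} s = indicator {b<..} s *\<^sub>R (g' s * indicator {0<..} s)" for s
      using elim by (auto simp: indicator_def)
    have "(\<integral>s. indicator {..b} s *\<^sub>R (g' s * indicator {0<..} s) \<partial>lborel)
        = (\<integral>s. g' s * indicator {0<..} s - g' s * indicator {b<..} s \<partial>lborel)"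
      by (rule Bochner_Integration.integral_cong) (use elim in \<open>auto simp: indicator_def\<close>)
    also have "\<dots> = integral {0..b} g'"
      unfolding lborel_integral_interval[OF g' elim, symmetric]
      by (rule Bochner_Integration.integral_diff[OF g'], unfold eq) (intro integrable_mult_indicator g', simp)
    also have "\<dots> = g b - g 0"
      by (rule integral_unique, rule fundamental_theorem_of_calculus[OF elim])
        (use d in \<open>auto intro: has_field_derivative_at_within simp: has_real_derivative_iff_has_vector_derivative[symmetric]\<close>)
    finally show ?case .
  qed
  ultimately show ?thesis by (rule Lim_transform_eventually)
qed

lemma integral_deriv_half_line:
  fixes g g' :: "real \<Rightarrow> real"
  assumes d: "\<And>t. DERIV g t :> g' t" and g: "integrable lborel g" and g': "integrable lborel g'"
  shows "(\<integral>s. g' s * indicator {0<..} s \<partial>lborel) = - g 0"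
proof -
  let ?I = "\<integral>s. g' s * indicator {0<..} s \<partial>lborel"
  have "integrable lborel (\<lambda>s. g' s * indicator {0<..} s)"
    using integrable_mult_indicator[of "{0<..}" lborel g'] g' by (simp add: mult.commute)
  from integral_deriv_half_line_tendsto[OF d this]
  have "((\<lambda>b. g b - g 0 + g 0) \<longlongrightarrow> ?I + g 0) at_top" by (intro tendsto_intros)
  then have "?I + g 0 = 0" by (intro integrable_tendsto_0[OF g]) simp
  then show ?thesis by simp
qed

text \<open>The half-line formula is applied to \<open>g\<close> and to its reflection, and the
  values at 0 cancel. The derivative may be discontinuous: the fundamental theorem for the gauge
  integral covers it, and integrability of \<open>g\<close> makes its limits at infinity
  vanish.\<close>

lemma integral_deriv_zero:
  fixes g g' :: "real \<Rightarrow> real"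
  assumes d: "\<And>t. DERIV g t :> g' t" and g: "integrable lborel g" and g': "integrable lborel g'"
  shows "(\<integral>s. g' s \<partial>lborel) = 0"
proof -
  have i: "integrable lborel (\<lambda>s. g' s * indicator S s)" if "S \<in> sets borel" for S
    using integrable_mult_indicator[of S lborel g'] g' that by (simp add: mult.commute)
  have 1: "(\<integral>s. g' s * indicator {0<..} s \<partial>lborel) = - g 0"
    by (rule integral_deriv_half_line[OF d g g'])
  have "(\<integral>s. - g' (- s) * indicator {0<..} s \<partial>lborel) = - g (- 0)"
  proof (rule integral_deriv_half_line[where g = "\<lambda>s. g (- s)"])
    show "((\<lambda>s. g (- s)) has_real_derivative - g' (- t)) (at t)" for t
      using d[of "- t"] by (simp add: DERIV_mirror)
    show "integrable lborel (\<lambda>s. g (- s))" "integrable lborel (\<lambda>s. - g' (- s))"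
      using lborel_integrable_real_affine[OF g, of "-1" 0] lborel_integrable_real_affine[OF g', of "-1" 0] by auto
  qed
  moreover have "(\<integral>s. g' s * indicator {..<0} s \<partial>lborel) = (\<integral>s. g' (- s) * indicator {0<..} s \<partial>lborel)"
    by (subst lborel_integral_real_affine[where c = "-1" and t = 0])
      (auto intro!: Bochner_Integration.integral_cong simp: indicator_def)
  ultimately have 2: "(\<integral>s. g' s * indicator {..<0} s \<partial>lborel) = g 0" by simp
  have "(\<integral>s. g' s \<partial>lborel) = (\<integral>s. g' s * indicator {..<0} s + g' s * indicator {0<..} s \<partial>lborel)"
  proof (rule integral_cong_AE)
    show "AE s in lborel. g' s = g' s * indicator {..<0} s + g' s * indicator {0<..} s"
      using AE_lborel_singleton[of 0] by eventually_elim (auto simp: indicator_def)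
  qed (use g' in auto)
  also have "\<dots> = 0" by (subst Bochner_Integration.integral_add) (auto intro: i simp: 1 2)
  finally show ?thesis .
qed

text \<open>Formally F' = - W' F, but \<open>W'\<close> need not be locally integrable, so F exp(W)
  cannot be handled globally. Near a point with F \<noteq> 0, dividing the integrable product W' F
  by F shows that \<open>W'\<close> is integrable there, and a contraction argument identifies F
  with a multiple of exp(-W). So \<open>G\<close> is locally constant near such points, and a
  nonzero level set of \<open>G\<close> is open and closed.\<close>

lemma integral_equation_solution:
  fixes W W' F :: "real \<Rightarrow> real"
  assumes W: "\<And>t. DERIV W t :> W' t"
    and k: "\<And>t. integrable lborel (\<lambda>s. W' s * F s * indicator {t<..} s)"
    and F: "\<And>t. F t = (\<integral>s. W' s * F s * indicator {t<..} s \<partial>lborel)"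
  obtains \<kappa> where "\<And>t. F t = \<kappa> * exp (- W t)"
proof (cases "\<forall>t. F t = 0")
  case True
  then show thesis using that[of 0] by simp
next
  case False
  then obtain t0 where t0: "F t0 \<noteq> 0" by blast
  let ?k = "\<lambda>s. W' s * F s"
  have Fd: "F t = F a - integral {a..t} ?k" if "a \<le> t" for a t
    using lborel_integral_interval[OF k that] F[of a] F[of t] by simp
  have ki: "?k integrable_on {a..b}" "(\<lambda>s. \<bar>?k s\<bar>) integrable_on {a..b}" for a b
  proof -
    have 1: "(\<lambda>s. ?k s * indicator {a - 1<..} s) integrable_on {a..b}"
      using integrable_on_subinterval[OF integrable_on_lborel[OF k]] by blast
    have 2: "(\<lambda>s. \<bar>?k s * indicator {a - 1<..} s\<bar>) integrable_on {a..b}"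
      using integrable_on_subinterval[OF integrable_on_lborel[OF integrable_abs[OF k]]] by blast
    show "?k integrable_on {a..b}" by (rule integrable_eq[OF 1]) auto
    show "(\<lambda>s. \<bar>?k s\<bar>) integrable_on {a..b}" by (rule integrable_eq[OF 2]) auto
  qed
  have Fc: "continuous_on {a..b} F" for a b
  proof -
    have "continuous_on {a..b} (\<lambda>t. F a - integral {a..t} ?k)"
      by (intro continuous_intros indefinite_integral_continuous_1 ki)
    then show ?thesis by (rule continuous_on_eq) (use Fd in auto)
  qed
  have Fcont: "isCont F t" for t
    using Fc[of "t - 1" "t + 1"] by (intro continuous_on_interior[of "{t - 1..t + 1}"]) auto
  have Wc: "isCont W t" for t using W by (rule DERIV_isCont)
  define G where "G t = F t * exp (W t)" for t
  have Gc: "continuous_on UNIV G"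
    unfolding G_def using Fcont Wc by (intro continuous_at_imp_continuous_on ballI) (auto intro!: continuous_intros)
  have local: "\<exists>\<delta>>0. \<forall>t. \<bar>t - t1\<bar> < \<delta> \<longrightarrow> G t = G t1" if t1: "F t1 \<noteq> 0" for t1
  proof -
    \<comment> \<open>Half the size of F at \<open>t1\<close>; by continuity it bounds |F| from
      below nearby.\<close>
    define m where "m = \<bar>F t1\<bar> / 2"
    have m: "m > 0" using t1 by (simp add: m_def)
    obtain d1 where d1: "d1 > 0" "\<And>t. \<bar>t - t1\<bar> < d1 \<Longrightarrow> \<bar>F t - F t1\<bar> < m"
      using Fcont[of t1] m unfolding continuous_at_real_range real_norm_def by blast
    have mF: "\<bar>F t\<bar> \<ge> m" if "\<bar>t - t1\<bar> < d1" for t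
      using d1(2)[OF that] unfolding m_def by (simp add: abs_if split: if_splits)
    let ?J = "\<lambda>t. integral {t1 - d1..t} (\<lambda>s. \<bar>?k s\<bar>)"
    have "continuous_on {t1 - d1..t1 + d1} ?J" by (rule indefinite_integral_continuous_1) (rule ki)
    then have "isCont ?J t1" using d1(1) by (intro continuous_on_interior) auto
    moreover have "m / 4 > 0" using m by simp
    ultimately obtain d2 where d2: "d2 > 0" "\<And>t. \<bar>t - t1\<bar> < d2 \<Longrightarrow> \<bar>?J t - ?J t1\<bar> < m / 4"
      unfolding continuous_at_real_range real_norm_def by blast
    \<comment> \<open>By the choice of \<open>d2\<close> the integral of |W' F| is at most m / 2,
      hence that of |W'| at most 1 / 2; halving the minimum keeps the closed interval inside both
      neighbourhoods.\<close>
    define \<delta> where "\<delta> = min d1 d2 / 2"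
    have \<delta>: "\<delta> > 0" "\<delta> < d1" "\<delta> < d2" using d1(1) d2(1) by (auto simp: \<delta>_def)
    define a where "a = t1 - \<delta>"
    define b where "b = t1 + \<delta>"
    have ab: "a \<le> b" using \<delta> by (simp add: a_def b_def)
    have near: "\<bar>t - t1\<bar> < d1" if "t \<in> {a..b}" for t using that \<delta> by (auto simp: a_def b_def)
    have "integral {a..b} (\<lambda>s. \<bar>?k s\<bar>) = ?J b - ?J a"
      using Henstock_Kurzweil_Integration.integral_combine[where a = "t1 - d1" and c = a and b = b and f = "\<lambda>s. \<bar>?k s\<bar>"] ki(2) \<delta> by (simp add: a_def b_def)
    also have "\<dots> \<le> m / 2"
    proof -
      have *: "y - x \<le> m / 2" if "\<bar>x - z\<bar> < m / 4" "\<bar>y - z\<bar> < m / 4" for x y z using that by linarith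
      show ?thesis by (rule *[where z = "?J t1"]; rule d2(2)) (use \<delta> in \<open>auto simp: a_def b_def\<close>)
    qed
    finally have kab: "integral {a..b} (\<lambda>s. \<bar>?k s\<bar>) \<le> m / 2" .
    have W'i: "(W' has_integral W t - W s) {s..t}" if "s \<le> t" for s t
      by (rule fundamental_theorem_of_calculus[OF that])
        (use W in \<open>auto intro: has_field_derivative_at_within simp: has_real_derivative_iff_has_vector_derivative[symmetric]\<close>)
    have bnd: "\<bar>W' s\<bar> \<le> \<bar>?k s\<bar> / m" if "s \<in> {a..b}" for s
    proof -
      have "\<bar>W' s\<bar> * m \<le> \<bar>W' s\<bar> * \<bar>F s\<bar>" using mF[OF near[OF that]] by (intro mult_left_mono) auto
      then show ?thesis using m by (simp add: field_simps abs_mult)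
    qed
    \<comment> \<open>As a derivative \<open>W'\<close> is gauge integrable; the bound by |W' F| / m
      upgrades this to absolute integrability.\<close>
    have "W' absolutely_integrable_on {a..b}"
      by (rule absolutely_integrable_integrable_bound[where g = "\<lambda>s. \<bar>?k s\<bar> / m"])
        (use bnd W'i[OF ab] ki(2)[of a b] in \<open>auto intro: integrable_on_divide\<close>)
    then have absW: "(\<lambda>s. \<bar>W' s\<bar>) integrable_on {a..b}"
      by (simp add: absolutely_integrable_on_def)
    have Wab: "integral {a..b} (\<lambda>s. \<bar>W' s\<bar>) \<le> 1 / 2"
    proof -
      have "integral {a..b} (\<lambda>s. \<bar>W' s\<bar>) \<le> integral {a..b} (\<lambda>s. \<bar>?k s\<bar> / m)"
        using bnd absW ki(2)[of a b] by (intro integral_le) (auto intro: integrable_on_divide)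
      also have "\<dots> = integral {a..b} (\<lambda>s. \<bar>?k s\<bar>) / m" by (rule integral_divide)
      also have "\<dots> \<le> 1 / 2" using kab m by (simp add: field_simps)
      finally show ?thesis .
    qed
    have E1: "x * exp (- W t) * exp (W t) = x" "x * exp (W t) * exp (- W t) = x" for x t
      by (simp_all add: exp_minus)
    \<comment> \<open>The deviation from the expected solution satisfies the same linear equation
      and vanishes at \<open>a\<close>. Since |W'| has integral at most 1 / 2, the maximum of |d| is
      at most half of itself.\<close>
    define d where "d t = F t - G a * exp (- W t)" for t
    have da: "d a = 0" by (simp add: d_def G_def E1)
    have Ei: "((\<lambda>s. - (W' s * exp (- W s))) has_integral exp (- W t) - exp (- W a)) {a..t}" if "a \<le> t" for t
    proof (rule fundamental_theorem_of_calculus[OF that])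
      fix s
      have "((\<lambda>s. exp (- W s)) has_real_derivative exp (- W s) * (- W' s)) (at s)"
        by (rule DERIV_fun_exp) (rule DERIV_minus[OF W])
      then show "((\<lambda>s. exp (- W s)) has_vector_derivative - (W' s * exp (- W s))) (at s within {a..t})"
        unfolding has_real_derivative_iff_has_vector_derivative[symmetric]
        by (simp add: mult.commute has_field_derivative_at_within)
    qed
    have dc: "continuous_on {a..b} d"
    proof -
      have "continuous_on {a..b} W" using Wc by (intro continuous_at_imp_continuous_on) auto
      then show ?thesis unfolding d_def by (intro continuous_intros Fc)
    qed
    have cne: "compact {a..b}" "{a..b} \<noteq> {}" using ab by auto
    have "continuous_on {a..b} (\<lambda>t. \<bar>d t\<bar>)" using dc by (intro continuous_intros)
    from continuous_attains_sup[OF cne this]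
    obtain tm where tm: "tm \<in> {a..b}" "\<And>t. t \<in> {a..b} \<Longrightarrow> \<bar>d t\<bar> \<le> \<bar>d tm\<bar>"
      by blast
    have "\<bar>d tm\<bar> \<le> \<bar>d tm\<bar> / 2"
    proof -
      let ?h = "\<lambda>s. - ?k s - G a * (- (W' s * exp (- W s)))"
      have hi: "(?h has_integral (- integral {a..tm} ?k - G a * (exp (- W tm) - exp (- W a)))) {a..tm}"
        by (intro has_integral_diff has_integral_neg has_integral_mult_right integrable_integral ki Ei)
          (use tm in auto)
      have "- integral {a..tm} ?k - G a * (exp (- W tm) - exp (- W a)) = d tm"
        using Fd[of a tm] tm(1) da by (simp add: d_def algebra_simps)
      then have "d tm = integral {a..tm} ?h" using hi by (simp add: integral_unique)
      also have "\<bar>\<dots>\<bar> \<le> integral {a..tm} (\<lambda>s. \<bar>W' s\<bar> * \<bar>d tm\<bar>)"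
      proof -
        have "norm (integral {a..tm} ?h) \<le> integral {a..tm} (\<lambda>s. \<bar>W' s\<bar> * \<bar>d tm\<bar>)"
        proof (rule integral_norm_bound_integral)
          show "?h integrable_on {a..tm}" using hi by blast
          show "(\<lambda>s. \<bar>W' s\<bar> * \<bar>d tm\<bar>) integrable_on {a..tm}"
            using integrable_on_subinterval[OF absW, of a tm] tm(1) by (auto intro: integrable_on_mult_left)
          fix s assume "s \<in> {a..tm}"
          then have "\<bar>d s\<bar> \<le> \<bar>d tm\<bar>" using tm by auto
          moreover have "?h s = - W' s * d s" by (simp add: d_def algebra_simps)
          ultimately show "norm (?h s) \<le> \<bar>W' s\<bar> * \<bar>d tm\<bar>"
            by (simp add: abs_mult mult_left_mono)
        qed
        then show ?thesis by simp
      qed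
      also have "\<dots> = integral {a..tm} (\<lambda>s. \<bar>W' s\<bar>) * \<bar>d tm\<bar>" by (rule integral_mult_left)
      also have "\<dots> \<le> (1 / 2) * \<bar>d tm\<bar>"
      proof (intro mult_right_mono)
        have "integral {a..tm} (\<lambda>s. \<bar>W' s\<bar>) \<le> integral {a..b} (\<lambda>s. \<bar>W' s\<bar>)"
          using integrable_on_subinterval[OF absW, of a tm] tm(1) absW by (intro integral_subset_le) auto
        with Wab show "integral {a..tm} (\<lambda>s. \<bar>W' s\<bar>) \<le> 1 / 2" by simp
      qed simp
      finally show ?thesis by simp
    qed
    then have "d t = 0" if "t \<in> {a..b}" for t using tm(2)[OF that] by simp
    then have Ga: "G t = G a" if "t \<in> {a..b}" for t
      using that by (simp add: d_def G_def[of t] E1)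
    have "G t = G t1" if "\<bar>t - t1\<bar> < \<delta>" for t
      using Ga[of t] Ga[of t1] that \<delta> by (simp add: a_def b_def abs_less_iff)
    with \<delta>(1) show ?thesis by blast
  qed
  have const: "G t = G t0" for t
  proof -
    let ?S = "{t. G t = G t0}"
    have cl: "closed ?S" by (intro closed_Collect_eq Gc continuous_on_const)
    \<comment> \<open>On this level set F has no zeros, since F is nonzero at \<open>t0\<close>; so
      the local statement applies at each of its points.\<close>
    have op: "open ?S" unfolding open_dist
    proof
      fix t assume t: "t \<in> ?S"
      then have "F t \<noteq> 0" using t0 by (auto simp: G_def)
      from local[OF this] obtain \<delta> where "\<delta> > 0" "\<And>s. \<bar>s - t\<bar> < \<delta> \<Longrightarrow> G s = G t" by blast
      then have "dist y t < \<delta> \<Longrightarrow> y \<in> ?S" for y using t unfolding dist_real_def mem_Collect_eq by metis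
      with \<open>\<delta> > 0\<close> show "\<exists>e>0. \<forall>y. dist y t < e \<longrightarrow> y \<in> ?S" by blast
    qed
    have "?S = {} \<or> ?S = UNIV" using cl op by (intro clopen[THEN iffD1] conjI)
    moreover have "t0 \<in> ?S" by simp
    ultimately have "t \<in> ?S" by blast
    then show ?thesis unfolding mem_Collect_eq .
  qed
  show thesis
  proof (rule that[of "G t0"])
    fix t
    have "F t = G t * exp (- W t)" by (simp add: G_def exp_minus)
    then show "F t = G t0 * exp (- W t)" by (simp only: const[of t])
  qed
qed

lemma (in pair_sigma_finite) integrable_prod_mult:
  fixes f :: "'a \<Rightarrow> real" and g :: "'b \<Rightarrow> real"
  assumes f: "integrable M1 f" and g: "integrable M2 g"
  shows "integrable (M1 \<Otimes>\<^sub>M M2) (\<lambda>p. f (fst p) * g (snd p))"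
proof (rule Fubini_integrable)
  have [measurable]: "f \<in> borel_measurable M1" "g \<in> borel_measurable M2" using f g by auto
  show "(\<lambda>p. f (fst p) * g (snd p)) \<in> borel_measurable (M1 \<Otimes>\<^sub>M M2)" by measurable
  show "integrable M1 (\<lambda>x. \<integral>y. norm (f (fst (x, y)) * g (snd (x, y))) \<partial>M2)"
    using f by (simp add: abs_mult)
  show "AE x in M1. integrable M2 (\<lambda>y. f (fst (x, y)) * g (snd (x, y)))"
    using g by simp
qed

section \<open>Disintegration of a measure with a logarithmic derivative\<close>

text \<open>Density of the standard exponential law. Convolution with it inverts 1 + d/ds, which is
  why b + 1 appears in place of \<open>b\<close> from here on.\<close>

definition exp_kernel :: "real \<Rightarrow> real" where
  "exp_kernel s = exp (- s) * indicator {0<..} s"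

lemma exp_kernel_measurable[measurable]: "exp_kernel \<in> borel_measurable borel"
  unfolding exp_kernel_def by measurable

lemma exp_kernel_integrable: "integrable lborel exp_kernel"
proof -
  have "(\<integral>\<^sup>+s. ennreal (exp (- s)) * indicator {0..} s \<partial>lborel) = ennreal (0 - (- exp (- 0)))"
  proof (rule nn_integral_FTC_atLeast)
    show "DERIV (\<lambda>s. - exp (- s)) x :> exp (- x)" for x :: real by (auto intro!: derivative_eq_intros)
    show "((\<lambda>s::real. - exp (- s)) \<longlongrightarrow> 0) at_top" by real_asymp
  qed auto
  moreover have "(\<integral>\<^sup>+s. ennreal (norm (exp_kernel s)) \<partial>lborel) \<le> (\<integral>\<^sup>+s. ennreal (exp (- s)) * indicator {0..} s \<partial>lborel)"
    by (rule nn_integral_mono) (auto simp: exp_kernel_def indicator_def)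
  ultimately show ?thesis by (auto simp: integrable_iff_bounded intro: le_less_trans)
qed

lemma exp_kernel_bound_integrable:
  assumes "f \<in> borel_measurable borel" "\<And>s. \<bar>f s\<bar> \<le> B"
  shows "integrable lborel (\<lambda>s. exp_kernel s * f s)"
proof (rule Bochner_Integration.integrable_bound)
  show "integrable lborel (\<lambda>s. B * exp_kernel s)" using exp_kernel_integrable by simp
  show "(\<lambda>s. exp_kernel s * f s) \<in> borel_measurable lborel" using assms(1) by simp
  have "\<bar>exp_kernel s\<bar> * \<bar>f s\<bar> \<le> \<bar>exp_kernel s\<bar> * \<bar>B\<bar>" for s
    using assms(2)[of s] by (intro mult_left_mono) auto
  then show "AE s in lborel. norm (exp_kernel s * f s) \<le> norm (B * exp_kernel s)"
    by (simp add: abs_mult mult.commute)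
qed

text \<open>This is the real part of exp(i alpha) / (1 + i theta); \<open>exp_kernel_sin\<close> is
  the imaginary part.\<close>

lemma exp_kernel_cos:
  "(\<integral>s. exp_kernel s * cos (\<alpha> - s * \<theta>) \<partial>lborel) = (cos \<alpha> + \<theta> * sin \<alpha>) / (1 + \<theta>\<^sup>2)"
proof -
  define g where "g s = - exp (- s) * (cos (\<alpha> - s * \<theta>) + \<theta> * sin (\<alpha> - s * \<theta>)) / (1 + \<theta>\<^sup>2)" for s
  have nz: "1 + \<theta>\<^sup>2 \<noteq> 0" by (metis add_nonneg_eq_0_iff zero_le_one zero_le_power2 one_neq_zero)
  have d: "DERIV g s :> exp (- s) * cos (\<alpha> - s * \<theta>)" for s
  proof -
    have "DERIV g s :> (exp (- s) * (cos (\<alpha> - s * \<theta>) + \<theta> * sin (\<alpha> - s * \<theta>))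
      - exp (- s) * (\<theta> * sin (\<alpha> - s * \<theta>) - \<theta> * (\<theta> * cos (\<alpha> - s * \<theta>)))) / (1 + \<theta>\<^sup>2)"
      unfolding g_def by (intro DERIV_cdivide) (auto intro!: derivative_eq_intros simp: algebra_simps)
    also have "(exp (- s) * (cos (\<alpha> - s * \<theta>) + \<theta> * sin (\<alpha> - s * \<theta>))
      - exp (- s) * (\<theta> * sin (\<alpha> - s * \<theta>) - \<theta> * (\<theta> * cos (\<alpha> - s * \<theta>)))) / (1 + \<theta>\<^sup>2)
      = exp (- s) * cos (\<alpha> - s * \<theta>) * (1 + \<theta>\<^sup>2) / (1 + \<theta>\<^sup>2)"
      by (simp add: algebra_simps power2_eq_square)
    finally show ?thesis using nz by simp
  qed
  have i: "integrable lborel (\<lambda>s. exp (- s) * cos (\<alpha> - s * \<theta>) * indicator {0<..} s)"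
    using exp_kernel_bound_integrable[of "\<lambda>s. cos (\<alpha> - s * \<theta>)" 1] by (simp add: exp_kernel_def mult_ac)
  have 1: "((\<lambda>s. g s - g 0) \<longlongrightarrow> (\<integral>s. exp (- s) * cos (\<alpha> - s * \<theta>) * indicator {0<..} s \<partial>lborel)) at_top"
    by (rule integral_deriv_half_line_tendsto[OF d i])
  have "(g \<longlongrightarrow> 0) at_top"
  proof (rule Lim_null_comparison)
    have "\<bar>cos (\<alpha> - s * \<theta>) + \<theta> * sin (\<alpha> - s * \<theta>)\<bar> \<le> 1 + \<bar>\<theta>\<bar>" for s
    proof -
      have "\<bar>\<theta> * sin (\<alpha> - s * \<theta>)\<bar> \<le> \<bar>\<theta>\<bar> * 1" unfolding abs_mult by (intro mult_left_mono) auto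
      then show ?thesis using abs_cos_le_one[of "\<alpha> - s * \<theta>"] by linarith
    qed
    then have "norm (g s) \<le> exp (- s) * (1 + \<bar>\<theta>\<bar>) / (1 + \<theta>\<^sup>2)" for s
      unfolding g_def using nz by (simp add: abs_mult divide_right_mono mult_left_mono)
    then show "eventually (\<lambda>s. norm (g s) \<le> exp (- s) * (1 + \<bar>\<theta>\<bar>) / (1 + \<theta>\<^sup>2)) at_top" by simp
    show "((\<lambda>s. exp (- s) * (1 + \<bar>\<theta>\<bar>) / (1 + \<theta>\<^sup>2)) \<longlongrightarrow> 0) at_top"
      by (intro tendsto_divide_zero tendsto_mult_left_zero) real_asymp
  qed
  then have "((\<lambda>s. g s - g 0) \<longlongrightarrow> 0 - g 0) at_top" by (intro tendsto_intros)
  from tendsto_unique[OF _ 1 this] have "(\<integral>s. exp (- s) * cos (\<alpha> - s * \<theta>) * indicator {0<..} s \<partial>lborel) = - g 0"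
    by simp
  moreover have "g 0 = - ((cos \<alpha> + \<theta> * sin \<alpha>) / (1 + \<theta>\<^sup>2))"
    unfolding g_def using nz by (simp add: field_simps)
  ultimately show ?thesis by (simp add: exp_kernel_def mult_ac)
qed

lemma exp_kernel_sin:
  "(\<integral>s. exp_kernel s * sin (\<alpha> - s * \<theta>) \<partial>lborel) = (sin \<alpha> - \<theta> * cos \<alpha>) / (1 + \<theta>\<^sup>2)"
proof -
  have "sin (\<alpha> - s * \<theta>) = cos ((\<alpha> - pi / 2) - s * \<theta>)" for s
    using cos_sin_eq[of "(\<alpha> - pi / 2) - s * \<theta>"] sin_minus[of "s * \<theta> - \<alpha>"]
    by (simp add: cos_diff sin_diff algebra_simps)
  then show ?thesis using exp_kernel_cos[of "\<alpha> - pi / 2" \<theta>] by (simp add: cos_diff sin_diff)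
qed

lemma exp_kernel_total: "(\<integral>s. exp_kernel s \<partial>lborel) = 1"
  using exp_kernel_cos[of 0 0] by simp

lemma exp_kernel_reflected:
  "integrable lborel (\<lambda>s. exp_kernel (- s))" "(\<integral>s. exp_kernel (- s) \<partial>lborel) = 1"
  using lborel_integrable_real_affine[OF exp_kernel_integrable, of "-1" 0]
    lborel_integral_real_affine[of "-1" exp_kernel 0] exp_kernel_total by simp_all

text \<open>
  \<open>b\<close> is the logarithmic derivative of \<open>\<mu>\<close> along the unit vector \<open>e\<close>, up to sign, tested
  on trigonometric functions only.
\<close>

locale log_derivative =
  fixes \<mu> :: "'a::{real_inner, banach, second_countable_topology} measure" and b :: "'a \<Rightarrow> real" and e :: 'a
  assumes finite_mu: "finite_measure \<mu>" and sets_mu[measurable_cong, simp]: "sets \<mu> = sets borel"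
    and b_integrable: "integrable \<mu> b" and norm_e: "norm e = 1"
    and b_cos: "(\<integral>x. b x * cos (inner x h) \<partial>\<mu>) = - inner e h * (\<integral>x. sin (inner x h) \<partial>\<mu>)"
    and b_sin: "(\<integral>x. b x * sin (inner x h) \<partial>\<mu>) = inner e h * (\<integral>x. cos (inner x h) \<partial>\<mu>)"
begin

interpretation finite_measure \<mu> by (rule finite_mu)

lemma b_measurable[measurable]: "b \<in> borel_measurable borel"
  using b_integrable by (auto dest: borel_measurable_integrable)

lemma space_mu[simp]: "space \<mu> = UNIV"
  using sets_eq_imp_space_eq[OF sets_mu] by simp

lemma inner_e_e[simp]: "inner e e = 1"
  using norm_e by (simp add: norm_eq_1)

text \<open>
  The Fourier transforms of both sides agree because \<open>1 / (1 + i \<theta>)\<close> is the transform of the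
  exponential distribution: the equation \<open>i \<theta> \<mu>^ = (b \<mu>)^\<close> is divided by \<open>1 + i \<theta>\<close>.
\<close>

lemma resolvent:
  assumes S[measurable]: "S \<in> sets borel"
  shows "measure \<mu> S = (\<integral>x. (b x + 1) * (\<integral>s. exp_kernel s * indicator S (x - s *\<^sub>R e) \<partial>lborel) \<partial>\<mu>)"
proof -
  interpret P: pair_sigma_finite \<mu> lborel ..
  \<comment> \<open>Negative s are sent to x itself, so the reflected exponential law reproduces
    \<open>\<mu>\<close>, while positive s carry the convolution. The claim becomes the vanishing of
    one signed measure on the product.\<close>
  define \<xi> where "\<xi> p = fst p - max 0 (snd p) *\<^sub>R e" for p :: "'a \<times> real"
  define u where "u p = exp_kernel (- snd p) - (b (fst p) + 1) * exp_kernel (snd p)" for p :: "'a \<times> real"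
  have [measurable]: "\<xi> \<in> borel_measurable (\<mu> \<Otimes>\<^sub>M lborel)" unfolding \<xi>_def by measurable
  have i1: "integrable \<mu> (\<lambda>x. b x + 1)" using b_integrable by simp
  have u: "integrable (\<mu> \<Otimes>\<^sub>M lborel) u"
    using P.integrable_prod_mult[of "\<lambda>_. 1", OF _ exp_kernel_reflected(1)]
      P.integrable_prod_mult[OF i1 exp_kernel_integrable]
    unfolding u_def by (intro Bochner_Integration.integrable_diff) auto
  have fub: "(\<integral>p. u p * f (\<xi> p) \<partial>(\<mu> \<Otimes>\<^sub>M lborel)) =
      (\<integral>x. f x \<partial>\<mu>) - (\<integral>x. (b x + 1) * (\<integral>s. exp_kernel s * f (x - s *\<^sub>R e) \<partial>lborel) \<partial>\<mu>)"
    if [measurable]: "f \<in> borel_measurable borel" and f: "\<And>x. \<bar>f x\<bar> \<le> 1" for f :: "'a \<Rightarrow> real"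
  proof -
    have "integrable (\<mu> \<Otimes>\<^sub>M lborel) (\<lambda>p. u p * f (\<xi> p))"
    proof (rule Bochner_Integration.integrable_bound[OF u])
      have "\<bar>u p\<bar> * \<bar>f (\<xi> p)\<bar> \<le> \<bar>u p\<bar> * 1" for p by (intro mult_left_mono f) auto
      then show "AE p in \<mu> \<Otimes>\<^sub>M lborel. norm (u p * f (\<xi> p)) \<le> norm (u p)" by (simp add: abs_mult)
    qed (use u in measurable)
    then have "(\<integral>p. u p * f (\<xi> p) \<partial>(\<mu> \<Otimes>\<^sub>M lborel)) = (\<integral>x. (\<integral>s. u (x, s) * f (\<xi> (x, s)) \<partial>lborel) \<partial>\<mu>)"
      by (rule P.integral_fst'[symmetric])
    also have "\<dots> = (\<integral>x. f x - (b x + 1) * (\<integral>s. exp_kernel s * f (x - s *\<^sub>R e) \<partial>lborel) \<partial>\<mu>)"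
    proof (rule Bochner_Integration.integral_cong[OF refl])
      fix x
      have "u (x, s) * f (\<xi> (x, s)) = f x * exp_kernel (- s) - (b x + 1) * (exp_kernel s * f (x - s *\<^sub>R e))" for s
        by (auto simp: u_def \<xi>_def exp_kernel_def max_def indicator_def)
      moreover have "integrable lborel (\<lambda>s. exp_kernel s * f (x - s *\<^sub>R e))"
        by (rule exp_kernel_bound_integrable[where B = 1]) (use f in auto)
      ultimately show "(\<integral>s. u (x, s) * f (\<xi> (x, s)) \<partial>lborel)
          = f x - (b x + 1) * (\<integral>s. exp_kernel s * f (x - s *\<^sub>R e) \<partial>lborel)"
        using exp_kernel_reflected by simp
    qed
    also have "\<dots> = (\<integral>x. f x \<partial>\<mu>) - (\<integral>x. (b x + 1) * (\<integral>s. exp_kernel s * f (x - s *\<^sub>R e) \<partial>lborel) \<partial>\<mu>)"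
    proof (rule Bochner_Integration.integral_diff)
      show "integrable \<mu> f" by (rule integrable_const_bound[where B = 1]) (use f in auto)
      show "integrable \<mu> (\<lambda>x. (b x + 1) * (\<integral>s. exp_kernel s * f (x - s *\<^sub>R e) \<partial>lborel))"
      proof (rule Bochner_Integration.integrable_bound[OF i1])
        have "\<bar>\<integral>s. exp_kernel s * f (x - s *\<^sub>R e) \<partial>lborel\<bar> \<le> 1" for x
        proof -
          have "\<bar>\<integral>s. exp_kernel s * f (x - s *\<^sub>R e) \<partial>lborel\<bar> \<le> (\<integral>s. exp_kernel s \<partial>lborel)"
          proof (rule integral_abs_bound_integral)
            show "integrable lborel (\<lambda>s. exp_kernel s * f (x - s *\<^sub>R e))"
              by (rule exp_kernel_bound_integrable[where B = 1]) (use f in auto)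
            show "\<bar>exp_kernel s * f (x - s *\<^sub>R e)\<bar> \<le> exp_kernel s" for s
              using f[of "x - s *\<^sub>R e"] by (auto simp: exp_kernel_def indicator_def abs_mult intro: mult_left_le)
          qed (rule exp_kernel_integrable)
          then show ?thesis by (simp add: exp_kernel_total)
        qed
        then show "AE x in \<mu>. norm ((b x + 1) * (\<integral>s. exp_kernel s * f (x - s *\<^sub>R e) \<partial>lborel)) \<le> norm (b x + 1)"
          by (simp add: abs_mult mult_left_le)
      qed measurable
    qed
    finally show ?thesis .
  qed
  have ic: "integrable \<mu> (\<lambda>x. cos (inner x h))" "integrable \<mu> (\<lambda>x. sin (inner x h))" for h
    by (rule integrable_const_bound[where B = 1]; simp)+
  have ib: "integrable \<mu> (\<lambda>x. b x * cos (inner x h))" "integrable \<mu> (\<lambda>x. b x * sin (inner x h))" for h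
    by (rule Bochner_Integration.integrable_bound[OF b_integrable]; simp add: abs_mult mult_left_le)+
  have "(\<integral>p. u p * indicator S (\<xi> p) \<partial>(\<mu> \<Otimes>\<^sub>M lborel)) = 0"
  proof (rule signed_char_unique[OF _ u])
    fix h :: 'a
    let ?\<theta> = "inner e h"
    have nz: "1 + ?\<theta>\<^sup>2 \<noteq> 0" by (metis add_nonneg_eq_0_iff zero_le_one zero_le_power2 one_neq_zero)
    have "(\<integral>x. (b x + 1) * (\<integral>s. exp_kernel s * cos (inner (x - s *\<^sub>R e) h) \<partial>lborel) \<partial>\<mu>)
      = (\<integral>x. (b x * cos (inner x h) + ?\<theta> * (b x * sin (inner x h)) + (cos (inner x h) + ?\<theta> * sin (inner x h))) / (1 + ?\<theta>\<^sup>2) \<partial>\<mu>)"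
      by (rule Bochner_Integration.integral_cong[OF refl])
        (simp add: inner_diff_left exp_kernel_cos algebra_simps add_divide_distrib)
    also have "\<dots> = ((\<integral>x. b x * cos (inner x h) \<partial>\<mu>) + ?\<theta> * (\<integral>x. b x * sin (inner x h) \<partial>\<mu>)
        + ((\<integral>x. cos (inner x h) \<partial>\<mu>) + ?\<theta> * (\<integral>x. sin (inner x h) \<partial>\<mu>))) / (1 + ?\<theta>\<^sup>2)"
      using ic ib by simp
    \<comment> \<open>The formulas \<open>b_cos\<close> and \<open>b_sin\<close> produce exactly the
      factor 1 + theta^2 of the denominator.\<close>
    also have "\<dots> = ((1 + ?\<theta>\<^sup>2) * (\<integral>x. cos (inner x h) \<partial>\<mu>)) / (1 + ?\<theta>\<^sup>2)"
      by (simp add: b_cos b_sin algebra_simps power2_eq_square)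
    also have "\<dots> = (\<integral>x. cos (inner x h) \<partial>\<mu>)" using nz by simp
    finally show "(\<integral>p. u p * cos (inner (\<xi> p) h) \<partial>(\<mu> \<Otimes>\<^sub>M lborel)) = 0"
      by (subst fub) auto
    have "(\<integral>x. (b x + 1) * (\<integral>s. exp_kernel s * sin (inner (x - s *\<^sub>R e) h) \<partial>lborel) \<partial>\<mu>)
      = (\<integral>x. (b x * sin (inner x h) - ?\<theta> * (b x * cos (inner x h)) + (sin (inner x h) - ?\<theta> * cos (inner x h))) / (1 + ?\<theta>\<^sup>2) \<partial>\<mu>)"
      by (rule Bochner_Integration.integral_cong[OF refl])
        (simp add: inner_diff_left exp_kernel_sin algebra_simps add_divide_distrib diff_divide_distrib)
    also have "\<dots> = ((\<integral>x. b x * sin (inner x h) \<partial>\<mu>) - ?\<theta> * (\<integral>x. b x * cos (inner x h) \<partial>\<mu>)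
        + ((\<integral>x. sin (inner x h) \<partial>\<mu>) - ?\<theta> * (\<integral>x. cos (inner x h) \<partial>\<mu>))) / (1 + ?\<theta>\<^sup>2)"
      using ic ib by simp
    also have "\<dots> = ((1 + ?\<theta>\<^sup>2) * (\<integral>x. sin (inner x h) \<partial>\<mu>)) / (1 + ?\<theta>\<^sup>2)"
      by (simp add: b_cos b_sin algebra_simps power2_eq_square)
    also have "\<dots> = (\<integral>x. sin (inner x h) \<partial>\<mu>)" using nz by simp
    finally show "(\<integral>p. u p * sin (inner (\<xi> p) h) \<partial>(\<mu> \<Otimes>\<^sub>M lborel)) = 0"
      by (subst fub) auto
  qed (use S in auto)
  then show ?thesis by (subst (asm) fub) (auto simp: indicator_def)
qed

section \<open>Lebesgue measure on the lines parallel to \<open>e\<close>\<close>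

definition line_base :: "'a measure" where
  "line_base = density \<mu> (\<lambda>x. ennreal \<bar>b x + 1\<bar>)"

text \<open>Base points are weighted by |b + 1|, the total variation of the measure that
  \<open>resolvent\<close> averages along lines. This makes \<open>\<mu>\<close> absolutely
  continuous with respect to the result, although the whole space carries no reference
  measure.\<close>

definition line_measure :: "'a measure" where
  "line_measure = distr (line_base \<Otimes>\<^sub>M lborel) borel (\<lambda>(x, s). x + s *\<^sub>R e)"

lemma sets_line_base[measurable_cong, simp]: "sets line_base = sets borel"
  by (simp add: line_base_def)

lemma sets_line_measure[measurable_cong, simp]: "sets line_measure = sets borel"
  by (simp add: line_measure_def)

lemma space_line[simp]: "space line_base = UNIV" "space line_measure = UNIV"
  by (simp_all add: line_base_def line_measure_def)

lemma finite_line_base: "finite_measure line_base"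
proof (rule finite_measureI)
  have "emeasure line_base UNIV = (\<integral>\<^sup>+x. ennreal (norm (b x + 1)) \<partial>\<mu>)"
    unfolding line_base_def by (subst emeasure_density) auto
  also have "\<dots> < \<infinity>"
    using Bochner_Integration.integrable_add[OF b_integrable integrable_const[of 1]]
    by (simp add: integrable_iff_bounded)
  finally show "emeasure line_base (space line_base) \<noteq> \<infinity>" by simp
qed

interpretation LB: finite_measure line_base by (rule finite_line_base)
interpretation LP: pair_sigma_finite line_base lborel ..

lemma nn_integral_line_measure:
  assumes [measurable]: "f \<in> borel_measurable borel"
  shows "(\<integral>\<^sup>+x. f x \<partial>line_measure) = (\<integral>\<^sup>+y. (\<integral>\<^sup>+s. f (y + s *\<^sub>R e) \<partial>lborel) \<partial>line_base)"
  unfolding line_measure_def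
  by (subst nn_integral_distr) (auto simp: lborel.nn_integral_fst[symmetric] split_beta)

text \<open>A slab in the coordinate along \<open>e\<close> cuts every line in a segment of length 2
  n, and the base measure is finite.\<close>

lemma sigma_finite_line_measure: "sigma_finite_measure line_measure"
proof
  define A where "A n = {x. \<bar>inner x e\<bar> \<le> real n}" for n
  have [measurable]: "A n \<in> sets borel" for n unfolding A_def by measurable
  have "emeasure line_measure (A n) \<noteq> \<infinity>" for n
  proof -
    have "emeasure line_measure (A n) = (\<integral>\<^sup>+x. indicator (A n) x \<partial>line_measure)" by simp
    also have "\<dots> = (\<integral>\<^sup>+y. (\<integral>\<^sup>+s. indicator (A n) (y + s *\<^sub>R e) \<partial>lborel) \<partial>line_base)"
      by (rule nn_integral_line_measure) simp
    also have "\<dots> = (\<integral>\<^sup>+y. ennreal (2 * real n) \<partial>line_base)"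
    proof (rule nn_integral_cong)
      fix y
      have "(\<integral>\<^sup>+s. indicator (A n) (y + s *\<^sub>R e) \<partial>lborel)
          = (\<integral>\<^sup>+s. indicator {- real n - inner y e..real n - inner y e} s \<partial>lborel)"
        by (rule nn_integral_cong) (auto simp: A_def indicator_def inner_add_left abs_le_iff)
      then show "(\<integral>\<^sup>+s. indicator (A n) (y + s *\<^sub>R e) \<partial>lborel) = ennreal (2 * real n)" by simp
    qed
    also have "\<dots> < \<infinity>" using LB.emeasure_finite[of UNIV] by (simp add: ennreal_mult_eq_top_iff less_top[symmetric])
    finally show ?thesis by simp
  qed
  moreover have "(\<Union>n. A n) = UNIV"
    by (auto simp: A_def real_arch_simple)
  ultimately show "\<exists>A. countable A \<and> A \<subseteq> sets line_measure \<and> \<Union> A = space line_measure \<and>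
      (\<forall>a\<in>A. emeasure line_measure a \<noteq> \<infinity>)"
    by (intro exI[of _ "range A"]) auto
qed

interpretation L: sigma_finite_measure line_measure by (rule sigma_finite_line_measure)
interpretation Q: pair_sigma_finite line_measure lborel ..

lemma nn_integral_line_measure_shift:
  assumes [measurable]: "f \<in> borel_measurable borel"
  shows "(\<integral>\<^sup>+x. f (x + t *\<^sub>R e) \<partial>line_measure) = (\<integral>\<^sup>+x. f x \<partial>line_measure)"
proof -
  have "(\<integral>\<^sup>+s. f (y + s *\<^sub>R e + t *\<^sub>R e) \<partial>lborel) = (\<integral>\<^sup>+s. f (y + s *\<^sub>R e) \<partial>lborel)" for y
    using nn_integral_real_affine[of "\<lambda>s. f (y + s *\<^sub>R e)" 1 t]
    by (simp add: scaleR_add_left add.assoc add.commute[of "t *\<^sub>R e"])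
  then show ?thesis by (simp add: nn_integral_line_measure)
qed

text \<open>Translation invariance along \<open>e\<close> and Fubini give invariance under the
  shear. It is the change of variables that moves a translation from a test set to a
  density.\<close>

lemma distr_shear:
  "distr (line_measure \<Otimes>\<^sub>M lborel) (line_measure \<Otimes>\<^sub>M lborel) (\<lambda>(x, s). (x + s *\<^sub>R e, s)) = line_measure \<Otimes>\<^sub>M lborel"
proof (rule measure_eqI)
  fix A assume "A \<in> sets (distr (line_measure \<Otimes>\<^sub>M lborel) (line_measure \<Otimes>\<^sub>M lborel) (\<lambda>(x, s). (x + s *\<^sub>R e, s)))"
  then have A: "A \<in> sets (line_measure \<Otimes>\<^sub>M lborel)" by simp
  then have [measurable]: "A \<in> sets (borel \<Otimes>\<^sub>M borel)" by (simp cong: sets_pair_measure_cong)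
  have [measurable]: "(\<lambda>(x, s). (x + s *\<^sub>R e, s)) \<in> line_measure \<Otimes>\<^sub>M lborel \<rightarrow>\<^sub>M line_measure \<Otimes>\<^sub>M lborel"
    by measurable
  have "emeasure (distr (line_measure \<Otimes>\<^sub>M lborel) (line_measure \<Otimes>\<^sub>M lborel) (\<lambda>(x, s). (x + s *\<^sub>R e, s))) A
     = integral\<^sup>N (distr (line_measure \<Otimes>\<^sub>M lborel) (line_measure \<Otimes>\<^sub>M lborel) (\<lambda>(x, s). (x + s *\<^sub>R e, s))) (indicator A)"
    by (rule nn_integral_indicator[symmetric]) (use A in simp)
  also have "\<dots> = (\<integral>\<^sup>+p. indicator A (case p of (x, s) \<Rightarrow> (x + s *\<^sub>R e, s)) \<partial>(line_measure \<Otimes>\<^sub>M lborel))"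
    by (rule nn_integral_distr) auto
  also have "\<dots> = (\<integral>\<^sup>+s. (\<integral>\<^sup>+x. indicator A (x + s *\<^sub>R e, s) \<partial>line_measure) \<partial>lborel)"
    by (subst Q.nn_integral_snd[symmetric]) auto
  also have "\<dots> = (\<integral>\<^sup>+s. (\<integral>\<^sup>+x. indicator A (x, s) \<partial>line_measure) \<partial>lborel)"
    by (intro nn_integral_cong nn_integral_line_measure_shift[where f = "\<lambda>x. indicator A (x, s)" for s]) simp
  also have "\<dots> = integral\<^sup>N (line_measure \<Otimes>\<^sub>M lborel) (indicator A)"
    by (rule Q.nn_integral_snd) simp
  also have "\<dots> = emeasure (line_measure \<Otimes>\<^sub>M lborel) A"
    by (rule nn_integral_indicator) (rule A)
  finally show "emeasure (distr (line_measure \<Otimes>\<^sub>M lborel) (line_measure \<Otimes>\<^sub>M lborel) (\<lambda>(x, s). (x + s *\<^sub>R e, s))) A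
     = emeasure (line_measure \<Otimes>\<^sub>M lborel) A" .
qed simp

text \<open>At almost every base point, either the line meets \<open>S\<close> in a Lebesgue null
  set, and the average in \<open>resolvent\<close> vanishes, or the factor b + 1 is zero.\<close>

lemma absolutely_continuous_line_measure: "absolutely_continuous line_measure \<mu>"
  unfolding absolutely_continuous_def
proof
  fix S assume "S \<in> null_sets line_measure"
  then have [measurable]: "S \<in> sets borel" and "emeasure line_measure S = 0" by auto
  then have "(\<integral>\<^sup>+y. (\<integral>\<^sup>+s. indicator S (y + s *\<^sub>R e) \<partial>lborel) \<partial>line_base) = 0"
    using nn_integral_line_measure[of "indicator S"] nn_integral_indicator[of S line_measure] by simp
  then have "AE y in line_base. (\<integral>\<^sup>+s. indicator S (y + s *\<^sub>R e) \<partial>lborel) = (0::ennreal)"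
    by (subst (asm) nn_integral_0_iff_AE) auto
  then have "AE y in \<mu>. \<bar>b y + 1\<bar> > 0 \<longrightarrow> (\<integral>\<^sup>+s. indicator S (y + s *\<^sub>R e) \<partial>lborel) = (0::ennreal)"
    unfolding line_base_def by (subst (asm) AE_density) auto
  then have "AE y in \<mu>. (b y + 1) * (\<integral>s. exp_kernel s * indicator S (y - s *\<^sub>R e) \<partial>lborel) = 0"
  proof eventually_elim
    case (elim y)
    show ?case
    proof (cases "b y + 1 = 0")
      case False
      with elim have "(\<integral>\<^sup>+s. indicator S (y + s *\<^sub>R e) \<partial>lborel) = (0::ennreal)" by simp
      then have "(\<integral>\<^sup>+s. indicator S (y - s *\<^sub>R e) \<partial>lborel) = (0::ennreal)"
        using nn_integral_real_affine[of "\<lambda>s. indicator S (y + s *\<^sub>R e)" "-1" 0] by simp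
      then have "AE s in lborel. indicator S (y - s *\<^sub>R e) = (0::ennreal)"
        by (subst (asm) nn_integral_0_iff_AE) auto
      then have "AE s in lborel. exp_kernel s * indicator S (y - s *\<^sub>R e) = 0"
        by eventually_elim (auto simp: indicator_def split: if_splits)
      then show ?thesis by (simp add: integral_eq_zero_AE)
    qed simp
  qed
  then have "measure \<mu> S = 0"
    unfolding resolvent[OF \<open>S \<in> sets borel\<close>] by (rule integral_eq_zero_AE)
  then show "S \<in> null_sets \<mu>" by (auto simp: null_sets_def emeasure_eq_measure)
qed

section \<open>Densities on the lines\<close>

lemma line_density:
  obtains D where "D \<in> borel_measurable borel" "\<And>x. 0 \<le> D x" "density line_measure (\<lambda>x. ennreal (D x)) = \<mu>"
proof -
  obtain D where D: "D \<in> borel_measurable line_measure" "AE x in line_measure. RN_deriv line_measure \<mu> x = ennreal (D x)"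
    "\<And>x. 0 \<le> D x"
    using L.real_RN_deriv[OF finite_mu absolutely_continuous_line_measure] by auto
  have "density line_measure (\<lambda>x. ennreal (D x)) = density line_measure (RN_deriv line_measure \<mu>)"
    by (rule density_cong) (use D in auto)
  also have "\<dots> = \<mu>" by (rule L.density_RN_deriv[OF absolutely_continuous_line_measure]) simp
  finally show thesis using that[of D] D by simp
qed

text \<open>The density version of \<open>resolvent\<close>: the shear moves the convolution from
  the test set to D (b + 1), and comparison on all Borel sets identifies the densities almost
  everywhere.\<close>

lemma line_density_equation:
  assumes D[measurable]: "D \<in> borel_measurable borel" "\<And>x. 0 \<le> D x" "density line_measure (\<lambda>x. ennreal (D x)) = \<mu>"
  defines "Q \<equiv> \<lambda>x. \<integral>s. exp_kernel s * (D (x + s *\<^sub>R e) * (b (x + s *\<^sub>R e) + 1)) \<partial>lborel"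
  shows "AE x in line_measure. D x = Q x" "integrable line_measure (\<lambda>x. D x * (b x + 1))"
proof -
  let ?g = "\<lambda>x. D x * (b x + 1)"
  have "integrable \<mu> (\<lambda>x. b x + 1)" using b_integrable by simp
  then have "integrable (density line_measure (\<lambda>x. ennreal (D x))) (\<lambda>x. b x + 1)" by (simp only: D(3))
  then show g: "integrable line_measure ?g"
    by (subst (asm) integrable_density) (use D(2) in auto)
  have iD: "integrable line_measure D"
  proof -
    have "integrable (density line_measure (\<lambda>x. ennreal (D x))) (\<lambda>x. 1::real)" by (simp add: D(3))
    then show ?thesis by (subst (asm) integrable_density) (use D(2) in auto)
  qed
  let ?\<tau> = "\<lambda>(x, s). (x + s *\<^sub>R e, s)"
  have \<tau>[measurable]: "?\<tau> \<in> line_measure \<Otimes>\<^sub>M lborel \<rightarrow>\<^sub>M line_measure \<Otimes>\<^sub>M lborel" by measurable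
  have gk: "integrable (line_measure \<Otimes>\<^sub>M lborel) (\<lambda>p. ?g (fst p) * exp_kernel (snd p))"
    by (rule Q.integrable_prod_mult[OF g exp_kernel_integrable])
  then have "integrable (distr (line_measure \<Otimes>\<^sub>M lborel) (line_measure \<Otimes>\<^sub>M lborel) ?\<tau>) (\<lambda>p. ?g (fst p) * exp_kernel (snd p))"
    by (simp only: distr_shear)
  then have gk\<tau>: "integrable (line_measure \<Otimes>\<^sub>M lborel) (\<lambda>(x, s). exp_kernel s * ?g (x + s *\<^sub>R e))"
    by (subst (asm) integrable_distr_eq) (auto simp: case_prod_beta' mult_ac)
  have iQ: "integrable line_measure Q" unfolding Q_def by (rule Q.integrable_fst[OF gk\<tau>])
  show "AE x in line_measure. D x = Q x"
  proof (rule density_unique_real[OF iD iQ])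
    fix S assume "S \<in> sets line_measure"
    then have S[measurable]: "S \<in> sets borel" by simp
    let ?F = "\<lambda>p. ?g (fst p) * exp_kernel (snd p) * indicator S (fst p - snd p *\<^sub>R e)"
    have F: "integrable (line_measure \<Otimes>\<^sub>M lborel) ?F"
      by (rule Bochner_Integration.integrable_bound[OF gk]) (auto simp: indicator_def)
    have "measure \<mu> S = (\<integral>x. indicator S x \<partial>density line_measure (\<lambda>x. ennreal (D x)))"
      by (simp add: D(3))
    also have "\<dots> = (LINT x:S|line_measure. D x)"
      by (subst integral_density) (use D(2) in \<open>auto simp: set_lebesgue_integral_def mult.commute\<close>)
    finally have 1: "(LINT x:S|line_measure. D x) = measure \<mu> S" ..
    have "measure \<mu> S = (\<integral>x. (b x + 1) * (\<integral>s. exp_kernel s * indicator S (x - s *\<^sub>R e) \<partial>lborel) \<partial>density line_measure (\<lambda>x. ennreal (D x)))"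
      by (simp only: D(3) resolvent[OF S])
    also have "\<dots> = (\<integral>x. D x * ((b x + 1) * (\<integral>s. exp_kernel s * indicator S (x - s *\<^sub>R e) \<partial>lborel)) \<partial>line_measure)"
      by (subst integral_density) (use D(2) in auto)
    also have "\<dots> = (\<integral>x. (\<integral>s. ?F (x, s) \<partial>lborel) \<partial>line_measure)"
      by (simp add: mult.assoc)
    also have "\<dots> = (\<integral>p. ?F p \<partial>(line_measure \<Otimes>\<^sub>M lborel))" by (rule Q.integral_fst'[OF F])
    also have "\<dots> = (\<integral>p. ?F p \<partial>distr (line_measure \<Otimes>\<^sub>M lborel) (line_measure \<Otimes>\<^sub>M lborel) ?\<tau>)"
      by (simp only: distr_shear)
    also have "\<dots> = (\<integral>(x, s). indicator S x * (exp_kernel s * ?g (x + s *\<^sub>R e)) \<partial>(line_measure \<Otimes>\<^sub>M lborel))"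
      by (subst integral_distr) (auto simp: case_prod_beta' mult_ac)
    also have "\<dots> = (\<integral>x. (\<integral>s. indicator S x * (exp_kernel s * ?g (x + s *\<^sub>R e)) \<partial>lborel) \<partial>line_measure)"
    proof (rule Q.integral_fst[symmetric])
      show "integrable (line_measure \<Otimes>\<^sub>M lborel) (\<lambda>(x, s). indicator S x * (exp_kernel s * ?g (x + s *\<^sub>R e)))"
        by (rule Bochner_Integration.integrable_bound[OF gk\<tau>]) (auto simp: indicator_def)
    qed
    also have "\<dots> = (LINT x:S|line_measure. Q x)"
      by (simp add: Q_def set_lebesgue_integral_def)
    finally show "(LINT x:S|line_measure. D x) = (LINT x:S|line_measure. Q x)" using 1 by simp
  qed
qed

text \<open>The integral equation is solved by the right-hand side \<open>Q\<close>, which is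
  defined at every point, whereas \<open>D\<close> agrees with it only almost everywhere.
  Multiplication by exp(-t) turns the convolution into an integral over the half-line beyond
  t.\<close>

lemma line_density_exp:
  assumes D[measurable]: "D \<in> borel_measurable borel" "\<And>x. 0 \<le> D x" "density line_measure (\<lambda>x. ennreal (D x)) = \<mu>"
    and V: "\<And>x. ((\<lambda>s. V (x + s *\<^sub>R e)) has_real_derivative b x) (at 0)"
  shows "AE y in line_base. \<exists>\<kappa>. AE s in lborel. D (y + s *\<^sub>R e) = \<kappa> * exp (- V (y + s *\<^sub>R e))"
proof -
  let ?g = "\<lambda>x. D x * (b x + 1)"
  define Q where "Q x = (\<integral>s. exp_kernel s * ?g (x + s *\<^sub>R e) \<partial>lborel)" for x
  have [measurable]: "Q \<in> borel_measurable borel" unfolding Q_def by measurable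
  note eq = line_density_equation[OF D, folded Q_def]
  have "AE p in line_base \<Otimes>\<^sub>M lborel. D (case p of (x, s) \<Rightarrow> x + s *\<^sub>R e) = Q (case p of (x, s) \<Rightarrow> x + s *\<^sub>R e)"
    using eq(1) unfolding line_measure_def by (subst (asm) AE_distr_iff) auto
  then have 1: "AE y in line_base. AE s in lborel. D (y + s *\<^sub>R e) = Q (y + s *\<^sub>R e)"
    using LP.AE_pair by fastforce
  have "integrable (line_base \<Otimes>\<^sub>M lborel) (\<lambda>(y, s). ?g (y + s *\<^sub>R e))"
    using eq(2) unfolding line_measure_def by (subst (asm) integrable_distr_eq) (auto simp: case_prod_beta')
  then have 2: "AE y in line_base. integrable lborel (\<lambda>s. ?g (y + s *\<^sub>R e))"
    by (rule LP.AE_integrable_fst)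
  from 1 2 show ?thesis
  proof eventually_elim
    case (elim y)
    \<comment> \<open>The extra s in \<open>W\<close> accounts for the 1 in b + 1; in the solution
      it is cancelled by the factor exp(-s) of \<open>F\<close>.\<close>
    define W where "W s = V (y + s *\<^sub>R e) + s" for s
    define F where "F s = exp (- s) * Q (y + s *\<^sub>R e)" for s
    have W: "DERIV W s :> b (y + s *\<^sub>R e) + 1" for s
    proof -
      have "((\<lambda>r. V (y + (s + r) *\<^sub>R e)) has_real_derivative b (y + s *\<^sub>R e)) (at 0)"
        using V[of "y + s *\<^sub>R e"] by (simp add: scaleR_add_left add.assoc)
      then have "DERIV (\<lambda>s. V (y + s *\<^sub>R e)) s :> b (y + s *\<^sub>R e)"
        by (simp add: DERIV_def)
      then show ?thesis unfolding W_def by (auto intro!: derivative_eq_intros)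
    qed
    have ae: "AE s in lborel. exp (- s) * ?g (y + s *\<^sub>R e) * indicator {t<..} s
        = (b (y + s *\<^sub>R e) + 1) * F s * indicator {t<..} s" for t
      using elim(1) by eventually_elim (simp add: F_def)
    have i: "integrable lborel (\<lambda>s. exp (- s) * ?g (y + s *\<^sub>R e) * indicator {t<..} s)" for t
    proof (rule Bochner_Integration.integrable_bound)
      show "integrable lborel (\<lambda>s. exp (- t) * ?g (y + s *\<^sub>R e))" using elim(2) by simp
      show "AE s in lborel. norm (exp (- s) * ?g (y + s *\<^sub>R e) * indicator {t<..} s) \<le> norm (exp (- t) * ?g (y + s *\<^sub>R e))"
        by (auto simp: indicator_def abs_mult intro!: mult_right_mono)
    qed measurable
    obtain \<kappa> where \<kappa>: "\<And>t. F t = \<kappa> * exp (- W t)"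
    proof (rule integral_equation_solution[OF W])
      show "integrable lborel (\<lambda>s. (b (y + s *\<^sub>R e) + 1) * F s * indicator {t<..} s)" for t
        by (rule integrable_cong_AE_imp[OF i _ ae]) (simp add: F_def)
      show "F t = (\<integral>s. (b (y + s *\<^sub>R e) + 1) * F s * indicator {t<..} s \<partial>lborel)" for t
      proof -
        have "F t = (\<integral>s. exp (- t) * (exp_kernel s * ?g (y + (t + s) *\<^sub>R e)) \<partial>lborel)"
          by (simp add: F_def Q_def scaleR_add_left add.assoc)
        also have "\<dots> = (\<integral>s. exp (- (t + s)) * ?g (y + (t + s) *\<^sub>R e) * indicator {t<..} (t + s) \<partial>lborel)"
          by (rule Bochner_Integration.integral_cong) (auto simp: exp_kernel_def indicator_def exp_diff exp_minus field_simps exp_add)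
        also have "\<dots> = (\<integral>s. exp (- s) * ?g (y + s *\<^sub>R e) * indicator {t<..} s \<partial>lborel)"
          using lborel_integral_real_affine[of 1 "\<lambda>s. exp (- s) * ?g (y + s *\<^sub>R e) * indicator {t<..} s" t] by simp
        also have "\<dots> = (\<integral>s. (b (y + s *\<^sub>R e) + 1) * F s * indicator {t<..} s \<partial>lborel)"
          by (rule integral_cong_AE[OF _ _ ae]) (simp_all add: F_def)
        finally show ?thesis .
      qed
    qed blast
    have "AE s in lborel. D (y + s *\<^sub>R e) = \<kappa> * exp (- V (y + s *\<^sub>R e))"
      using elim(1)
    proof eventually_elim
      case (elim s)
      have "Q (y + s *\<^sub>R e) = exp s * F s" by (simp add: F_def exp_minus)
      also have "\<dots> = \<kappa> * exp (- V (y + s *\<^sub>R e))" by (simp add: \<kappa> W_def exp_diff exp_minus field_simps)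
      finally show ?case using elim by simp
    qed
    then show ?case by blast
  qed
qed

lemma nn_integral_line_density:
  assumes D[measurable]: "D \<in> borel_measurable borel" "density line_measure (\<lambda>x. ennreal (D x)) = \<mu>"
    and [measurable]: "f \<in> borel_measurable borel"
  shows "(\<integral>\<^sup>+x. f x \<partial>\<mu>) = (\<integral>\<^sup>+y. (\<integral>\<^sup>+s. ennreal (D (y + s *\<^sub>R e)) * f (y + s *\<^sub>R e) \<partial>lborel) \<partial>line_base)"
  by (subst D(2)[symmetric], subst nn_integral_density) (auto simp: nn_integral_line_measure)

text \<open>The Gibbs property: given the line through a point, the position on it is normal.\<close>

lemma resample_invariant:
  assumes V: "\<And>x. ((\<lambda>s. V (x + s *\<^sub>R e)) has_real_derivative b x) (at 0)"
    and l: "l > 0" and G: "\<And>x. V x = G x + (inner x e)\<^sup>2 / (2 * l)" and G_meas[measurable]: "G \<in> borel_measurable borel"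
    and f[measurable]: "f \<in> borel_measurable borel"
  shows "(\<integral>\<^sup>+x. (\<integral>\<^sup>+t. f (x - inner x e *\<^sub>R e + t *\<^sub>R e) \<partial>density lborel (normal_density 0 (sqrt l)))
      \<partial>density \<mu> (\<lambda>x. ennreal (exp (G x)))) = (\<integral>\<^sup>+x. f x \<partial>density \<mu> (\<lambda>x. ennreal (exp (G x))))"
proof -
  obtain D where D[measurable]: "D \<in> borel_measurable borel" "\<And>x. 0 \<le> D x" "density line_measure (\<lambda>x. ennreal (D x)) = \<mu>"
    using line_density by blast
  let ?nd = "normal_density 0 (sqrt l)"
  define g where "g x = (\<integral>\<^sup>+t. f (x - inner x e *\<^sub>R e + t *\<^sub>R e) \<partial>density lborel ?nd)" for x
  have [measurable]: "g \<in> borel_measurable borel"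
  proof -
    interpret N: prob_space "density lborel ?nd" by (rule prob_space_normal_density) (use l in simp)
    show ?thesis unfolding g_def by measurable
  qed
  have eq: "(\<integral>\<^sup>+x. h x \<partial>density \<mu> (\<lambda>x. ennreal (exp (G x)))) =
     (\<integral>\<^sup>+y. (\<integral>\<^sup>+s. ennreal (D (y + s *\<^sub>R e)) * (ennreal (exp (G (y + s *\<^sub>R e))) * h (y + s *\<^sub>R e)) \<partial>lborel) \<partial>line_base)"
    if [measurable]: "h \<in> borel_measurable borel" for h
    by (subst nn_integral_density, simp, simp, subst nn_integral_line_density[OF D(1,3)]) auto
  show ?thesis
    unfolding g_def[symmetric] eq[OF f] eq[OF \<open>g \<in> borel_measurable borel\<close>]
  proof (rule nn_integral_cong_AE)
    show "AE y in line_base. (\<integral>\<^sup>+s. ennreal (D (y + s *\<^sub>R e)) * (ennreal (exp (G (y + s *\<^sub>R e))) * g (y + s *\<^sub>R e)) \<partial>lborel)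
       = (\<integral>\<^sup>+s. ennreal (D (y + s *\<^sub>R e)) * (ennreal (exp (G (y + s *\<^sub>R e))) * f (y + s *\<^sub>R e)) \<partial>lborel)"
      using line_density_exp[OF D V]
    proof eventually_elim
      case (elim y)
      then obtain \<kappa> where \<kappa>: "AE s in lborel. D (y + s *\<^sub>R e) = \<kappa> * exp (- V (y + s *\<^sub>R e))" by blast
      \<comment> \<open>The root is the normalizing constant of the normal density with variance
        \<open>l\<close>.\<close>
      let ?c = "\<kappa> * sqrt (2 * pi * l)" and ?r = "inner y e"
      have DG: "AE s in lborel. ennreal (D (y + s *\<^sub>R e)) * ennreal (exp (G (y + s *\<^sub>R e)))
         = ennreal ?c * ennreal (?nd (?r + s))"
        using \<kappa>
      proof eventually_elim
        case (elim s)
        \<comment> \<open>Multiplication by exp(G) leaves of exp(-V) only the Gaussian factor in the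
          coordinate r + s along \<open>e\<close>.\<close>
        have "exp (- V (y + s *\<^sub>R e)) * exp (G (y + s *\<^sub>R e)) = exp (- (?r + s)\<^sup>2 / (2 * l))"
          unfolding exp_add[symmetric] by (simp add: G inner_add_left)
        also have "\<dots> = sqrt (2 * pi * l) * ?nd (?r + s)"
          using l by (simp add: normal_density_def)
        finally have "D (y + s *\<^sub>R e) * exp (G (y + s *\<^sub>R e)) = ?c * ?nd (?r + s)"
          using elim by (simp add: mult.assoc)
        then show ?case using D(2) by (metis ennreal_mult'' exp_ge_zero normal_density_nonneg)
      qed
      have shift: "(\<integral>\<^sup>+s. ennreal (?nd (?r + s)) * h (?r + s) \<partial>lborel) = (\<integral>\<^sup>+s. ennreal (?nd s) * h s \<partial>lborel)"
        if [measurable]: "h \<in> borel_measurable borel" for h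
        using nn_integral_real_affine[of "\<lambda>s. ennreal (?nd s) * h s" 1 ?r] by simp
      have step: "(\<integral>\<^sup>+s. ennreal (D (y + s *\<^sub>R e)) * (ennreal (exp (G (y + s *\<^sub>R e))) * h (y + s *\<^sub>R e)) \<partial>lborel)
          = ennreal ?c * (\<integral>\<^sup>+s. ennreal (?nd s) * h (y - ?r *\<^sub>R e + s *\<^sub>R e) \<partial>lborel)"
        if [measurable]: "h \<in> borel_measurable borel" for h
      proof -
        have "(\<integral>\<^sup>+s. ennreal (D (y + s *\<^sub>R e)) * (ennreal (exp (G (y + s *\<^sub>R e))) * h (y + s *\<^sub>R e)) \<partial>lborel)
          = (\<integral>\<^sup>+s. ennreal ?c * (ennreal (?nd (?r + s)) * h (y - ?r *\<^sub>R e + (?r + s) *\<^sub>R e)) \<partial>lborel)"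
          by (rule nn_integral_cong_AE) (use DG in eventually_elim, simp add: mult.assoc[symmetric] scaleR_add_left)
        also have "\<dots> = ennreal ?c * (\<integral>\<^sup>+s. ennreal (?nd (?r + s)) * h (y - ?r *\<^sub>R e + (?r + s) *\<^sub>R e) \<partial>lborel)"
          by (rule nn_integral_cmult) measurable
        also have "(\<integral>\<^sup>+s. ennreal (?nd (?r + s)) * h (y - ?r *\<^sub>R e + (?r + s) *\<^sub>R e) \<partial>lborel)
          = (\<integral>\<^sup>+s. ennreal (?nd s) * h (y - ?r *\<^sub>R e + s *\<^sub>R e) \<partial>lborel)"
          by (rule shift) measurable
        finally show ?thesis .
      qed
      \<comment> \<open>\<open>g\<close> averages over the coordinate along \<open>e\<close>, so it
        is constant on the line.\<close>
      have gy: "g (y - ?r *\<^sub>R e + s *\<^sub>R e) = g y" for s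
        by (simp add: g_def inner_add_left inner_diff_left)
      have nd1: "(\<integral>\<^sup>+s. ennreal (?nd s) \<partial>lborel) = 1"
      proof -
        interpret N: prob_space "density lborel ?nd" by (rule prob_space_normal_density) (use l in simp)
        show ?thesis using N.emeasure_space_1 by (simp add: emeasure_density)
      qed
      have "(\<integral>\<^sup>+s. ennreal (?nd s) * g (y - ?r *\<^sub>R e + s *\<^sub>R e) \<partial>lborel) = g y"
        by (simp add: gy nn_integral_multc nd1)
      also have "g y = (\<integral>\<^sup>+s. ennreal (?nd s) * f (y - ?r *\<^sub>R e + s *\<^sub>R e) \<partial>lborel)"
        unfolding g_def by (subst nn_integral_density) auto
      finally show ?case by (simp only: step[OF f] step[OF \<open>g \<in> borel_measurable borel\<close>])
    qed
  qed
qed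

end

section \<open>Uniqueness of Gibbs measures\<close>

lemma inner_proj_upto_ge:
  assumes "onseq e" "n \<le> i" shows "inner (proj_upto e n x) (e i) = 0"
  using assms by (simp add: inner_proj_upto)

lemma proj_upto_linear:
  "proj_upto e n (x + y) = proj_upto e n x + proj_upto e n y"
  "proj_upto e n (x - y) = proj_upto e n x - proj_upto e n y"
  "proj_upto e n (c *\<^sub>R x) = c *\<^sub>R proj_upto e n x"
  by (simp_all add: proj_upto_def inner_add_left inner_diff_left scaleR_add_left scaleR_diff_left
      sum.distrib sum_subtractf scaleR_sum_right)

lemma proj_upto_basis_ge:
  assumes "onseq e" "n \<le> i" shows "proj_upto e n (e i) = 0"
  unfolding proj_upto_def using assms by (intro sum.neutral) (auto simp: onseq_def)

lemma borel_measurable_proj_upto[measurable (raw)]: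
  fixes f :: "'b \<Rightarrow> 'a::{real_inner, second_countable_topology}"
  assumes "f \<in> borel_measurable M" shows "(\<lambda>x. proj_upto e n (f x)) \<in> borel_measurable M"
  using assms unfolding proj_upto_def by measurable

text \<open>Nonnegative integrals keep the notion meaningful for infinite measures, such as exp U
  times \<open>Q\<close> before its finiteness is known.\<close>

definition resample_invariant ::
  "'a::real_inner measure \<Rightarrow> (nat \<Rightarrow> 'a) \<Rightarrow> 'a measure \<Rightarrow> bool" where
  "resample_invariant N e R \<longleftrightarrow> (\<forall>i. \<forall>f\<in>borel_measurable borel.
     (\<integral>\<^sup>+x. (\<integral>\<^sup>+z. f (resample (e i) x z) \<partial>N) \<partial>R) = (\<integral>\<^sup>+x. f x \<partial>R))"

lemma resample_invariantD:
  "resample_invariant N e R \<Longrightarrow> f \<in> borel_measurable borel \<Longrightarrow>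
    (\<integral>\<^sup>+x. (\<integral>\<^sup>+z. f (resample (e i) x z) \<partial>N) \<partial>R) = (\<integral>\<^sup>+x. f x \<partial>R)"
  by (simp add: resample_invariant_def)

text \<open>Coordinate \<open>n\<close> is treated by the invariance of \<open>R\<close>, the
  earlier ones by induction. This produces two independent samples, which merge into one because
  \<open>N\<close> is itself invariant.\<close>

lemma iterated_resample:
  fixes N R :: "'a::{real_inner, second_countable_topology} measure"
  assumes e: "onseq e" and N: "prob_space N" and sN[measurable_cong, simp]: "sets N = sets borel"
    and sR[measurable_cong, simp]: "sets R = sets borel"
    and invN: "resample_invariant N e N"
    and invR: "resample_invariant N e R"
    and f: "f \<in> borel_measurable borel"
  shows "(\<integral>\<^sup>+x. (\<integral>\<^sup>+z. f (x - proj_upto e n x + proj_upto e n z) \<partial>N) \<partial>R) = (\<integral>\<^sup>+x. f x \<partial>R)"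
  using f
proof (induction n arbitrary: f)
  case 0
  interpret prob_space N by fact
  show ?case by (simp add: proj_upto_def emeasure_space_1)
next
  case (Suc n)
  interpret prob_space N by fact
  have [measurable]: "f \<in> borel_measurable borel" by fact
  define g where "g x = (\<integral>\<^sup>+z. f (resample (e n) x z) \<partial>N)" for x
  have [measurable]: "g \<in> borel_measurable borel" unfolding g_def by measurable
  have ee: "inner (e n) (e n) *\<^sub>R e n = e n" by (rule onseq_inner_self[OF e])
  have P: "proj_upto e (Suc n) x = proj_upto e n x + inner x (e n) *\<^sub>R e n" for x
    by (simp add: proj_upto_def)
  have "(\<integral>\<^sup>+z. g (x - proj_upto e n x + proj_upto e n z) \<partial>N)
      = (\<integral>\<^sup>+z. f (x - proj_upto e (Suc n) x + proj_upto e (Suc n) z) \<partial>N)" for x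
  proof -
    let ?F = "\<lambda>z. f (x - proj_upto e (Suc n) x + proj_upto e (Suc n) z)"
    \<comment> \<open>Both sides keep x beyond coordinate \<open>n\<close>, take z below it and the
      second sample at it.\<close>
    have "resample (e n) (x - proj_upto e n x + proj_upto e n z) z'
        = x - proj_upto e (Suc n) x + proj_upto e (Suc n) (resample (e n) z z')" for z z'
    proof -
      have "e n = 0 \<or> inner (e n) (e n) = 1" using e by (auto simp: onseq_def norm_eq_1)
      then show ?thesis
        by (elim disjE) (simp_all add: resample_def P proj_upto_linear proj_upto_basis_ge[OF e] inner_add_left
            inner_diff_left inner_proj_upto_ge[OF e])
    qed
    then have "(\<integral>\<^sup>+z. g (x - proj_upto e n x + proj_upto e n z) \<partial>N)
        = (\<integral>\<^sup>+z. (\<integral>\<^sup>+z'. ?F (resample (e n) z z') \<partial>N) \<partial>N)" by (simp add: g_def)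
    also have "\<dots> = (\<integral>\<^sup>+z. ?F z \<partial>N)" by (rule resample_invariantD[OF invN]) measurable
    finally show ?thesis .
  qed
  then have "(\<integral>\<^sup>+x. (\<integral>\<^sup>+z. f (x - proj_upto e (Suc n) x + proj_upto e (Suc n) z) \<partial>N) \<partial>R)
     = (\<integral>\<^sup>+x. (\<integral>\<^sup>+z. g (x - proj_upto e n x + proj_upto e n z) \<partial>N) \<partial>R)" by simp
  also have "\<dots> = (\<integral>\<^sup>+x. g x \<partial>R)" by (rule Suc.IH) measurable
  also have "\<dots> = (\<integral>\<^sup>+x. f x \<partial>R)" unfolding g_def by (rule resample_invariantD[OF invR]) measurable
  finally show ?case .
qed

text \<open>As n grows the resampled point tends to z, and indicators of open sets are lower
  semicontinuous; Fatou's lemma in both variables gives the inequality. It also holds for infinite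
  \<open>R\<close> and will be the source of finiteness.\<close>

lemma resample_invariant_open:
  fixes N R :: "'a::{real_inner, second_countable_topology} measure"
  assumes e: "complete_onseq e" and N: "prob_space N" and sN[measurable_cong, simp]: "sets N = sets borel"
    and sR[measurable_cong, simp]: "sets R = sets borel"
    and invN: "resample_invariant N e N"
    and invR: "resample_invariant N e R"
    and S: "open S"
  shows "emeasure R UNIV * emeasure N S \<le> emeasure R S"
proof -
  interpret prob_space N by fact
  have [measurable]: "S \<in> sets borel" using S by simp
  have sp[simp]: "space R = UNIV" using sets_eq_imp_space_eq[OF sR] by simp
  have os: "onseq e" using e by (simp add: complete_onseq_def)
  let ?h = "\<lambda>n x z. x - proj_upto e n x + proj_upto e n z"
  have lsc: "indicator S z \<le> liminf (\<lambda>n. indicator S (?h n x z) :: ennreal)" for x z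
  proof (cases "z \<in> S")
    case True
    have "(\<lambda>n. ?h n x z) \<longlonglongrightarrow> x - x + z"
      by (intro tendsto_intros) (use e in \<open>auto simp: complete_onseq_def\<close>)
    then have "eventually (\<lambda>n. ?h n x z \<in> S) sequentially"
      using topological_tendstoD[OF _ S] True by auto
    then have "eventually (\<lambda>n. 1 \<le> (indicator S (?h n x z) :: ennreal)) sequentially"
      by eventually_elim simp
    then have "1 \<le> liminf (\<lambda>n. indicator S (?h n x z) :: ennreal)" by (rule Liminf_bounded)
    with True show ?thesis by simp
  qed simp
  have "emeasure R UNIV * emeasure N S = (\<integral>\<^sup>+x. (\<integral>\<^sup>+z. indicator S z \<partial>N) \<partial>R)"
    by (simp add: mult.commute)
  also have "\<dots> \<le> (\<integral>\<^sup>+x. (\<integral>\<^sup>+z. liminf (\<lambda>n. indicator S (?h n x z)) \<partial>N) \<partial>R)"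
    by (intro nn_integral_mono lsc)
  also have "\<dots> \<le> (\<integral>\<^sup>+x. liminf (\<lambda>n. \<integral>\<^sup>+z. indicator S (?h n x z) \<partial>N) \<partial>R)"
    by (intro nn_integral_mono nn_integral_liminf) measurable
  also have "\<dots> \<le> liminf (\<lambda>n. \<integral>\<^sup>+x. (\<integral>\<^sup>+z. indicator S (?h n x z) \<partial>N) \<partial>R)"
    by (intro nn_integral_liminf) measurable
  also have "\<dots> = emeasure R S"
  proof -
    have "(\<integral>\<^sup>+x. (\<integral>\<^sup>+z. indicator S (?h n x z) \<partial>N) \<partial>R) = emeasure R S" for n
      using iterated_resample[OF os N sN sR invN invR, of "indicator S" n] nn_integral_indicator[of S R]
      by simp
    then show ?thesis by (simp add: Liminf_const)
  qed
  finally show ?thesis .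
qed

text \<open>Closed sets are decreasing limits of open neighbourhoods, so the inequality passes to
  them. For the complement of an open set it becomes the reverse inequality, because both sides have
  the same total mass.\<close>

lemma measure_eq_of_open_le:
  fixes R N :: "'a::metric_space measure"
  assumes R: "finite_measure R" "sets R = sets borel" and N: "prob_space N" "sets N = sets borel"
    and le: "\<And>S. open S \<Longrightarrow> emeasure R UNIV * emeasure N S \<le> emeasure R S"
  shows "R = density N (\<lambda>_. emeasure R UNIV)"
proof -
  interpret R: finite_measure R by fact
  interpret N: prob_space N by fact
  note [measurable_cong, simp] = R(2) N(2)
  have [simp]: "space R = UNIV" "space N = UNIV"
    using sets_eq_imp_space_eq[OF R(2)] sets_eq_imp_space_eq[OF N(2)] by simp_all
  let ?r = "measure R UNIV"
  have le': "?r * measure N S \<le> measure R S" if "open S" for S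
    using le[OF that] by (simp add: R.emeasure_eq_measure N.emeasure_eq_measure flip: ennreal_mult')
  \<comment> \<open>The distance to the empty set is 0 by convention, so the neighbourhoods below
    shrink to \<open>F\<close> only if \<open>F\<close> is nonempty.\<close>
  have cl: "?r * measure N F \<le> measure R F" if F: "closed F" "F \<noteq> {}" for F
  proof -
    define G where "G n = {x. infdist x F < 1 / real (Suc n)}" for n
    have oG: "open (G n)" for n unfolding G_def
      by (intro open_Collect_less continuous_intros)
    have "G n \<subseteq> G m" if "m \<le> n" for m n
    proof -
      have "1 / real (Suc n) \<le> 1 / real (Suc m)" using that by (intro frac_le) auto
      then show ?thesis unfolding G_def by (auto intro: order.strict_trans2)
    qed
    then have "decseq G" by (simp add: decseq_def)
    have IG: "(\<Inter>n. G n) = F"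
    proof
      show "F \<subseteq> (\<Inter>n. G n)" by (auto simp: G_def)
      show "(\<Inter>n. G n) \<subseteq> F"
      proof
        fix x assume x: "x \<in> (\<Inter>n. G n)"
        have "infdist x F \<le> 0"
        proof (rule field_le_epsilon)
          fix \<epsilon> :: real assume "\<epsilon> > 0"
          then obtain n where "1 / real (Suc n) < \<epsilon>"
            using reals_Archimedean by (auto simp: inverse_eq_divide)
          with x show "infdist x F \<le> 0 + \<epsilon>" by (auto simp: G_def dest!: spec[of _ n])
        qed
        then have "infdist x F = 0" using infdist_nonneg[of x F] by linarith
        then show "x \<in> F" using F in_closed_iff_infdist_zero by blast
      qed
    qed
    have rG: "range G \<subseteq> sets borel" using oG by auto
    have A: "(\<lambda>n. measure R (G n)) \<longlonglongrightarrow> measure R F"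
      using R.finite_Lim_measure_decseq[of G] rG \<open>decseq G\<close> IG by simp
    have B: "(\<lambda>n. ?r * measure N (G n)) \<longlonglongrightarrow> ?r * measure N F"
      using N.finite_Lim_measure_decseq[of G] rG \<open>decseq G\<close> IG by (intro tendsto_intros) simp
    show ?thesis by (rule LIMSEQ_le[OF B A]) (use le'[OF oG] in auto)
  qed
  have eq: "measure R S = ?r * measure N S" if S: "open S" for S
  proof (cases "S = UNIV")
    case True
    then show ?thesis using N.prob_space by simp
  next
    case False
    have [measurable]: "S \<in> sets borel" using S by simp
    have "?r * measure N (- S) \<le> measure R (- S)"
      using cl[of "- S"] S False by auto
    moreover have "measure N (- S) = 1 - measure N S"
      using N.prob_compl[of S] by (simp add: Compl_eq_Diff_UNIV)
    moreover have "measure R (- S) = ?r - measure R S"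
      using R.finite_measure_compl[of S] by (simp add: Compl_eq_Diff_UNIV)
    ultimately have "measure R S \<le> ?r * measure N S" by (simp add: algebra_simps)
    with le'[OF S] show ?thesis by simp
  qed
  show ?thesis
  proof (rule measure_eqI_generator_eq[where E = "{S. open S}" and \<Omega> = UNIV and A = "\<lambda>_. UNIV"])
    fix S :: "'a set" assume "S \<in> {S. open S}"
    then have S: "open S" and [measurable]: "S \<in> sets borel" by auto
    show "emeasure R S = emeasure (density N (\<lambda>_. emeasure R UNIV)) S"
      using eq[OF S] by (simp add: emeasure_density nn_integral_cmult_indicator R.emeasure_eq_measure
          N.emeasure_eq_measure flip: ennreal_mult')
  qed (auto simp: Int_stable_def borel_def R.emeasure_finite)
qed

text \<open>On the open set where U < n, exp U times \<open>Q\<close> has mass at most exp(n), while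
  \<open>N\<close> charges one of these sets; the inequality for open sets then bounds the total
  mass. Multiplying the resulting equality of measures by exp(-U) recovers \<open>Q\<close>.\<close>

lemma gibbs_unique:
  fixes N P Q :: "'a::{real_inner, second_countable_topology} measure"
  assumes e: "complete_onseq e" and N: "prob_space N" and sN[measurable_cong, simp]: "sets N = sets borel"
    and Q: "prob_space Q" and sQ[measurable_cong, simp]: "sets Q = sets borel"
    and invN: "resample_invariant N e N"
    and invR: "resample_invariant N e (density Q (\<lambda>x. ennreal (exp (U x))))"
    and U: "continuous_on UNIV U"
    and P: "prob_space P" "Z > 0" "P = density N (\<lambda>x. ennreal (exp (- U x) / Z))"
  shows "Q = P"
proof -
  interpret N: prob_space N by fact
  interpret Q: prob_space Q by fact
  have [measurable]: "U \<in> borel_measurable borel" using U by (rule borel_measurable_continuous_onI)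
  have [simp]: "space Q = UNIV" "space N = UNIV"
    using sets_eq_imp_space_eq[OF sQ] sets_eq_imp_space_eq[OF sN] by simp_all
  let ?R = "density Q (\<lambda>x. ennreal (exp (U x)))"
  have sR: "sets ?R = sets borel" by simp
  note open_le = resample_invariant_open[OF e N sN sR invN invR]
  define S where "S n = {x. U x < real n}" for n
  have oS: "open (S n)" for n unfolding S_def by (intro open_Collect_less U continuous_on_const)
  then have [measurable]: "S n \<in> sets borel" for n by simp
  have US: "(\<Union>n. S n) = UNIV" using reals_Archimedean2 by (auto simp: S_def)
  have "\<exists>n. emeasure N (S n) \<noteq> 0"
  proof (rule ccontr)
    assume "\<not> ?thesis"
    then have "emeasure N (\<Union>n. S n) = 0" by (intro emeasure_UN_eq_0) auto
    then show False using N.emeasure_space_1 US by simp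
  qed
  then obtain n where n: "emeasure N (S n) \<noteq> 0" by blast
  have "emeasure ?R (S n) = (\<integral>\<^sup>+x. ennreal (exp (U x)) * indicator (S n) x \<partial>Q)"
    by (rule emeasure_density) measurable
  also have "\<dots> \<le> (\<integral>\<^sup>+x. ennreal (exp (real n)) \<partial>Q)"
    by (rule nn_integral_mono) (auto simp: S_def indicator_def intro!: ennreal_leI)
  also have "\<dots> < \<infinity>" using Q.emeasure_space_1 by simp
  finally have "emeasure ?R (S n) < \<infinity>" .
  then have "emeasure ?R UNIV * emeasure N (S n) < \<infinity>" using open_le[OF oS] by (rule le_less_trans[rotated])
  then have fin: "emeasure ?R UNIV \<noteq> \<infinity>" using n by (auto simp: ennreal_mult_less_top)
  let ?r = "emeasure ?R UNIV"
  have "?R = density N (\<lambda>_. ?r)"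
    by (rule measure_eq_of_open_le[OF finite_measureI sR N sN open_le]) (use fin in simp_all)
  then have "density ?R (\<lambda>x. ennreal (exp (- U x))) = density (density N (\<lambda>_. ?r)) (\<lambda>x. ennreal (exp (- U x)))"
    by simp
  moreover have "density ?R (\<lambda>x. ennreal (exp (- U x))) = Q"
    by (simp add: density_density_eq exp_minus_inverse density_1 flip: ennreal_mult')
  moreover have "density (density N (\<lambda>_. ?r)) (\<lambda>x. ennreal (exp (- U x)))
      = density N (\<lambda>x. ?r * ennreal (exp (- U x)))" by (simp add: density_density_eq)
  ultimately have Qd: "Q = density N (\<lambda>x. ?r * ennreal (exp (- U x)))" by simp
  let ?K = "\<integral>\<^sup>+x. ennreal (exp (- U x)) \<partial>N"
  have 1: "?r * ?K = 1"
  proof -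
    have "1 = emeasure (density N (\<lambda>x. ?r * ennreal (exp (- U x)))) UNIV"
      using Q.emeasure_space_1 Qd by simp
    then show ?thesis by (simp add: emeasure_density nn_integral_cmult)
  qed
  have 2: "ennreal (1 / Z) * ?K = 1"
  proof -
    have "1 = emeasure (density N (\<lambda>x. ennreal (1 / Z) * ennreal (exp (- U x)))) UNIV"
      using prob_space.emeasure_space_1[OF P(1)] P(2,3) by (simp flip: ennreal_mult')
    then show ?thesis by (simp add: emeasure_density nn_integral_cmult)
  qed
  \<comment> \<open>Both constants normalize the same integral of exp(-U).\<close>
  have "?r = ?r * (ennreal (1 / Z) * ?K)" by (simp add: 2)
  also have "\<dots> = (?r * ?K) * ennreal (1 / Z)" by (simp add: mult_ac)
  also have "\<dots> = ennreal (1 / Z)" by (simp only: 1 mult_1)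
  finally have "?r = ennreal (1 / Z)" .
  then show ?thesis using Qd P(2,3) by (simp flip: ennreal_mult')
qed

lemma gaussian_resample_invariant:
  fixes C :: "'a::{real_inner, banach, second_countable_topology} \<Rightarrow>\<^sub>L 'a"
  assumes N: "centred_gaussian C N" and C: "nonneg_symmetric C" and e: "onseq e"
    and Ce: "\<And>i. C (e i) = l i *\<^sub>R e i"
  shows "resample_invariant N e N"
  unfolding resample_invariant_def
proof (intro allI ballI)
  fix i and f :: "'a \<Rightarrow> ennreal" assume "f \<in> borel_measurable borel"
  moreover have "norm (e i) = 1 \<or> e i = 0" using e by (auto simp: onseq_def)
  ultimately show "(\<integral>\<^sup>+x. (\<integral>\<^sup>+z. f (resample (e i) x z) \<partial>N) \<partial>N) = (\<integral>\<^sup>+x. f x \<partial>N)"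
    by (intro gaussian_resample_nn_integral[OF N C _ Ce])
qed

section \<open>From the Stein equation to invariance\<close>

lemma GDERIV_gradient:
  fixes U :: "'a::{real_inner, banach, second_countable_topology} \<Rightarrow> real"
  assumes "U differentiable (at x)"
  shows "(U has_derivative (\<lambda>h. inner h (gradient U x))) (at x)"
proof -
  obtain D where D: "(U has_derivative D) (at x)" using assms by (auto simp: differentiable_def)
  then obtain g where g: "\<And>h. D h = inner h g"
    using riesz_representation[OF has_derivative_bounded_linear] by blast
  have "D = (\<lambda>h. inner h g)" using g by auto
  with D have G: "GDERIV U x :> g" by (simp add: gderiv_def)
  have "GDERIV U x :> gradient U x" unfolding gradient_def
  proof (rule theI[where P = "\<lambda>g. GDERIV U x :> g", OF G])
    fix g' assume "GDERIV U x :> g'"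
    then have "(\<lambda>h. inner h g') = (\<lambda>h. inner h g)"
      using G unfolding gderiv_def by (rule has_derivative_unique)
    then have "inner (g' - g) g' = inner (g' - g) g" by (rule fun_cong)
    then have "inner (g' - g) (g' - g) = 0" by (simp add: inner_diff_right)
    then show "g' = g" by simp
  qed
  then show ?thesis by (simp add: gderiv_def)
qed

lemma has_derivative_along_line:
  fixes f :: "'a::real_normed_vector \<Rightarrow> real"
  assumes "(f has_derivative D) (at (x + t *\<^sub>R e))"
  shows "((\<lambda>s. f (x + s *\<^sub>R e)) has_real_derivative D e) (at t)"
proof -
  have "((\<lambda>s. x + s *\<^sub>R e) has_derivative (\<lambda>s. s *\<^sub>R e)) (at t)"
    by (auto intro!: derivative_eq_intros)
  from has_derivative_compose[OF this] assms
  have "((\<lambda>s. f (x + s *\<^sub>R e)) has_derivative (\<lambda>s. D (s *\<^sub>R e))) (at t)" by blast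
  then show ?thesis unfolding has_field_derivative_def
    using linear_scale[OF bounded_linear.linear[OF has_derivative_bounded_linear[OF assms]]]
    by (simp add: mult.commute[of _ "D e"])
qed

text \<open>The derivative may be discontinuous; as a pointwise limit of difference quotients of a
  continuous function it is still Borel.\<close>

lemma directional_derivative_measurable:
  fixes f :: "'a::{real_normed_vector, second_countable_topology} \<Rightarrow> real"
  assumes f: "\<And>x. (f has_derivative D x) (at x)"
  shows "(\<lambda>x. D x e) \<in> borel_measurable borel"
proof -
  have "continuous_on UNIV f"
    using f by (intro continuous_at_imp_continuous_on ballI has_derivative_continuous) 
  then have [measurable]: "f \<in> borel_measurable borel" by (rule borel_measurable_continuous_onI)
  have "(\<lambda>n. (f (x + inverse (real (Suc n)) *\<^sub>R e) - f x) / inverse (real (Suc n))) \<longlonglongrightarrow> D x e" for x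
  proof -
    have "((\<lambda>s. f (x + s *\<^sub>R e)) has_real_derivative D x e) (at 0)"
      by (rule has_derivative_along_line) (use f in simp)
    then have "((\<lambda>s. (f (x + s *\<^sub>R e) - f x) / s) \<longlongrightarrow> D x e) (at 0)"
      by (simp add: DERIV_def)
    moreover have "filterlim (\<lambda>n. inverse (real (Suc n))) (at 0) sequentially"
      using LIMSEQ_inverse_real_of_nat by (auto simp: filterlim_at)
    ultimately show ?thesis by (rule filterlim_compose)
  qed
  then show ?thesis by (rule borel_measurable_LIMSEQ_real) measurable
qed

section \<open>Continuation from real to imaginary arguments\<close>

lemma powser_zero_coefficients:
  fixes c :: "nat \<Rightarrow> real"
  assumes "\<And>\<tau>. (\<lambda>n. c n * \<tau> ^ n) sums 0"
  shows "c n = 0"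
proof (induction n rule: less_induct)
  case (less n)
  \<comment> \<open>The coefficients below \<open>n\<close> vanish by induction; after division by
    tau^n the series tends to c n as tau tends to 0.\<close>
  have "(\<lambda>m. c (m + n) * \<tau> ^ m) sums 0" if "\<tau> \<noteq> 0" for \<tau>
  proof -
    have "(\<lambda>m. c (m + n) * \<tau> ^ (m + n)) sums (0 - (\<Sum>i<n. c i * \<tau> ^ i))"
      by (rule sums_split_initial_segment[OF assms])
    then have "(\<lambda>m. inverse (\<tau> ^ n) * (c (m + n) * \<tau> ^ (m + n))) sums (inverse (\<tau> ^ n) * 0)"
      using less by (intro sums_mult) simp
    then show ?thesis using that by (simp add: power_add field_simps)
  qed
  then have "((\<lambda>_. 0) \<longlongrightarrow> c (0 + n)) (at (0::real))"
    using powser_limit_0_strong[of 1 "\<lambda>m. c (m + n)" "\<lambda>_. 0"] by simp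
  then show ?case using tendsto_unique[OF _ _ tendsto_const, of "at (0::real)" 0 "c n"] by simp
qed

text \<open>The integral is a power series in tau that converges everywhere, since the exponential
  moments allow termwise integration. It vanishes for real tau, so all coefficients vanish, and with
  them its value at the imaginary unit.\<close>

lemma laplace_to_fourier:
  fixes a u0 u1 :: "'b \<Rightarrow> real"
  assumes [measurable]: "a \<in> borel_measurable M" "u0 \<in> borel_measurable M" "u1 \<in> borel_measurable M"
    and i0: "\<And>\<tau>. integrable M (\<lambda>x. u0 x * exp (\<tau> * \<bar>a x\<bar>))"
    and i1: "\<And>\<tau>. integrable M (\<lambda>x. u1 x * exp (\<tau> * \<bar>a x\<bar>))"
    and eq: "\<And>\<tau>. (\<integral>x. (u0 x + \<tau> * u1 x) * exp (\<tau> * a x) \<partial>M) = 0"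
  shows "(\<integral>x. u0 x * cos (a x) \<partial>M) = (\<integral>x. u1 x * sin (a x) \<partial>M)"
    "(\<integral>x. u0 x * sin (a x) \<partial>M) = - (\<integral>x. u1 x * cos (a x) \<partial>M)"
proof -
  \<comment> \<open>The coefficient of tau^n in (u0 + tau u1) exp(tau a).\<close>
  define X where "X n x = u0 x * (a x ^ n / fact n) + (if n = 0 then 0 else u1 x * (a x ^ (n - 1) / fact (n - 1)))" for n x
  have [measurable]: "X n \<in> borel_measurable M" for n unfolding X_def by measurable
  \<comment> \<open>Majorant for all partial sums of the absolute values of the terms at
    \<open>z\<close>.\<close>
  define B where "B z x = (\<bar>u0 x\<bar> + norm z * \<bar>u1 x\<bar>) * exp (norm z * \<bar>a x\<bar>)" for z :: complex and x
  have iB: "integrable M (B z)" for z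
  proof -
    have "integrable M (\<lambda>x. \<bar>u0 x * exp (norm z * \<bar>a x\<bar>)\<bar> + norm z * \<bar>u1 x * exp (norm z * \<bar>a x\<bar>)\<bar>)"
      using i0 i1 by auto
    moreover have "B z = (\<lambda>x. \<bar>u0 x * exp (norm z * \<bar>a x\<bar>)\<bar> + norm z * \<bar>u1 x * exp (norm z * \<bar>a x\<bar>)\<bar>)"
      by (auto simp: B_def abs_mult algebra_simps)
    ultimately show ?thesis by simp
  qed
  have es: "(\<Sum>n<m. t ^ n / fact n) \<le> exp t" if "t \<ge> 0" for t :: real and m
    using sum_le_suminf[OF summable_exp_generic[of t], of "{..<m}"] that
    by (simp add: exp_def field_simps)
  have part: "(\<Sum>n<m. norm (z ^ n * of_real (X n x))) \<le> B z x" for m x and z :: complex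
  proof -
    let ?t = "norm z * \<bar>a x\<bar>"
    have "norm (z ^ n * of_real (X n x)) \<le> \<bar>u0 x\<bar> * (?t ^ n / fact n) + (if n = 0 then 0 else norm z * \<bar>u1 x\<bar> * (?t ^ (n - 1) / fact (n - 1)))" for n
    proof -
      have "norm (z ^ n * of_real (X n x)) = norm z ^ n * \<bar>X n x\<bar>" by (simp add: norm_mult norm_power)
      also have "\<dots> \<le> norm z ^ n * (\<bar>u0 x\<bar> * (\<bar>a x\<bar> ^ n / fact n) + (if n = 0 then 0 else \<bar>u1 x\<bar> * (\<bar>a x\<bar> ^ (n - 1) / fact (n - 1))))"
        unfolding X_def by (intro mult_left_mono order_trans[OF abs_triangle_ineq] add_mono)
          (auto simp: abs_mult power_abs)
      also have "\<dots> = \<bar>u0 x\<bar> * (?t ^ n / fact n) + (if n = 0 then 0 else norm z * \<bar>u1 x\<bar> * (?t ^ (n - 1) / fact (n - 1)))"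
        by (cases n) (auto simp: power_mult_distrib algebra_simps)
      finally show ?thesis .
    qed
    then have "(\<Sum>n<m. norm (z ^ n * of_real (X n x))) \<le>
      \<bar>u0 x\<bar> * (\<Sum>n<m. ?t ^ n / fact n) + (\<Sum>n<m. if n = 0 then 0 else norm z * \<bar>u1 x\<bar> * (?t ^ (n - 1) / fact (n - 1)))"
      by (subst sum_distrib_left, subst sum.distrib[symmetric]) (rule sum_mono)
    also have "(\<Sum>n<m. if n = 0 then 0 else norm z * \<bar>u1 x\<bar> * (?t ^ (n - 1) / fact (n - 1)))
       = norm z * \<bar>u1 x\<bar> * (\<Sum>n<m - 1. ?t ^ n / fact n)"
      by (cases m) (simp_all add: sum.lessThan_Suc_shift sum_distrib_left del: sum.lessThan_Suc)
    also have "\<bar>u0 x\<bar> * (\<Sum>n<m. ?t ^ n / fact n) + norm z * \<bar>u1 x\<bar> * (\<Sum>n<m - 1. ?t ^ n / fact n)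
        \<le> \<bar>u0 x\<bar> * exp ?t + norm z * \<bar>u1 x\<bar> * exp ?t"
      by (intro add_mono mult_left_mono es) auto
    also have "\<dots> = B z x" by (simp add: B_def algebra_simps)
    finally show ?thesis .
  qed
  have sm: "summable (\<lambda>n. norm (z ^ n * of_real (X n x)))" for x and z :: complex
    by (rule bounded_imp_summable[where B = "B z x"]) (simp_all only: lessThan_Suc_atMost[symmetric] part norm_ge_zero)
  have iX: "integrable M (\<lambda>x. z ^ n * of_real (X n x))" for n and z :: complex
  proof (rule Bochner_Integration.integrable_bound[OF iB[of z]])
    have "norm (z ^ n * of_real (X n x)) \<le> B z x" for x
      using part[where m = "Suc n" and z = z and x = x]
        sum_nonneg[of "{..<n}" "\<lambda>n. norm (z ^ n * of_real (X n x))"] by simp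
    moreover have "B z x \<ge> 0" for x by (simp add: B_def)
    ultimately show "AE x in M. norm (z ^ n * of_real (X n x)) \<le> norm (B z x)" by auto
  qed measurable
  have sX: "(\<lambda>n. z ^ n * of_real (X n x)) sums ((of_real (u0 x) + z * of_real (u1 x)) * exp (z * of_real (a x)))" for x and z :: complex
  proof -
    have E: "(\<lambda>n. (z * of_real (a x)) ^ n / fact n) sums exp (z * of_real (a x))"
      using exp_converges[of "z * of_real (a x)"] by (simp add: scaleR_conv_of_real field_simps)
    have 1: "(\<lambda>n. of_real (u0 x) * ((z * of_real (a x)) ^ n / fact n)) sums (of_real (u0 x) * exp (z * of_real (a x)))"
      by (rule sums_mult[OF E])
    let ?f = "\<lambda>n. if n = 0 then 0 else z * of_real (u1 x) * ((z * of_real (a x)) ^ (n - 1) / fact (n - 1))"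
    have "(\<lambda>n. ?f (Suc n)) sums (z * of_real (u1 x) * exp (z * of_real (a x)))"
      using sums_mult[OF E, of "z * of_real (u1 x)"] by simp
    then have "?f sums (z * of_real (u1 x) * exp (z * of_real (a x)) + ?f 0)" by (rule sums_Suc)
    from sums_add[OF 1 this]
    have "(\<lambda>n. of_real (u0 x) * ((z * of_real (a x)) ^ n / fact n) + (if n = 0 then 0 else z * of_real (u1 x) * ((z * of_real (a x)) ^ (n - 1) / fact (n - 1))))
       sums ((of_real (u0 x) + z * of_real (u1 x)) * exp (z * of_real (a x)))" by (simp add: algebra_simps)
    moreover have "of_real (u0 x) * ((z * of_real (a x)) ^ n / fact n) + (if n = 0 then 0 else z * of_real (u1 x) * ((z * of_real (a x)) ^ (n - 1) / fact (n - 1)))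
       = z ^ n * of_real (X n x)" for n
      by (cases n) (simp_all add: X_def power_mult_distrib algebra_simps)
    ultimately show ?thesis by simp
  qed
  define c where "c n = (\<integral>x. X n x \<partial>M)" for n
  have main: "(\<lambda>n. z ^ n * of_real (c n)) sums (\<integral>x. (of_real (u0 x) + z * of_real (u1 x)) * exp (z * of_real (a x)) \<partial>M)" for z :: complex
  proof -
    have "(\<lambda>n. \<integral>x. z ^ n * of_real (X n x) \<partial>M) sums (\<integral>x. (\<Sum>n. z ^ n * of_real (X n x)) \<partial>M)"
    proof (rule sums_integral[OF iX])
      show "AE x in M. summable (\<lambda>n. norm (z ^ n * of_real (X n x)))" using sm by simp
      show "summable (\<lambda>n. \<integral>x. norm (z ^ n * of_real (X n x)) \<partial>M)"
      proof (rule bounded_imp_summable[where B = "\<integral>x. B z x \<partial>M"])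
        fix m
        have "(\<Sum>n<Suc m. \<integral>x. norm (z ^ n * of_real (X n x)) \<partial>M) = (\<integral>x. (\<Sum>n<Suc m. norm (z ^ n * of_real (X n x))) \<partial>M)"
          by (rule Bochner_Integration.integral_sum[symmetric]) (intro integrable_norm iX)
        also have "\<dots> \<le> (\<integral>x. B z x \<partial>M)"
          by (intro integral_mono Bochner_Integration.integrable_sum integrable_norm iX iB part)
        finally show "(\<Sum>n\<le>m. \<integral>x. norm (z ^ n * of_real (X n x)) \<partial>M) \<le> (\<integral>x. B z x \<partial>M)"
          by (simp only: lessThan_Suc_atMost)
      qed simp
    qed
    moreover have "(\<integral>x. z ^ n * of_real (X n x) \<partial>M) = z ^ n * of_real (c n)" for n
      by (simp add: c_def)
    moreover have "(\<Sum>n. z ^ n * of_real (X n x)) = (of_real (u0 x) + z * of_real (u1 x)) * exp (z * of_real (a x))" for x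
      using sX[of z x] by (rule sums_unique[symmetric])
    ultimately show ?thesis by (simp only:)
  qed
  have "(\<lambda>n. c n * \<tau> ^ n) sums 0" for \<tau>
  proof -
    have "(\<integral>x. (of_real (u0 x) + of_real \<tau> * of_real (u1 x)) * exp (of_real \<tau> * of_real (a x)) \<partial>M)
      = (\<integral>x. complex_of_real ((u0 x + \<tau> * u1 x) * exp (\<tau> * a x)) \<partial>M)"
      by (rule Bochner_Integration.integral_cong) (rule refl, metis exp_of_real of_real_add of_real_mult)
    also have "\<dots> = 0" by (simp only: integral_complex_of_real eq of_real_0)
    finally have "(\<lambda>n. of_real (c n * \<tau> ^ n)) sums (of_real 0 :: complex)"
      using main[of "of_real \<tau>"] by (simp add: mult.commute)
    then show ?thesis by (simp only: sums_of_real_iff)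
  qed
  then have c0: "c n = 0" for n by (rule powser_zero_coefficients)
  \<comment> \<open>The real and imaginary parts of the integral of this function are the two
    claims.\<close>
  let ?I = "\<lambda>x. (of_real (u0 x) + \<i> * of_real (u1 x)) * exp (\<i> * of_real (a x))"
  have "(\<integral>x. ?I x \<partial>M) = 0"
    using main[of \<i>] by (simp add: c0 sums_unique2[OF _ sums_zero])
  moreover have I: "integrable M ?I"
  proof (rule Bochner_Integration.integrable_bound[OF iB[of 1]])
    have "norm (?I x) \<le> (\<bar>u0 x\<bar> + \<bar>u1 x\<bar>) * 1" for x
      unfolding norm_mult by (intro mult_mono order_trans[OF norm_triangle_ineq]) (auto simp: norm_mult)
    moreover have "(\<bar>u0 x\<bar> + \<bar>u1 x\<bar>) * 1 \<le> B 1 x" for x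
      unfolding B_def by (intro mult_mono) auto
    ultimately have "norm (?I x) \<le> B 1 x" for x by (rule order_trans)
    moreover have "B 1 x \<ge> 0" for x by (simp add: B_def)
    ultimately show "AE x in M. norm (?I x) \<le> norm (B 1 x)" by auto
  qed measurable
  ultimately have "(\<integral>x. Re (?I x) \<partial>M) = 0" "(\<integral>x. Im (?I x) \<partial>M) = 0"
    using integral_Re[OF I] integral_Im[OF I] by simp_all
  moreover have "Re (?I x) = u0 x * cos (a x) - u1 x * sin (a x)" "Im (?I x) = u0 x * sin (a x) + u1 x * cos (a x)" for x
    by (simp_all add: Re_exp Im_exp)
  moreover have "integrable M (\<lambda>x. u0 x * cos (a x))" "integrable M (\<lambda>x. u0 x * sin (a x))"
    using i0[of 0] by (auto intro: Bochner_Integration.integrable_bound simp: abs_mult mult_left_le)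
  moreover have "integrable M (\<lambda>x. u1 x * cos (a x))" "integrable M (\<lambda>x. u1 x * sin (a x))"
    using i1[of 0] by (auto intro: Bochner_Integration.integrable_bound simp: abs_mult mult_left_le)
  ultimately show "(\<integral>x. u0 x * cos (a x) \<partial>M) = (\<integral>x. u1 x * sin (a x) \<partial>M)"
    "(\<integral>x. u0 x * sin (a x) \<partial>M) = - (\<integral>x. u1 x * cos (a x) \<partial>M)" by simp_all
qed

section \<open>The adjoint of a bounded operator\<close>

lemma adjoint_blinfun:
  fixes T :: "'a::{real_inner, banach, second_countable_topology} \<Rightarrow>\<^sub>L 'a"
  shows "inner (T x) y = inner x (adjoint T y)"
proof -
  have "\<exists>g. \<forall>x. inner (T x) y = inner x g" for y
  proof -
    have "bounded_linear (\<lambda>x. inner (T x) y)"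
      by (intro bounded_linear_compose[OF bounded_linear_inner_left] blinfun.bounded_linear_right)
    then show ?thesis using riesz_representation by metis
  qed
  then obtain g where "\<forall>x y. inner (T x) y = inner x (g y)" by metis
  \<comment> \<open>\<open>adjoint\<close> is a choice operator; Riesz representation shows that
    there is something to choose.\<close>
  then have "\<forall>x y. inner (T x) y = inner x (adjoint T y)" unfolding adjoint_def
    by (rule someI[where P = "\<lambda>f'. \<forall>x y. inner (T x) y = inner x (f' y)"])
  then show ?thesis by blast
qed

lemma inner_left_eqI: "(\<And>x. inner x y = inner x z) \<Longrightarrow> y = (z::'a::real_inner)"
  using inner_eq_zero_iff[of "y - z"] by (simp add: inner_diff_right)

lemma subspace_closure:
  fixes S :: "'a::real_normed_vector set"
  assumes "subspace S" shows "subspace (closure S)"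
  unfolding subspace_def
proof (intro conjI ballI allI)
  show "0 \<in> closure S" using assms closure_subset subspace_0 by blast
  fix x y c assume "x \<in> closure S"
  then obtain u where u: "\<And>n. u n \<in> S" "u \<longlonglongrightarrow> x" unfolding closure_sequential by blast
  have "(\<lambda>n. c *\<^sub>R u n) \<longlonglongrightarrow> c *\<^sub>R x" by (intro tendsto_intros u)
  then show "c *\<^sub>R x \<in> closure S" using assms u(1) subspace_scale
    unfolding closure_sequential by (intro exI[of _ "\<lambda>n. c *\<^sub>R u n"]) blast
  assume "y \<in> closure S"
  then obtain v where v: "\<And>n. v n \<in> S" "v \<longlonglongrightarrow> y" unfolding closure_sequential by blast
  have "(\<lambda>n. u n + v n) \<longlonglongrightarrow> x + y" by (intro tendsto_intros u v)
  then show "x + y \<in> closure S" using assms u(1) v(1) subspace_add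
    unfolding closure_sequential by (intro exI[of _ "\<lambda>n. u n + v n"]) blast
qed

text \<open>A vector z orthogonal to this range satisfies |T z|^2 = 0, and surjectivity of the
  adjoint makes \<open>T\<close> injective.\<close>

lemma dense_range_adjoint:
  fixes T :: "'a::{real_inner, banach, second_countable_topology} \<Rightarrow>\<^sub>L 'a"
  assumes "surj (adjoint T)"
  shows "closure (range (\<lambda>y. adjoint T (T y))) = UNIV"
proof (rule ccontr)
  let ?D = "range (\<lambda>y. adjoint T (T y))"
  assume "closure ?D \<noteq> UNIV"
  then obtain x where x: "x \<notin> closure ?D" by blast
  have add: "adjoint T (T (y + z)) = adjoint T (T y) + adjoint T (T z)" for y z
    by (rule inner_left_eqI) (simp add: inner_add_right blinfun.add_right flip: adjoint_blinfun)
  have scale: "adjoint T (T (c *\<^sub>R y)) = c *\<^sub>R adjoint T (T y)" for c y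
    by (rule inner_left_eqI) (simp add: blinfun.scaleR_right flip: adjoint_blinfun)
  have "subspace ?D" unfolding subspace_def
  proof (intro conjI ballI allI)
    show "0 \<in> ?D" using scale[of 0 0] by (metis rangeI scaleR_zero_left)
    fix u v c assume "u \<in> ?D"
    then show "c *\<^sub>R u \<in> ?D" by (auto simp: scale[symmetric])
    assume "v \<in> ?D"
    with \<open>u \<in> ?D\<close> show "u + v \<in> ?D" by (auto simp: add[symmetric])
  qed
  then have "subspace (closure ?D)" by (rule subspace_closure)
  from closed_subspace_orthogonal[OF this closed_closure x]
  obtain z where z: "z \<noteq> 0" "\<And>y. y \<in> closure ?D \<Longrightarrow> inner z y = 0" by blast
  have "inner (T z) (T z) = inner z (adjoint T (T z))" by (rule adjoint_blinfun)
  also have "\<dots> = 0" by (rule z(2)[OF subsetD[OF closure_subset rangeI]])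
  finally have Tz: "T z = 0" by simp
  obtain y where "adjoint T y = z" using assms by (metis surjD)
  then have "inner z z = inner (T z) y" by (simp add: adjoint_blinfun)
  with Tz z(1) show False by simp
qed

section \<open>Trigonometric form of the Stein equation\<close>

lemma integrable_norm_of_square:
  fixes Q :: "'a::{real_inner, second_countable_topology} measure"
  assumes "prob_space Q" and [measurable_cong]: "sets Q = sets borel" and "integrable Q (\<lambda>x. (norm x)\<^sup>2)"
  shows "integrable Q norm"
proof -
  interpret prob_space Q by fact
  show ?thesis
  proof (rule Bochner_Integration.integrable_bound)
    show "integrable Q (\<lambda>x. 1 + (norm x)\<^sup>2)" using assms(3) by simp
    have "t \<le> 1 + t\<^sup>2" for t :: real using zero_le_power2[of "t - 1"] zero_le_power2[of "t + 1"]
      by (simp add: power2_eq_square algebra_simps)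
    then show "AE x in Q. norm (norm x) \<le> norm (1 + (norm x)\<^sup>2)" by (intro AE_I2) (simp add: abs_of_nonneg)
  qed measurable
qed

text \<open>With centre tau y the Gaussian is a constant times w(x) exp(tau <x, h>), where h is 2 s
  times the adjoint of T applied to T y. So the Stein equation is an identity of Laplace transforms
  in tau, to which \<open>laplace_to_fourier\<close> applies. Such h are dense, and both sides are
  continuous in h.\<close>

lemma stein_trig:
  fixes T :: "'a::{real_inner, banach, second_countable_topology} \<Rightarrow>\<^sub>L 'a"
  assumes Q: "prob_space Q" and sQ[measurable_cong, simp]: "sets Q = sets borel"
    and nQ: "integrable Q norm" and b: "integrable Q b" and T: "surj (adjoint T)" and s: "s > 0"
    and eq: "\<And>y. (\<integral>x. (- 2 * s * l * inner (T x - T y) (T e) - b x) * exp (- s * (norm (T x - T y))\<^sup>2) \<partial>Q) = 0"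
  defines "w \<equiv> \<lambda>x. exp (- s * (norm (T x))\<^sup>2)" and "B \<equiv> \<lambda>x. b x + 2 * s * l * inner (T x) (T e)"
  shows "(\<integral>x. w x * B x * cos (inner x h) \<partial>Q) = - (l * inner e h) * (\<integral>x. w x * sin (inner x h) \<partial>Q)"
    "(\<integral>x. w x * B x * sin (inner x h) \<partial>Q) = l * inner e h * (\<integral>x. w x * cos (inner x h) \<partial>Q)"
proof -
  interpret prob_space Q by fact
  have [measurable]: "blinfun_apply T \<in> borel_measurable borel"
    by (intro borel_measurable_continuous_onI continuous_intros)
  have [measurable]: "b \<in> borel_measurable borel" using b by (auto dest: borel_measurable_integrable)
  have [measurable]: "w \<in> borel_measurable borel" "B \<in> borel_measurable borel"
    unfolding w_def B_def by measurable
  have w1: "0 \<le> w x" "w x \<le> 1" for x using s by (auto simp: w_def)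
  have iB: "integrable Q B"
  proof -
    have "integrable Q (\<lambda>x. inner (T x) (T e))"
    proof (rule Bochner_Integration.integrable_bound)
      show "integrable Q (\<lambda>x. norm T * norm (T e) * norm x)" using nQ by simp
      have "\<bar>inner (T x) (T e)\<bar> \<le> norm T * norm x * norm (T e)" for x
        by (rule order_trans[OF Cauchy_Schwarz_ineq2]) (intro mult_right_mono norm_blinfun norm_ge_zero)
      then show "AE x in Q. norm (inner (T x) (T e)) \<le> norm (norm T * norm (T e) * norm x)"
        by (simp add: mult_ac)
    qed measurable
    then show ?thesis using b unfolding B_def by simp
  qed
  have iwB: "integrable Q (\<lambda>x. w x * B x)"
    by (rule Bochner_Integration.integrable_bound[OF iB]) (use w1 in \<open>auto simp: abs_mult intro!: AE_I2 mult_left_le_one_le\<close>)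
  have iw: "integrable Q w" by (rule integrable_const_bound[where B = 1]) (use w1 in auto)
  have dense: "(\<integral>x. w x * B x * cos (inner x h) \<partial>Q) = - (l * inner e h) * (\<integral>x. w x * sin (inner x h) \<partial>Q) \<and>
    (\<integral>x. w x * B x * sin (inner x h) \<partial>Q) = l * inner e h * (\<integral>x. w x * cos (inner x h) \<partial>Q)"
    if h: "h = (2 * s) *\<^sub>R adjoint T (T y)" for h y
  proof -
    define c where "c = l * inner e h"
    have a: "inner x h = 2 * s * inner (T x) (T y)" for x
      by (simp add: h adjoint_blinfun)
    \<comment> \<open>Completing the square in |T x|: since <x, h> depends on x only through T x,
      the decay of \<open>w\<close> absorbs every exponential of it.\<close>
    have growth: "w x * exp (\<tau> * \<bar>inner x h\<bar>) \<le> exp (s * (\<tau> * norm (T y))\<^sup>2)" for x \<tau>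
    proof -
      have "\<tau> * \<bar>inner x h\<bar> \<le> \<bar>\<tau>\<bar> * (2 * s * (norm (T x) * norm (T y)))"
        unfolding a abs_mult using s Cauchy_Schwarz_ineq2[of "T x" "T y"]
        by (intro mult_mono) auto
      moreover have "0 \<le> s * (norm (T x) - \<bar>\<tau>\<bar> * norm (T y))\<^sup>2" using s by simp
      ultimately have "- s * (norm (T x))\<^sup>2 + \<tau> * \<bar>inner x h\<bar> \<le> s * (\<tau> * norm (T y))\<^sup>2"
        by (simp add: power2_diff power_mult_distrib algebra_simps)
      then show ?thesis unfolding w_def exp_add[symmetric] by simp
    qed
    have gi: "integrable Q (\<lambda>x. f x * (w x * exp (\<tau> * \<bar>inner x h\<bar>)))" if f: "integrable Q f" for f \<tau>
    proof (rule Bochner_Integration.integrable_bound)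
      show "integrable Q (\<lambda>x. exp (s * (\<tau> * norm (T y))\<^sup>2) * f x)" using f by simp
      have "\<bar>w x * exp (\<tau> * \<bar>inner x h\<bar>)\<bar> \<le> exp (s * (\<tau> * norm (T y))\<^sup>2)" for x
        using growth[of x \<tau>] w1[of x] by (simp add: abs_mult)
      then have "\<bar>f x\<bar> * \<bar>w x * exp (\<tau> * \<bar>inner x h\<bar>)\<bar> \<le> \<bar>f x\<bar> * exp (s * (\<tau> * norm (T y))\<^sup>2)" for x
        by (intro mult_left_mono) auto
      then show "AE x in Q. norm (f x * (w x * exp (\<tau> * \<bar>inner x h\<bar>))) \<le> norm (exp (s * (\<tau> * norm (T y))\<^sup>2) * f x)"
        by (simp add: abs_mult mult.commute)
    qed (use f in measurable)
    have L: "(\<integral>x. (- (w x * B x) + \<tau> * (w x * c)) * exp (\<tau> * inner x h) \<partial>Q) = 0" for \<tau>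
    proof -
      \<comment> \<open>The prefactor depends on tau but not on x, so it can be divided out.\<close>
      have "(- 2 * s * l * inner (T x - T (\<tau> *\<^sub>R y)) (T e) - b x) * exp (- s * (norm (T x - T (\<tau> *\<^sub>R y)))\<^sup>2)
          = exp (- s * \<tau>\<^sup>2 * (norm (T y))\<^sup>2) * ((- (w x * B x) + \<tau> * (w x * c)) * exp (\<tau> * inner x h))" for x
      proof -
        have 1: "exp (- s * (norm (T x - T (\<tau> *\<^sub>R y)))\<^sup>2) = exp (- s * \<tau>\<^sup>2 * (norm (T y))\<^sup>2) * (w x * exp (\<tau> * inner x h))"
          unfolding w_def a power2_norm_eq_inner exp_add[symmetric]
          by (simp add: blinfun.scaleR_right inner_diff_left inner_diff_right inner_commute[of "T y" "T x"]
              power2_eq_square algebra_simps)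
        have 2: "- 2 * s * l * inner (T x - T (\<tau> *\<^sub>R y)) (T e) - b x = - B x + \<tau> * c"
          unfolding B_def c_def a by (simp add: blinfun.scaleR_right inner_diff_left inner_commute[of "T e" "T y"] algebra_simps)
        show ?thesis unfolding 1 2 by (simp add: algebra_simps)
      qed
      then have "exp (- s * \<tau>\<^sup>2 * (norm (T y))\<^sup>2) * (\<integral>x. (- (w x * B x) + \<tau> * (w x * c)) * exp (\<tau> * inner x h) \<partial>Q) = 0"
        using eq[of "\<tau> *\<^sub>R y"] by simp
      then show ?thesis by simp
    qed
    have "integrable Q (\<lambda>x. - (w x * B x) * exp (\<tau> * \<bar>inner x h\<bar>))" for \<tau>
      using gi[of "\<lambda>x. - B x" \<tau>] iB by (simp add: mult_ac)
    moreover have "integrable Q (\<lambda>x. w x * c * exp (\<tau> * \<bar>inner x h\<bar>))" for \<tau>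
      using gi[of "\<lambda>x. c" \<tau>] by (simp add: mult_ac)
    ultimately have "(\<integral>x. - (w x * B x) * cos (inner x h) \<partial>Q) = (\<integral>x. w x * c * sin (inner x h) \<partial>Q)"
        "(\<integral>x. - (w x * B x) * sin (inner x h) \<partial>Q) = - (\<integral>x. w x * c * cos (inner x h) \<partial>Q)"
      using laplace_to_fourier[of "\<lambda>x. inner x h" Q "\<lambda>x. - (w x * B x)" "\<lambda>x. w x * c", OF _ _ _ _ _ L] by auto
    moreover have "(\<integral>x. w x * c * f x \<partial>Q) = c * (\<integral>x. w x * f x \<partial>Q)" for f
      by (subst integral_mult_right_zero[symmetric]) (simp add: mult_ac)
    ultimately show ?thesis by (simp add: c_def)
  qed
  \<comment> \<open>The directions treated above carry the factor 2 s, hence the scaling.\<close>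
  have "h /\<^sub>R (2 * s) \<in> closure (range (\<lambda>y. adjoint T (T y)))"
    using dense_range_adjoint[OF T] by simp
  then obtain k where k: "\<And>n. k n \<in> range (\<lambda>y. adjoint T (T y))" "k \<longlonglongrightarrow> h /\<^sub>R (2 * s)"
    unfolding closure_sequential by blast
  obtain y where y: "\<And>n. k n = adjoint T (T (y n))" using k(1) unfolding image_iff by metis
  define g where "g n = (2 * s) *\<^sub>R k n" for n
  have "g \<longlonglongrightarrow> (2 * s) *\<^sub>R (h /\<^sub>R (2 * s))" unfolding g_def by (intro tendsto_intros k(2))
  then have g: "g \<longlonglongrightarrow> h" using s by simp
  have gn: "(\<integral>x. w x * B x * cos (inner x (g n)) \<partial>Q) = - (l * inner e (g n)) * (\<integral>x. w x * sin (inner x (g n)) \<partial>Q)"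
    "(\<integral>x. w x * B x * sin (inner x (g n)) \<partial>Q) = l * inner e (g n) * (\<integral>x. w x * cos (inner x (g n)) \<partial>Q)" for n
    using dense[of "g n" "y n"] by (simp_all add: g_def y)
  have lim: "(\<lambda>n. \<integral>x. f x * \<phi> (inner x (g n)) \<partial>Q) \<longlonglongrightarrow> (\<integral>x. f x * \<phi> (inner x h) \<partial>Q)"
    if f: "integrable Q f" and [measurable]: "\<phi> \<in> borel_measurable borel" and \<phi>: "\<And>t. \<bar>\<phi> t\<bar> \<le> 1" "\<And>t. isCont \<phi> t"
    for f and \<phi> :: "real \<Rightarrow> real"
  proof (rule integral_dominated_convergence[where w = "\<lambda>x. \<bar>f x\<bar>"])
    show "AE x in Q. (\<lambda>n. f x * \<phi> (inner x (g n))) \<longlonglongrightarrow> f x * \<phi> (inner x h)"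
      by (intro AE_I2 tendsto_intros isCont_tendsto_compose[OF \<phi>(2)] g)
    show "AE x in Q. norm (f x * \<phi> (inner x (g n))) \<le> \<bar>f x\<bar>" for n
      using \<phi>(1) by (intro AE_I2) (simp add: abs_mult mult_left_le)
  qed (use f in auto)
  note lc = lim[of _ cos] and ls = lim[of _ sin]
  have gl: "(\<lambda>n. l * inner e (g n)) \<longlonglongrightarrow> l * inner e h" by (intro tendsto_intros g)
  show "(\<integral>x. w x * B x * cos (inner x h) \<partial>Q) = - (l * inner e h) * (\<integral>x. w x * sin (inner x h) \<partial>Q)"
  proof (rule LIMSEQ_unique)
    show "(\<lambda>n. \<integral>x. w x * B x * cos (inner x (g n)) \<partial>Q) \<longlonglongrightarrow> (\<integral>x. w x * B x * cos (inner x h) \<partial>Q)"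
      by (rule lc[OF iwB]) auto
    show "(\<lambda>n. \<integral>x. w x * B x * cos (inner x (g n)) \<partial>Q) \<longlonglongrightarrow> - (l * inner e h) * (\<integral>x. w x * sin (inner x h) \<partial>Q)"
      unfolding gn(1) by (intro tendsto_mult tendsto_minus gl ls[OF iw]) auto
  qed
  show "(\<integral>x. w x * B x * sin (inner x h) \<partial>Q) = l * inner e h * (\<integral>x. w x * cos (inner x h) \<partial>Q)"
  proof (rule LIMSEQ_unique)
    show "(\<lambda>n. \<integral>x. w x * B x * sin (inner x (g n)) \<partial>Q) \<longlonglongrightarrow> (\<integral>x. w x * B x * sin (inner x h) \<partial>Q)"
      by (rule ls[OF iwB]) auto
    show "(\<lambda>n. \<integral>x. w x * B x * sin (inner x (g n)) \<partial>Q) \<longlonglongrightarrow> l * inner e h * (\<integral>x. w x * cos (inner x h) \<partial>Q)"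
      unfolding gn(2) by (intro tendsto_mult gl lc[OF iw]) auto
  qed
qed

section \<open>Degenerate directions and invariance under resampling\<close>

lemma degenerate_gaussian_direction:
  assumes N: "centred_gaussian C N" and h: "C h = 0"
  shows "AE x in N. inner x h = 0"
proof -
  have [measurable_cong, simp]: "sets N = sets borel" using N by (simp add: centred_gaussian_def)
  have d: "distr N borel (\<lambda>x. inner x h) = return borel 0"
    using N h by (simp add: centred_gaussian_def normal_law_def)
  have [measurable]: "(\<lambda>x. inner x h) \<in> borel_measurable borel" 
    by (intro borel_measurable_continuous_onI continuous_intros)
  have "AE t in distr N borel (\<lambda>x. inner x h). t = 0" unfolding d by (subst AE_return) auto
  then show ?thesis by (subst (asm) AE_distr_iff) auto
qed

lemma nn_integral_gaussian_inner:
  assumes N: "centred_gaussian C N" and v: "inner (C h) h = l" "l > 0" and [measurable]: "f \<in> borel_measurable borel"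
  shows "(\<integral>\<^sup>+z. f (inner z h) \<partial>N) = (\<integral>\<^sup>+t. f t \<partial>density lborel (normal_density 0 (sqrt l)))"
proof -
  have [measurable_cong, simp]: "sets N = sets borel" using N by (simp add: centred_gaussian_def)
  have [measurable]: "(\<lambda>x. inner x h) \<in> borel_measurable borel" 
    by (intro borel_measurable_continuous_onI continuous_intros)
  have "distr N borel (\<lambda>x. inner x h) = density lborel (normal_density 0 (sqrt l))"
    using N v by (simp add: centred_gaussian_def normal_law_def)
  then show ?thesis by (subst nn_integral_distr[symmetric, of "\<lambda>x. inner x h" N borel f]) auto
qed

text \<open>Meant for directions with eigenvalue 0, where the right-hand sides in
  \<open>stein_trig\<close> vanish.\<close>

lemma degenerate_direction_trig:
  fixes Q :: "'a::{real_inner, banach, second_countable_topology} measure"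
  assumes [measurable_cong]: "sets Q = sets borel" and u: "integrable Q u"
    and "\<And>h. (\<integral>x. u x * cos (inner x h) \<partial>Q) = 0" "\<And>h. (\<integral>x. u x * sin (inner x h) \<partial>Q) = 0"
  shows "AE x in Q. u x = 0"
proof (rule density_unique_real[OF u])
  fix S assume "S \<in> sets Q"
  then have S: "S \<in> sets borel" using assms(1) by simp
  have "(\<lambda>x. x) \<in> borel_measurable Q" by measurable
  from signed_char_unique[OF this u assms(3,4) S]
  show "(LINT x:S|Q. u x) = (LINT x:S|Q. 0)"
    by (simp add: set_lebesgue_integral_def mult.commute)
qed simp

text \<open>The weighted measure w Q has logarithmic derivative B / l along \<open>e i\<close>, up
  to sign; the term 2 s <T x, T e> in \<open>B\<close> stems from the weight. Adding s |T x|^2 to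
  \<open>U\<close> absorbs it, and w exp(G) = exp(U) removes the weight at the end. If l = 0, both
  measures live on the hyperplane orthogonal to \<open>e i\<close>, and resampling does
  nothing.\<close>

lemma stein_resample_invariant:
  fixes C T :: "'a::{real_inner, banach, second_countable_topology} \<Rightarrow>\<^sub>L 'a"
  assumes N: "centred_gaussian C N" and e: "complete_onseq e" and Ce: "\<And>i. C (e i) = l i *\<^sub>R e i" "\<And>i. l i \<ge> 0"
    and U: "\<And>x. U differentiable (at x)"
    and Q: "prob_space Q" and sQ[measurable_cong, simp]: "sets Q = sets borel"
    and nQ: "integrable Q norm" and T: "surj (adjoint T)" and s: "s > 0"
    and b: "\<And>i. integrable Q (\<lambda>x. inner x (e i) + l i * inner (e i) (gradient U x))"
    and eq: "\<And>i y. (\<integral>x. (- 2 * s * l i * inner (T x - T y) (T (e i)) - (inner x (e i) + l i * inner (e i) (gradient U x)))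
        * exp (- s * (norm (T x - T y))\<^sup>2) \<partial>Q) = 0"
  shows "resample_invariant N e (density Q (\<lambda>x. ennreal (exp (U x))))"
  unfolding resample_invariant_def
proof (intro allI ballI)
  fix i and f :: "'a \<Rightarrow> ennreal" assume f[measurable]: "f \<in> borel_measurable borel"
  have sN[measurable_cong, simp]: "sets N = sets borel" and "prob_space N"
    using N by (simp_all add: centred_gaussian_def)
  interpret N: prob_space N by fact
  interpret Q: prob_space Q by fact
  have os: "onseq e" using e by (simp add: complete_onseq_def)
  have [measurable]: "blinfun_apply T \<in> borel_measurable borel"
    by (intro borel_measurable_continuous_onI continuous_intros)
  have "continuous_on UNIV U"
    using U by (intro continuous_at_imp_continuous_on ballI differentiable_imp_continuous_within) 
  then have [measurable]: "U \<in> borel_measurable borel" by (rule borel_measurable_continuous_onI)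
  let ?R = "density Q (\<lambda>x. ennreal (exp (U x)))"
  define w where "w x = exp (- s * (norm (T x))\<^sup>2)" for x
  define B where "B x = inner x (e i) + l i * inner (e i) (gradient U x) + 2 * s * l i * inner (T x) (T (e i))" for x
  note trig = stein_trig[OF Q sQ nQ b T s eq, of i, folded w_def B_def]
  have [measurable]: "w \<in> borel_measurable borel" unfolding w_def by measurable
  have w: "0 < w x" "w x \<le> 1" for x using s by (auto simp: w_def)
  have [measurable]: "(\<lambda>x. inner x (e i) + l i * inner (e i) (gradient U x)) \<in> borel_measurable borel"
    using borel_measurable_integrable[OF b[of i]] by (simp cong: measurable_cong_sets)
  have [measurable]: "B \<in> borel_measurable borel" unfolding B_def by measurable
  have iB: "integrable Q (\<lambda>x. w x * B x)"
  proof (rule Bochner_Integration.integrable_bound)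
    have "integrable Q (\<lambda>x. inner (T x) (T (e i)))"
    proof (rule Bochner_Integration.integrable_bound)
      show "integrable Q (\<lambda>x. norm T * norm (T (e i)) * norm x)" using nQ by simp
      have "\<bar>inner (T x) (T (e i))\<bar> \<le> norm T * norm x * norm (T (e i))" for x
        by (rule order_trans[OF Cauchy_Schwarz_ineq2]) (intro mult_right_mono norm_blinfun norm_ge_zero)
      then show "AE x in Q. norm (inner (T x) (T (e i))) \<le> norm (norm T * norm (T (e i)) * norm x)"
        by (simp add: mult_ac)
    qed measurable
    then show "integrable Q B" unfolding B_def using b[of i] by simp
    show "(\<lambda>x. w x * B x) \<in> borel_measurable Q" by measurable
    show "AE x in Q. norm (w x * B x) \<le> norm (B x)"
      using w by (intro AE_I2) (simp add: abs_mult mult_left_le_one_le less_imp_le)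
  qed
  consider "e i = 0" | "norm (e i) = 1" "l i = 0" | "norm (e i) = 1" "l i > 0"
    using os Ce(2)[of i] by (auto simp: onseq_def less_le)
  then show "(\<integral>\<^sup>+x. (\<integral>\<^sup>+z. f (resample (e i) x z) \<partial>N) \<partial>?R) = (\<integral>\<^sup>+x. f x \<partial>?R)"
  proof cases
    case 1
    then show ?thesis by (simp add: resample_def N.emeasure_space_1)
  next
    case 2
    have "AE x in Q. w x * B x = 0"
      by (rule degenerate_direction_trig[OF sQ iB]) (use 2 trig in simp_all)
    \<comment> \<open>For l = 0 only the coordinate is left of \<open>B\<close>, and
      \<open>w\<close> is positive.\<close>
    then have "AE x in Q. inner x (e i) = 0"
      by eventually_elim (use w 2 in \<open>simp add: B_def less_le\<close>)
    then have R0: "AE x in ?R. inner x (e i) = 0"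
      by (subst AE_density) auto
    have N0: "AE z in N. inner z (e i) = 0"
      by (rule degenerate_gaussian_direction[OF N]) (simp add: Ce 2)
    from R0 have "AE x in ?R. (\<integral>\<^sup>+z. f (resample (e i) x z) \<partial>N) = f x"
    proof eventually_elim
      case (elim x)
      have "(\<integral>\<^sup>+z. f (resample (e i) x z) \<partial>N) = (\<integral>\<^sup>+z. f x \<partial>N)"
        by (rule nn_integral_cong_AE) (use N0 in eventually_elim, simp add: resample_def elim)
      then show ?case by (simp add: N.emeasure_space_1)
    qed
    then show ?thesis by (rule nn_integral_cong_AE)
  next
    case 3
    let ?\<mu> = "density Q (\<lambda>x. ennreal (w x))"
    have dens: "(\<integral>x. g x \<partial>?\<mu>) = (\<integral>x. w x * g x \<partial>Q)" if "g \<in> borel_measurable Q" for g :: "'a \<Rightarrow> real"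
      by (subst integral_density) (use w that in \<open>auto simp: less_imp_le\<close>)
    have iB': "integrable ?\<mu> (\<lambda>x. B x / l i)" 
    proof (subst integrable_density)
      show "(\<lambda>x. B x / l i) \<in> borel_measurable Q" by measurable
      show "integrable Q (\<lambda>x. w x *\<^sub>R (B x / l i))" using iB by simp
    qed (use w in \<open>auto simp: less_imp_le\<close>)
    have [simp]: "space Q = UNIV" using sets_eq_imp_space_eq[OF sQ] by simp
    interpret L: log_derivative ?\<mu> "\<lambda>x. B x / l i" "e i"
    proof (rule log_derivative.intro)
      show "finite_measure ?\<mu>"
      proof (rule finite_measureI)
        have "emeasure ?\<mu> (space ?\<mu>) = (\<integral>\<^sup>+x. ennreal (w x) \<partial>Q)"
          by (subst emeasure_density) (auto intro!: nn_integral_cong)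
        also have "\<dots> \<le> (\<integral>\<^sup>+x. 1 \<partial>Q)" using w by (intro nn_integral_mono) (auto simp: less_imp_le)
        also have "\<dots> < \<infinity>" using Q.emeasure_space_1 by simp
        finally show "emeasure ?\<mu> (space ?\<mu>) \<noteq> \<infinity>" by simp
      qed
      fix h
      show "(\<integral>x. B x / l i * cos (inner x h) \<partial>?\<mu>) = - inner (e i) h * (\<integral>x. sin (inner x h) \<partial>?\<mu>)"
        using trig(1)[of h] 3(2) by (subst (1 2) dens) (simp_all add: field_simps)
      show "(\<integral>x. B x / l i * sin (inner x h) \<partial>?\<mu>) = inner (e i) h * (\<integral>x. cos (inner x h) \<partial>?\<mu>)"
        using trig(2)[of h] 3(2) by (subst (1 2) dens) (simp_all add: field_simps)
    qed (use iB' 3 in auto)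
    \<comment> \<open>\<open>G\<close> is the part of the potential that remains after splitting off
      the Gaussian term in the coordinate along \<open>e i\<close>; \<open>V\<close> contains
      both.\<close>
    define G where "G x = U x + s * (norm (T x))\<^sup>2" for x
    define V where "V x = G x + (inner x (e i))\<^sup>2 / (2 * l i)" for x
    have [measurable]: "G \<in> borel_measurable borel" unfolding G_def by measurable
    have V: "((\<lambda>t. V (x + t *\<^sub>R e i)) has_real_derivative B x / l i) (at 0)" for x
    proof -
      have 1: "((\<lambda>t. U (x + t *\<^sub>R e i)) has_real_derivative inner (e i) (gradient U x)) (at 0)"
        by (rule has_derivative_along_line) (use GDERIV_gradient[OF U] in simp)
      have 2: "V (x + t *\<^sub>R e i) = U (x + t *\<^sub>R e i) + s * (inner (T x) (T x) + 2 * t * inner (T x) (T (e i)) + t\<^sup>2 * inner (T (e i)) (T (e i)))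
          + inverse (2 * l i) * (inner x (e i) + t)\<^sup>2" for t
      proof -
        have "inner (x + t *\<^sub>R e i) (e i) = inner x (e i) + t"
          using 3(1) by (simp add: inner_add_left norm_eq_1)
        moreover have "(norm (T (x + t *\<^sub>R e i)))\<^sup>2 = inner (T x) (T x) + 2 * t * inner (T x) (T (e i)) + t\<^sup>2 * inner (T (e i)) (T (e i))"
          unfolding power2_norm_eq_inner
          by (simp add: blinfun.add_right blinfun.scaleR_right inner_add_left inner_add_right
              inner_commute[of "T (e i)" "T x"] power2_eq_square distrib_left)
        ultimately show ?thesis by (simp only: V_def G_def divide_inverse mult.commute[of "inverse (2 * l i)"])
      qed
      show ?thesis unfolding 2 B_def
        by (rule derivative_eq_intros 1 refl)+ (use 3(2) in \<open>simp add: field_simps\<close>)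
    qed
    have "density ?\<mu> (\<lambda>x. ennreal (exp (G x))) = ?R"
    proof -
      have "ennreal (w x) * ennreal (exp (G x)) = ennreal (exp (U x))" for x
        unfolding w_def G_def by (simp add: exp_add[symmetric] flip: ennreal_mult')
      then show ?thesis by (subst density_density_eq) auto
    qed
    moreover have "(\<integral>\<^sup>+z. f (resample (e i) x z) \<partial>N) =
        (\<integral>\<^sup>+t. f (x - inner x (e i) *\<^sub>R e i + t *\<^sub>R e i) \<partial>density lborel (normal_density 0 (sqrt (l i))))" for x
      unfolding resample_def
      by (rule nn_integral_gaussian_inner[OF N _ 3(2), of "e i" "\<lambda>t. f (x - inner x (e i) *\<^sub>R e i + t *\<^sub>R e i)"])
        (use 3(1) in \<open>simp_all add: Ce norm_eq_1\<close>)
    ultimately show ?thesis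
      using L.resample_invariant[OF V 3(2) V_def _ f] by simp
  qed
qed

section \<open>Positive semidefinite kernels and membership in an RKHS\<close>

text \<open>Finite combinations of point evaluations, kept as lists so that concatenation is
  addition and repeated points are harmless.\<close>

definition lin :: "(real \<times> 'a) list \<Rightarrow> ('a \<Rightarrow> real) \<Rightarrow> real" where
  "lin L g = (\<Sum>(a, x)\<leftarrow>L. a * g x)"

definition reweight :: "('a \<Rightarrow> real) \<Rightarrow> (real \<times> 'a) list \<Rightarrow> (real \<times> 'a) list" where
  "reweight w L = map (\<lambda>(a, x). (a * w x, x)) L"

lemma lin_simps[simp]: "lin [] g = 0" "lin ((a, x) # L) g = a * g x + lin L g"
  by (simp_all add: lin_def)

lemma lin_append: "lin (L @ L') g = lin L g + lin L' g"
  by (simp add: lin_def)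

lemma lin_reweight: "lin (reweight w L) g = lin L (\<lambda>x. w x * g x)"
  by (induction L) (auto simp: reweight_def)

lemma lin_add: "lin L (\<lambda>x. g x + h x) = lin L g + lin L h"
  by (induction L) (auto simp: algebra_simps)

lemma lin_cmult: "lin L (\<lambda>x. c * g x) = c * lin L g"
  by (induction L) (auto simp: algebra_simps)

lemma lin_sum: "lin L (\<lambda>x. \<Sum>m\<in>S. g m x) = (\<Sum>m\<in>S. lin L (g m))"
  by (induction L) (auto simp: sum.distrib sum_distrib_left)

lemma lin_divide: "lin L (\<lambda>x. g x / c) = lin L g / c"
  using lin_cmult[of L "1 / c" g] by simp

lemma tendsto_lin:
  assumes "\<And>x. ((\<lambda>n. g n x) \<longlongrightarrow> h x) F" shows "((\<lambda>n. lin L (g n)) \<longlongrightarrow> lin L h) F"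
  by (induction L) (auto intro!: tendsto_intros assms)

lemma lin_integral:
  fixes g :: "'b \<Rightarrow> 'a \<Rightarrow> real"
  assumes "\<And>x. integrable M (\<lambda>u. g u x)"
  shows "integrable M (\<lambda>u. lin L (g u))" "(\<integral>u. lin L (g u) \<partial>M) = lin L (\<lambda>x. \<integral>u. g u x \<partial>M)"
proof -
  have "integrable M (\<lambda>u. lin L (g u)) \<and> (\<integral>u. lin L (g u) \<partial>M) = lin L (\<lambda>x. \<integral>u. g u x \<partial>M)"
  proof (induction L)
    case (Cons p L)
    then show ?case using assms[of "snd p"] by (cases p) simp
  qed simp
  then show "integrable M (\<lambda>u. lin L (g u))" "(\<integral>u. lin L (g u) \<partial>M) = lin L (\<lambda>x. \<integral>u. g u x \<partial>M)" by auto
qed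

text \<open>Applying \<open>lin L\<close> in both arguments gives the quadratic form of the kernel
  at the weights and points of \<open>L\<close>.\<close>

definition psd_kernel :: "('a \<Rightarrow> 'a \<Rightarrow> real) \<Rightarrow> bool" where
  "psd_kernel K \<longleftrightarrow> (\<forall>L. 0 \<le> lin L (\<lambda>x. lin L (K x)))"

lemma psd_kernelD: "psd_kernel K \<Longrightarrow> 0 \<le> lin L (\<lambda>x. lin L (K x))"
  by (simp add: psd_kernel_def)

lemma psd_kernel_weighted:
  assumes "psd_kernel K" shows "psd_kernel (\<lambda>x y. g x * g y * K x y)"
  unfolding psd_kernel_def
proof
  fix L
  have "0 \<le> lin (reweight g L) (\<lambda>x. lin (reweight g L) (K x))" by (rule psd_kernelD[OF assms])
  then show "0 \<le> lin L (\<lambda>x. lin L (\<lambda>y. g x * g y * K x y))"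
    by (simp add: lin_reweight mult.assoc lin_cmult)
qed

lemma psd_kernel_sum:
  assumes "\<And>m. m \<in> S \<Longrightarrow> psd_kernel (K m)" shows "psd_kernel (\<lambda>x y. \<Sum>m\<in>S. K m x y)"
  unfolding psd_kernel_def lin_sum by (intro allI sum_nonneg psd_kernelD assms)

lemma psd_kernel_cmult:
  assumes "psd_kernel K" "c \<ge> 0" shows "psd_kernel (\<lambda>x y. c * K x y)"
  unfolding psd_kernel_def lin_cmult by (intro allI mult_nonneg_nonneg psd_kernelD assms)

lemma psd_kernel_limit:
  assumes "\<And>n::nat. psd_kernel (K n)" "\<And>x y. (\<lambda>n. K n x y) \<longlonglongrightarrow> K' x y" shows "psd_kernel K'"
  unfolding psd_kernel_def
proof
  fix L
  have "(\<lambda>n. lin L (\<lambda>x. lin L (K n x))) \<longlonglongrightarrow> lin L (\<lambda>x. lin L (K' x))"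
    by (intro tendsto_lin assms(2))
  then show "0 \<le> lin L (\<lambda>x. lin L (K' x))"
    by (rule LIMSEQ_le_const) (use psd_kernelD[OF assms(1)] in auto)
qed

lemma lin_map: "lin (map (\<lambda>(a, x). (a, f x)) L) g = lin L (\<lambda>x. g (f x))"
  by (induction L) auto

lemma psd_kernel_compose:
  assumes "psd_kernel K" shows "psd_kernel (\<lambda>x y. K (f x) (f y))"
  unfolding psd_kernel_def
proof
  fix L
  have "0 \<le> lin (map (\<lambda>(a, x). (a, f x)) L) (\<lambda>x. lin (map (\<lambda>(a, x). (a, f x)) L) (K x))"
    by (rule psd_kernelD[OF assms])
  then show "0 \<le> lin L (\<lambda>x. lin L (\<lambda>y. K (f x) (f y)))" by (simp add: lin_map)
qed

text \<open>By Parseval the product is a limit of sums of copies of \<open>K\<close> with rank one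
  weights <x, e m> <y, e m>. This case of the Schur product theorem suffices for powers of the inner
  product.\<close>

lemma psd_kernel_mult_inner:
  fixes K :: "'a::{real_inner, banach, second_countable_topology} \<Rightarrow> 'a \<Rightarrow> real"
  assumes K: "psd_kernel K" shows "psd_kernel (\<lambda>x y. inner x y * K x y)"
proof -
  obtain e :: "nat \<Rightarrow> 'a" where e: "complete_onseq e" using complete_onseq_exists by blast
  show ?thesis
  proof (rule psd_kernel_limit)
    show "psd_kernel (\<lambda>x y. \<Sum>m<n. inner x (e m) * inner y (e m) * K x y)" for n
      by (intro psd_kernel_sum psd_kernel_weighted K)
    show "(\<lambda>n. \<Sum>m<n. inner x (e m) * inner y (e m) * K x y) \<longlonglongrightarrow> inner x y * K x y" for x y
      using sums_mult2[OF parseval[OF e, of x y], of "K x y"] by (simp add: sums_def)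
  qed
qed

lemma psd_kernel_inner_power:
  "psd_kernel (\<lambda>x y :: 'a::{real_inner, banach, second_countable_topology}. inner x y ^ n)"
proof (induction n)
  case 0
  have "lin L (\<lambda>x. lin L (\<lambda>y. 1)) = lin L (\<lambda>_. 1) * lin L (\<lambda>_. 1)" for L :: "(real \<times> 'a) list"
    using lin_cmult[of L "lin L (\<lambda>_. 1)" "\<lambda>_. 1"] by simp
  then show ?case by (simp add: psd_kernel_def)
next
  case (Suc n)
  then show ?case by (simp add: psd_kernel_mult_inner)
qed

lemma psd_kernel_exp_inner:
  assumes "c \<ge> 0"
  shows "psd_kernel (\<lambda>x y :: 'a::{real_inner, banach, second_countable_topology}. exp (c * inner x y))"
proof (rule psd_kernel_limit)
  show "psd_kernel (\<lambda>x y :: 'a. \<Sum>m<n. (c ^ m / fact m) * inner x y ^ m)" for n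
    using assms by (intro psd_kernel_sum psd_kernel_cmult psd_kernel_inner_power) auto
  show "(\<lambda>n. \<Sum>m<n. (c ^ m / fact m) * inner x y ^ m) \<longlonglongrightarrow> exp (c * inner x y)" for x y :: 'a
    using exp_converges[of "c * inner x y"] by (simp add: sums_def power_mult_distrib divide_inverse mult_ac)
qed

text \<open>Expanding the square leaves exp(2 s <x, y>) with the weights exp(-s |x|^2) and exp(-s
  |y|^2).\<close>

lemma psd_kernel_gaussian:
  fixes T :: "'a::{real_inner, banach, second_countable_topology} \<Rightarrow>\<^sub>L 'a"
  assumes "s \<ge> 0"
  shows "psd_kernel (\<lambda>x y. exp (- s * (norm (T x - T y))\<^sup>2))"
proof -
  have "psd_kernel (\<lambda>x y :: 'a. exp (- s * (norm x)\<^sup>2) * exp (- s * (norm y)\<^sup>2) * exp (2 * s * inner x y))"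
    using assms by (intro psd_kernel_weighted psd_kernel_exp_inner) auto
  moreover have "exp (- s * (norm x)\<^sup>2) * exp (- s * (norm y)\<^sup>2) * exp (2 * s * inner x y) = exp (- s * (norm (x - y))\<^sup>2)" for x y :: 'a
    unfolding exp_add[symmetric] power2_norm_eq_inner
    by (simp add: inner_diff_left inner_diff_right inner_commute algebra_simps)
  ultimately show ?thesis using psd_kernel_compose[of "\<lambda>x y. exp (- s * (norm (x - y))\<^sup>2)" T] by simp
qed

text \<open>Positivity for the evaluation at \<open>y\<close> plus t times \<open>L\<close> is a
  nonnegative quadratic polynomial in t.\<close>

lemma psd_kernel_cauchy_schwarz:
  assumes K: "psd_kernel K" and sym: "\<And>x y. K x y = K y x"
  shows "(lin L (\<lambda>x. K x y))\<^sup>2 \<le> K y y * lin L (\<lambda>x. lin L (K x))"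
proof (rule quadratic_nonneg_discriminant)
  fix t
  have "0 \<le> lin ((1, y) # reweight (\<lambda>_. t) L) (\<lambda>x. lin ((1, y) # reweight (\<lambda>_. t) L) (K x))"
    by (rule psd_kernelD[OF K])
  also have "\<dots> = K y y + t * lin L (K y) + t * lin L (\<lambda>x. K x y) + t\<^sup>2 * lin L (\<lambda>x. lin L (K x))"
    by (simp add: lin_reweight lin_add lin_cmult power2_eq_square distrib_left)
  also have "lin L (K y) = lin L (\<lambda>x. K x y)"
    by (rule arg_cong[where f = "lin L"]) (rule ext, rule sym)
  also have "K y y + t * lin L (\<lambda>x. K x y) + t * lin L (\<lambda>x. K x y) + t\<^sup>2 * lin L (\<lambda>x. lin L (K x))
     = K y y + 2 * t * lin L (\<lambda>x. K x y) + t\<^sup>2 * lin L (\<lambda>x. lin L (K x))" by simp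
  finally show "0 \<le> K y y + 2 * t * lin L (\<lambda>x. K x y) + t\<^sup>2 * lin L (\<lambda>x. lin L (K x))" .
qed

section \<open>Membership in a reproducing kernel Hilbert space\<close>

context rkhs
begin

lemma uminus_mem: "f \<in> H \<Longrightarrow> (\<lambda>x. - f x) \<in> H"
  using scale_mem[of f "-1"] by simp

lemma diff_mem: "f \<in> H \<Longrightarrow> g \<in> H \<Longrightarrow> (\<lambda>x. f x - g x) \<in> H"
  using add_mem[OF _ uminus_mem, of f g] by simp

lemma ip_diff: "f \<in> H \<Longrightarrow> f' \<in> H \<Longrightarrow> g \<in> H \<Longrightarrow> ip (\<lambda>x. f x - f' x) g = ip f g - ip f' g"
  using ip_add[of f "\<lambda>x. - f' x" g] ip_scale[of f' g "-1"] uminus_mem[of f'] by simp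

lemma ip_add_right: "f \<in> H \<Longrightarrow> f' \<in> H \<Longrightarrow> g \<in> H \<Longrightarrow> ip g (\<lambda>x. f x + f' x) = ip g f + ip g f'"
  using ip_add[of f f' g] by (simp add: ip_commute[of g] add_mem)

lemma ip_diff_right: "f \<in> H \<Longrightarrow> f' \<in> H \<Longrightarrow> g \<in> H \<Longrightarrow> ip g (\<lambda>x. f x - f' x) = ip g f - ip g f'"
  using ip_diff[of f f' g] by (simp add: ip_commute[of g] diff_mem)

lemma ip_scale_right: "f \<in> H \<Longrightarrow> g \<in> H \<Longrightarrow> ip g (\<lambda>x. c * f x) = c * ip g f"
  using ip_scale[of f g c] by (simp add: ip_commute[of g] scale_mem)

lemma ip_add_self:
  "f \<in> H \<Longrightarrow> g \<in> H \<Longrightarrow> ip (\<lambda>x. f x + g x) (\<lambda>x. f x + g x) = ip f f + 2 * ip f g + ip g g"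
  by (simp add: ip_add ip_add_right add_mem ip_commute[of g f])

lemma ip_cauchy_schwarz:
  assumes "f \<in> H" "g \<in> H" shows "(ip f g)\<^sup>2 \<le> ip f f * ip g g"
proof (rule quadratic_nonneg_discriminant)
  fix t
  have tg: "(\<lambda>x. t * g x) \<in> H" using assms by (intro scale_mem)
  have "0 \<le> ip (\<lambda>x. f x + t * g x) (\<lambda>x. f x + t * g x)" by (intro ip_nonneg add_mem tg assms)
  also have "\<dots> = ip f f + 2 * t * ip f g + t\<^sup>2 * ip g g"
    using assms tg by (simp add: ip_add ip_add_right ip_scale ip_scale_right add_mem ip_commute[of g f]
        power2_eq_square algebra_simps)
  finally show "0 \<le> ip f f + 2 * t * ip f g + t\<^sup>2 * ip g g" .
qed

lemma lin_kernel_mem: "(\<lambda>z. lin L (k z)) \<in> H"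
proof (induction L)
  case (Cons p L)
  then show ?case by (cases p) (auto intro!: add_mem scale_mem kernel_mem)
qed (simp add: zero_mem)

lemma ip_lin_kernel: "g \<in> H \<Longrightarrow> ip g (\<lambda>z. lin L (k z)) = lin L g"
proof (induction L)
  case Nil
  then show ?case using ip_scale_right[OF zero_mem, of g 0] by simp
next
  case (Cons p L)
  then show ?case
    by (cases p) (simp add: ip_add_right ip_scale_right scale_mem kernel_mem lin_kernel_mem reproducing)
qed

text \<open>
  Aronszajn's membership criterion. The function is recovered as the minimizer of
  \<open>\<parallel>p\<parallel>\<^sup>2 - 2 \<langle>f, p\<rangle>\<close> over the span of the kernel sections, where \<open>\<langle>f, p\<rangle>\<close> is the evaluation
  \<open>lin L f\<close>; the bound makes this functional bounded below.
\<close>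

lemma mem_of_bound:
  assumes M: "M \<ge> 0" and bound: "\<And>L. (lin L f)\<^sup>2 \<le> M * lin L (\<lambda>x. lin L (k x))"
  shows "f \<in> H"
proof -
  define p where "p L = (\<lambda>z. lin L (k z))" for L
  have pH: "p L \<in> H" for L unfolding p_def by (rule lin_kernel_mem)
  have ip_p: "ip g (p L) = lin L g" if "g \<in> H" for g L unfolding p_def by (rule ip_lin_kernel[OF that])
  define J where "J L = ip (p L) (p L) - 2 * lin L f" for L
  \<comment> \<open>By the bound and the inequality of arithmetic and geometric means, |lin L f| is
    at most half of \<open>M\<close> plus the squared norm of \<open>p L\<close>.\<close>
  have J_ge: "J L \<ge> - M" for L
  proof -
    have nn: "0 \<le> ip (p L) (p L)" by (intro ip_nonneg pH)
    have "ip (p L) (p L) = lin L (\<lambda>x. lin L (k x))" by (subst ip_p[OF pH]) (simp add: p_def)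
    then have "(lin L f)\<^sup>2 \<le> M * ip (p L) (p L)" using bound[of L] by simp
    also have "\<dots> \<le> ((M + ip (p L) (p L)) / 2)\<^sup>2"
      using zero_le_power2[of "M - ip (p L) (p L)"] by (simp add: power2_eq_square algebra_simps)
    finally have "\<bar>lin L f\<bar> \<le> (M + ip (p L) (p L)) / 2"
      using M nn abs_le_square_iff[of "lin L f" "(M + ip (p L) (p L)) / 2"] by simp
    moreover have "\<bar>x\<bar> \<le> (M + y) / 2 \<Longrightarrow> - M \<le> y - 2 * x" for x y by (simp add: abs_le_iff field_simps)
    ultimately show ?thesis unfolding J_def by blast
  qed
  define I where "I = Inf (range J)"
  have bdd: "bdd_below (range J)" using J_ge by (intro bdd_belowI2)
  have I_le: "I \<le> J L" for L unfolding I_def by (intro cInf_lower bdd) simp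
  have "\<exists>L. J L < I + 1 / real (Suc n)" for n
    using cInf_less_iff[OF _ bdd, of "I + 1 / real (Suc n)"] by (auto simp: I_def)
  then obtain Ls where Ls: "\<And>n. J (Ls n) < I + 1 / real (Suc n)" by metis
  define q where "q n = p (Ls n)" for n
  have qH: "q n \<in> H" for n by (simp add: q_def pH)
  \<comment> \<open>The half sum of two nearly optimal combinations is a competitor, so the
    parallelogram law forces the two to be close.\<close>
  have parallelogram: "ip (\<lambda>x. q m x - q n x) (\<lambda>x. q m x - q n x) \<le> 2 * (1 / real (Suc m) + 1 / real (Suc n))" for m n
  proof -
    let ?L = "reweight (\<lambda>_. 1 / 2) (Ls m @ Ls n)"
    have pm: "p ?L = (\<lambda>z. (1 / 2) * (q m z + q n z))"
      by (rule ext) (simp add: p_def q_def lin_reweight lin_append lin_divide)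
    have s: "(\<lambda>z. q m z + q n z) \<in> H" by (intro add_mem qH)
    have "ip (p ?L) (p ?L) = (1 / 4) * (ip (q m) (q m) + 2 * ip (q m) (q n) + ip (q n) (q n))"
      unfolding pm using s qH
      by (simp only: ip_scale ip_scale_right scale_mem ip_add ip_add_right ip_commute[of "q n" "q m"]) simp
    moreover have "lin ?L f = (lin (Ls m) f + lin (Ls n) f) / 2"
      by (simp add: lin_reweight lin_append lin_divide add_divide_distrib)
    moreover have "ip (\<lambda>x. q m x - q n x) (\<lambda>x. q m x - q n x) = ip (q m) (q m) - 2 * ip (q m) (q n) + ip (q n) (q n)"
      using qH by (simp add: ip_diff ip_diff_right diff_mem ip_commute[of "q n" "q m"])
    ultimately have "ip (\<lambda>x. q m x - q n x) (\<lambda>x. q m x - q n x) = 2 * (J (Ls m) + J (Ls n) - 2 * J ?L)"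
      by (simp add: J_def q_def)
    moreover have "z = 2 * (a + b - 2 * c) \<Longrightarrow> I \<le> c \<Longrightarrow> a < I + r \<Longrightarrow> b < I + r' \<Longrightarrow> z \<le> 2 * (r + r')"
      for z a b c r r' unfolding distrib_left right_diff_distrib by linarith
    ultimately show ?thesis using I_le[of ?L] Ls[of m] Ls[of n] by blast
  qed
  have "\<exists>g\<in>H. (\<lambda>n. sqrt (ip (\<lambda>x. q n x - g x) (\<lambda>x. q n x - g x))) \<longlonglongrightarrow> 0"
  proof (rule complete)
    fix \<epsilon> :: real assume "\<epsilon> > 0"
    obtain K where K: "1 / real (Suc K) < \<epsilon>\<^sup>2 / 4"
      using reals_Archimedean[of "\<epsilon>\<^sup>2 / 4"] \<open>\<epsilon> > 0\<close> by (auto simp: inverse_eq_divide)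
    have "sqrt (ip (\<lambda>x. q m x - q n x) (\<lambda>x. q m x - q n x)) < \<epsilon>" if "m \<ge> K" "n \<ge> K" for m n
    proof (rule real_less_lsqrt)
      have "1 / real (Suc m) \<le> 1 / real (Suc K)" "1 / real (Suc n) \<le> 1 / real (Suc K)"
        using that by (auto intro!: frac_le)
      moreover have "z \<le> 2 * (a + b) \<Longrightarrow> a \<le> c \<Longrightarrow> b \<le> c \<Longrightarrow> c < \<epsilon>\<^sup>2 / 4 \<Longrightarrow> z < \<epsilon>\<^sup>2" for z a b c
        unfolding distrib_left by linarith
      ultimately show "ip (\<lambda>x. q m x - q n x) (\<lambda>x. q m x - q n x) < \<epsilon>\<^sup>2"
        using parallelogram[of m n] K by blast
    qed (use \<open>\<epsilon> > 0\<close> in auto)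
    then show "\<exists>K. \<forall>m\<ge>K. \<forall>n\<ge>K. sqrt (ip (\<lambda>x. q m x - q n x) (\<lambda>x. q m x - q n x)) < \<epsilon>" by blast
  qed (rule qH)
  then obtain g where g: "g \<in> H" "(\<lambda>n. sqrt (ip (\<lambda>x. q n x - g x) (\<lambda>x. q n x - g x))) \<longlonglongrightarrow> 0" by blast
  have pt: "(\<lambda>n. q n x) \<longlonglongrightarrow> g x" for x
  proof -
    have "\<bar>q n x - g x\<bar> \<le> sqrt (ip (\<lambda>x. q n x - g x) (\<lambda>x. q n x - g x)) * sqrt (k x x)" for n
    proof -
      have d: "(\<lambda>x. q n x - g x) \<in> H" by (intro diff_mem qH g)
      have "(ip (\<lambda>x. q n x - g x) (\<lambda>y. k y x))\<^sup>2 \<le> ip (\<lambda>x. q n x - g x) (\<lambda>x. q n x - g x) * ip (\<lambda>y. k y x) (\<lambda>y. k y x)"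
        by (rule ip_cauchy_schwarz[OF d kernel_mem])
      then have "(q n x - g x)\<^sup>2 \<le> ip (\<lambda>x. q n x - g x) (\<lambda>x. q n x - g x) * k x x"
        by (simp only: reproducing[OF d] reproducing[OF kernel_mem])
      then have "sqrt ((q n x - g x)\<^sup>2) \<le> sqrt (ip (\<lambda>x. q n x - g x) (\<lambda>x. q n x - g x) * k x x)"
        by (rule real_sqrt_le_mono)
      then show ?thesis by (simp add: real_sqrt_mult)
    qed
    moreover have "(\<lambda>n. sqrt (ip (\<lambda>x. q n x - g x) (\<lambda>x. q n x - g x)) * sqrt (k x x)) \<longlonglongrightarrow> 0"
      by (intro tendsto_mult_left_zero g)
    ultimately have "(\<lambda>n. q n x - g x) \<longlonglongrightarrow> 0"
      by (intro Lim_null_comparison[where f = "\<lambda>n. q n x - g x"]) auto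
    then show ?thesis by (simp add: LIM_zero_iff)
  qed
  have "g x = f x" for x
  proof -
    \<comment> \<open>Perturbing the near-minimizers by t times the section at x changes the
      functional by 2 t (q x - f x) + t^2 k(x, x). In the limit this is nonnegative for every t, so
      its linear coefficient vanishes.\<close>
    have "(g x - f x)\<^sup>2 \<le> 0 * k x x"
    proof (rule quadratic_nonneg_discriminant)
      fix t
      have "0 \<le> 1 / real (Suc n) + (2 * t * (q n x - f x) + t\<^sup>2 * k x x)" for n
      proof -
        let ?L = "(t, x) # Ls n"
        have pL: "p ?L = (\<lambda>z. t * k z x + q n z)" by (rule ext) (simp add: p_def q_def)
        have tk: "(\<lambda>z. t * k z x) \<in> H" by (intro scale_mem kernel_mem)
        have "ip (p ?L) (p ?L) = t * (t * k x x) + 2 * (t * q n x) + ip (q n) (q n)"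
        proof -
          have "ip (\<lambda>z. t * k z x) (q n) = t * q n x"
            using ip_commute[OF kernel_mem qH] by (simp add: ip_scale kernel_mem qH reproducing)
          moreover have "ip (\<lambda>z. t * k z x) (\<lambda>z. t * k z x) = t * (t * k x x)"
            by (simp add: ip_scale ip_scale_right tk kernel_mem reproducing)
          ultimately show ?thesis unfolding pL by (simp add: ip_add_self[OF tk qH])
        qed
        then have "J ?L = J (Ls n) + (2 * t * (q n x - f x) + t\<^sup>2 * k x x)"
          by (simp add: J_def q_def power2_eq_square algebra_simps)
        with I_le[of ?L] Ls[of n] show ?thesis by linarith
      qed
      moreover have "(\<lambda>n. 1 / real (Suc n) + (2 * t * (q n x - f x) + t\<^sup>2 * k x x)) \<longlonglongrightarrow> 0 + (2 * t * (g x - f x) + t\<^sup>2 * k x x)"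
        using LIMSEQ_inverse_real_of_nat by (intro tendsto_intros pt) (simp add: inverse_eq_divide)
      ultimately show "0 \<le> 0 + 2 * t * (g x - f x) + t\<^sup>2 * k x x"
        using LIMSEQ_le_const[of "\<lambda>n. 1 / real (Suc n) + (2 * t * (q n x - f x) + t\<^sup>2 * k x x)" _ 0] by auto
    qed
    then show ?thesis by simp
  qed
  then have "g = f" by (rule ext)
  with g(1) show ?thesis by simp
qed

end

section \<open>Stein equations from a vanishing discrepancy\<close>

lemma infsum_hilbert_basis:
  fixes f :: "'a::real_inner \<Rightarrow> real"
  assumes "bij_betw e J E" "\<And>i::nat. i \<notin> J \<Longrightarrow> e i = 0" "f 0 = 0" "summable (\<lambda>i. norm (f (e i)))"
  shows "infsum f E = (\<Sum>i. f (e i))"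
proof -
  have "infsum f E = infsum (\<lambda>i. f (e i)) J" by (rule infsum_reindex_bij_betw[OF assms(1), symmetric])
  also have "\<dots> = infsum (\<lambda>i. f (e i)) UNIV" by (rule infsum_cong_neutral) (auto simp: assms)
  also have "\<dots> = (\<Sum>i. f (e i))"
    using norm_summable_imp_has_sum[OF assms(4) summable_sums[OF summable_norm_cancel[OF assms(4)]]]
    by (rule infsumI)
  finally show ?thesis .
qed

lemma summable_inner_mult:
  assumes "onseq e" shows "summable (\<lambda>i. norm (inner x (e i) * inner y (e i)))"
proof (rule summable_comparison_test')
  show "summable (\<lambda>i. (inner x (e i))\<^sup>2 + (inner y (e i))\<^sup>2)"
    by (intro summable_add summable_inner_sq assms)
  have "norm (a * b) \<le> a\<^sup>2 + b\<^sup>2" for a b :: real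
  proof -
    have "2 * (\<bar>a\<bar> * \<bar>b\<bar>) \<le> a\<^sup>2 + b\<^sup>2" using zero_le_power2[of "\<bar>a\<bar> - \<bar>b\<bar>"] by (simp add: power2_diff)
    moreover have "0 \<le> \<bar>a\<bar> * \<bar>b\<bar>" by simp
    ultimately show ?thesis unfolding real_norm_def abs_mult by linarith
  qed
  then show "norm (norm (inner x (e i) * inner y (e i))) \<le> (inner x (e i))\<^sup>2 + (inner y (e i))\<^sup>2" for i by simp
qed

lemma infsum_parseval:
  fixes E :: "'a::{real_inner, banach, second_countable_topology} set"
  assumes "hilbert_basis E" shows "(\<Sum>\<^sub>\<infinity>h\<in>E. inner x h * inner y h) = inner x y"
proof -
  obtain e :: "nat \<Rightarrow> 'a" and J where e: "complete_onseq e" "bij_betw e J E" "\<And>i. i \<notin> J \<Longrightarrow> e i = 0"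
    using hilbert_basis_enumeration[OF assms] by metis
  have "(\<Sum>\<^sub>\<infinity>h\<in>E. inner x h * inner y h) = (\<Sum>i. inner x (e i) * inner y (e i))"
    by (rule infsum_hilbert_basis[OF e(2,3)]) (use e(1) summable_inner_mult in \<open>auto simp: complete_onseq_def\<close>)
  also have "\<dots> = inner x y" using parseval[OF e(1)] by (rule sums_unique[symmetric])
  finally show ?thesis .
qed

text \<open>For a field in a fixed direction the derivative has rank one, and Parseval reduces the
  trace to a single inner product.\<close>

lemma stein_op_scalar:
  fixes C :: "'a::{real_inner, banach, second_countable_topology} \<Rightarrow>\<^sub>L 'a"
  assumes "(\<phi> has_derivative (\<lambda>h. inner h g)) (at x)"
  shows "stein_op C U (\<lambda>x. \<phi> x *\<^sub>R e) x = inner g (C e) - \<phi> x * inner e (x + C (gradient U x))"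
proof -
  have "((\<lambda>x. \<phi> x *\<^sub>R e) has_derivative (\<lambda>h. inner h g *\<^sub>R e)) (at x)"
    using assms by (auto intro!: derivative_eq_intros)
  then have "frechet_derivative (\<lambda>x. \<phi> x *\<^sub>R e) (at x) = (\<lambda>h. inner h g *\<^sub>R e)"
    by (rule frechet_derivative_at[symmetric])
  moreover have "op_trace (\<lambda>h. C (inner h g *\<^sub>R e)) = inner g (C e)"
    unfolding op_trace_def using infsum_parseval[OF hilbert_basis_some, of g "C e"]
    by (simp add: blinfun.scaleR_right inner_commute)
  ultimately show ?thesis by (simp add: stein_op_def)
qed

lemma bessel_summable_on:
  assumes "hilbert_basis E"
  shows "(\<lambda>h. (inner e h)\<^sup>2) summable_on E" "(\<Sum>\<^sub>\<infinity>h\<in>E. (inner e h)\<^sup>2) \<le> (norm e)\<^sup>2"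
proof -
  have b: "(\<Sum>h\<in>F. (inner e h)\<^sup>2) \<le> (norm e)\<^sup>2" if "finite F" "F \<subseteq> E" for F
    by (rule bessel_finite[OF that(1)]) (use assms that in \<open>auto simp: hilbert_basis_def intro: pairwise_subset\<close>)
  show "(\<lambda>h. (inner e h)\<^sup>2) summable_on E"
    by (rule nonneg_bdd_above_summable_on) (use b in \<open>auto intro!: bdd_aboveI2\<close>)
  then show "(\<Sum>\<^sub>\<infinity>h\<in>E. (inner e h)\<^sup>2) \<le> (norm e)\<^sup>2"
    by (rule infsum_le_finite_sums) (use b in auto)
qed

lemma scalar_mem_vv_rkhs:
  fixes e :: "'a::{real_inner, banach, second_countable_topology}"
  assumes R: "rkhs k H ip" and \<phi>: "\<phi> \<in> H"
  shows "(\<lambda>x. \<phi> x *\<^sub>R e) \<in> vv_rkhs H ip" "vv_norm ip (\<lambda>x. \<phi> x *\<^sub>R e) \<le> norm e * sqrt (ip \<phi> \<phi>)"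
proof -
  interpret rkhs k H ip by fact
  have eq: "(\<lambda>x. inner (\<phi> x *\<^sub>R e) h) = (\<lambda>x. inner e h * \<phi> x)" for h by (auto simp: mult.commute)
  have ip_eq: "ip (\<lambda>x. inner e h * \<phi> x) (\<lambda>x. inner e h * \<phi> x) = (inner e h)\<^sup>2 * ip \<phi> \<phi>" for h
    using \<phi> by (simp add: ip_scale ip_scale_right scale_mem power2_eq_square)
  show "(\<lambda>x. \<phi> x *\<^sub>R e) \<in> vv_rkhs H ip"
    unfolding vv_rkhs_def using \<phi> bessel_summable_on(1)
    by (auto simp only: eq ip_eq mem_Collect_eq intro!: scale_mem summable_on_cmult_left)
  have "(\<Sum>\<^sub>\<infinity>h\<in>(SOME E. hilbert_basis E). (inner e h)\<^sup>2 * ip \<phi> \<phi>) \<le> (norm e)\<^sup>2 * ip \<phi> \<phi>"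
    using bessel_summable_on[OF hilbert_basis_some, of e] ip_nonneg[OF \<phi>]
    by (subst infsum_cmult_left) (auto intro: mult_right_mono)
  then show "vv_norm ip (\<lambda>x. \<phi> x *\<^sub>R e) \<le> norm e * sqrt (ip \<phi> \<phi>)"
    unfolding vv_norm_def eq ip_eq using real_sqrt_le_mono by (fastforce simp: real_sqrt_mult)
qed

text \<open>The field is scaled into the unit ball, where a zero supremum forces its integral to
  vanish; linearity then removes the scale.\<close>

lemma ksd_zero_scalar:
  fixes C :: "'a::{real_inner, banach, second_countable_topology} \<Rightarrow>\<^sub>L 'a"
  assumes R: "rkhs k H ip" and ksd: "ksd C U H ip Q = 0" and \<phi>: "\<phi> \<in> H"
    and D: "\<And>x. (\<phi> has_derivative (\<lambda>h. inner h (g x))) (at x)"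
  shows "(\<integral>x. inner (g x) (C e) - \<phi> x * inner e (x + C (gradient U x)) \<partial>Q) = 0"
proof -
  interpret rkhs k H ip by fact
  define r where "r = norm e * sqrt (ip \<phi> \<phi>)"
  have r: "r \<ge> 0" using ip_nonneg[OF \<phi>] by (simp add: r_def)
  \<comment> \<open>The summand 1 avoids division by zero when the norm vanishes.\<close>
  define c where "c = 1 / (1 + r)"
  have c: "c > 0" "c * r \<le> 1" using r by (auto simp: c_def field_simps)
  let ?\<psi> = "\<lambda>x. c * \<phi> x"
  have \<psi>: "?\<psi> \<in> H" by (intro scale_mem \<phi>)
  have "ip ?\<psi> ?\<psi> = c\<^sup>2 * ip \<phi> \<phi>" using \<phi> \<psi> by (simp add: ip_scale ip_scale_right power2_eq_square)
  then have "norm e * sqrt (ip ?\<psi> ?\<psi>) = c * r" using c(1) by (simp add: r_def real_sqrt_mult)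
  then have n: "vv_norm ip (\<lambda>x. ?\<psi> x *\<^sub>R e) \<le> 1"
    using scalar_mem_vv_rkhs(2)[OF R \<psi>, of e] c(2) by simp
  have "ennreal \<bar>\<integral>x. stein_op C U (\<lambda>x. ?\<psi> x *\<^sub>R e) x \<partial>Q\<bar> \<le> ksd C U H ip Q"
    unfolding ksd_def by (rule SUP_upper) (use scalar_mem_vv_rkhs(1)[OF R \<psi>] n in auto)
  then have "(\<integral>x. stein_op C U (\<lambda>x. ?\<psi> x *\<^sub>R e) x \<partial>Q) = 0" using ksd by (simp add: ennreal_eq_0_iff)
  moreover have "stein_op C U (\<lambda>x. ?\<psi> x *\<^sub>R e) x = c * (inner (g x) (C e) - \<phi> x * inner e (x + C (gradient U x)))" for x
  proof -
    have "(?\<psi> has_derivative (\<lambda>h. inner h (c *\<^sub>R g x))) (at x)"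
      using D[of x] by (auto intro!: derivative_eq_intros)
    from stein_op_scalar[OF this, of C U e] show ?thesis by (simp add: algebra_simps)
  qed
  ultimately show ?thesis using c(1) by simp
qed

lemma radial_has_derivative:
  fixes T :: "'a::{real_inner, banach, second_countable_topology} \<Rightarrow>\<^sub>L 'a"
  assumes "DERIV \<psi> ((norm (T x - T y))\<^sup>2) :> d"
  shows "((\<lambda>x. \<psi> ((norm (T x - T y))\<^sup>2)) has_derivative (\<lambda>h. inner h ((2 * d) *\<^sub>R adjoint T (T x - T y)))) (at x)"
proof -
  have "((\<lambda>x. (norm (T x - T y))\<^sup>2) has_derivative (\<lambda>h. 2 * inner (T x - T y) (T h))) (at x)"
    unfolding power2_norm_eq_inner
    by (auto intro!: derivative_eq_intros bounded_linear_imp_has_derivative blinfun.bounded_linear_right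
        simp: inner_commute)
  from has_derivative_compose[OF this assms[unfolded has_field_derivative_def]]
  show ?thesis by (simp add: adjoint_blinfun[symmetric] inner_commute mult_ac)
qed

text \<open>For an eigenvector, symmetry of \<open>C\<close> moves it from the gradient of
  \<open>U\<close> onto \<open>e\<close>, so that the equation involves the direction
  \<open>e\<close> alone.\<close>

lemma ksd_zero_radial:
  fixes C T :: "'a::{real_inner, banach, second_countable_topology} \<Rightarrow>\<^sub>L 'a"
  assumes R: "rkhs k H ip" and ksd: "ksd C U H ip Q = 0" and C: "nonneg_symmetric C" and Ce: "C e = l *\<^sub>R e"
    and \<phi>: "(\<lambda>x. \<psi> ((norm (T x - T y))\<^sup>2)) \<in> H" and D: "\<And>r. r \<ge> 0 \<Longrightarrow> DERIV \<psi> r :> \<psi>' r"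
  shows "(\<integral>x. 2 * \<psi>' ((norm (T x - T y))\<^sup>2) * l * inner (T x - T y) (T e)
     - \<psi> ((norm (T x - T y))\<^sup>2) * (inner x e + l * inner e (gradient U x)) \<partial>Q) = 0"
proof -
  have "(\<integral>x. inner ((2 * \<psi>' ((norm (T x - T y))\<^sup>2)) *\<^sub>R adjoint T (T x - T y)) (C e)
     - \<psi> ((norm (T x - T y))\<^sup>2) * inner e (x + C (gradient U x)) \<partial>Q) = 0"
    by (rule ksd_zero_scalar[OF R ksd \<phi> radial_has_derivative[OF D]]) simp
  moreover have "inner ((2 * \<psi>' ((norm (T x - T y))\<^sup>2)) *\<^sub>R adjoint T (T x - T y)) (C e)
      = 2 * \<psi>' ((norm (T x - T y))\<^sup>2) * l * inner (T x - T y) (T e)" for x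
    by (simp add: Ce inner_commute[of "adjoint T (T x - T y)"] adjoint_blinfun[symmetric] inner_commute[of "T e"])
  moreover have "inner e (x + C (gradient U x)) = inner x e + l * inner e (gradient U x)" for x
    using nonneg_symmetricD(1)[OF C, of e "gradient U x"] by (simp add: inner_add_right Ce inner_commute[of e x])
  ultimately show ?thesis by (simp only:)
qed

text \<open>The IMQ profile is a mixture of Gaussian profiles: the integrand is a multiple of the
  normal density with variance 1 / (2 (1 + r)).\<close>

lemma imq_gaussian_mixture:
  fixes r :: real
  assumes "r \<ge> 0"
  shows "integrable lborel (\<lambda>u. exp (- u\<^sup>2) * exp (- u\<^sup>2 * r))"
    "(\<integral>u. exp (- u\<^sup>2) * exp (- u\<^sup>2 * r) \<partial>lborel) = sqrt pi * (r + 1) powr (- (1 / 2))"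
proof -
  define \<sigma> where "\<sigma> = sqrt (1 / (2 * (1 + r)))"
  have \<sigma>: "\<sigma> > 0" "\<sigma>\<^sup>2 = 1 / (2 * (1 + r))" using assms by (auto simp: \<sigma>_def)
  have eq: "exp (- u\<^sup>2) * exp (- u\<^sup>2 * r) = sqrt (pi / (1 + r)) * normal_density 0 \<sigma> u" for u
  proof -
    have "2 * pi * \<sigma>\<^sup>2 = pi / (1 + r)" "- (u\<^sup>2) / (2 * \<sigma>\<^sup>2) = - u\<^sup>2 + - u\<^sup>2 * r"
      unfolding \<sigma>(2) using assms by (simp_all add: field_simps)
    moreover have "sqrt (pi / (1 + r)) > 0" "1 + r \<noteq> 0" using assms by simp_all
    ultimately show ?thesis unfolding normal_density_def exp_add[symmetric] by simp
  qed
  show "integrable lborel (\<lambda>u. exp (- u\<^sup>2) * exp (- u\<^sup>2 * r))" unfolding eq using \<sigma> by simp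
  have "(\<integral>u. exp (- u\<^sup>2) * exp (- u\<^sup>2 * r) \<partial>lborel) = sqrt (pi / (1 + r))" unfolding eq using \<sigma> by simp
  also have "\<dots> = sqrt pi * (r + 1) powr (- (1 / 2))"
  proof -
    have "(r + 1) powr (- (1 / 2)) = 1 / sqrt (1 + r)"
      using assms by (subst powr_minus, subst powr_half_sqrt) (simp_all add: inverse_eq_divide add.commute)
    then show ?thesis by (simp add: real_sqrt_divide)
  qed
  finally show "(\<integral>u. exp (- u\<^sup>2) * exp (- u\<^sup>2 * r) \<partial>lborel) = sqrt pi * (r + 1) powr (- (1 / 2))" .
qed

text \<open>The quadratic form of the IMQ kernel integrates the Gaussian forms \<open>q u\<close>
  over all u with weight exp(-u^2), so up to a constant it dominates their integral over a bounded
  range. As Gaussian kernels are 1 on the diagonal, (h u)^2 is at most \<open>q u\<close>, and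
  Aronszajn's criterion applies.\<close>

lemma imq_mem:
  fixes T :: "'a::{real_inner, banach, second_countable_topology} \<Rightarrow>\<^sub>L 'a"
  assumes R: "rkhs (imq_kernel T) H ip" and \<beta>: "\<beta> \<ge> 1"
  shows "(\<lambda>x. integral {1..\<beta>} (\<lambda>u. exp (- u\<^sup>2 * (norm (T x - T y))\<^sup>2))) \<in> H"
proof -
  interpret rkhs "imq_kernel T" H ip by fact
  define G where "G u x y = exp (- u\<^sup>2 * (norm (T x - T y))\<^sup>2)" for u :: real and x y
  have psd: "psd_kernel (G u)" for u unfolding G_def by (rule psd_kernel_gaussian) simp
  define f where "f x = integral {1..\<beta>} (\<lambda>u. G u x y)" for x
  let ?I = "\<lambda>u. indicator {1..\<beta>} u :: real"
  have [measurable]: "(\<lambda>u. G u x y) \<in> borel_measurable borel" for x y unfolding G_def by measurable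
  have gi: "integrable lborel (\<lambda>u. ?I u * h u)" if "continuous_on {1..\<beta>} h" for h :: "real \<Rightarrow> real"
    using borel_integrable_compact[OF compact_Icc that] by (simp add: indicator_def if_distrib cong: if_cong)
  have Gc: "continuous_on S (\<lambda>u. G u x y)" for S x y unfolding G_def by (intro continuous_intros)
  have linc: "continuous_on S (\<lambda>u. lin L (g u))" if "\<And>x. continuous_on S (\<lambda>u. g u x)" for S :: "real set" and L and g :: "real \<Rightarrow> 'a \<Rightarrow> real"
    by (induction L) (auto intro!: continuous_intros that)
  have f_eq: "f x = (\<integral>u. ?I u * G u x y \<partial>lborel)" for x
    unfolding f_def using set_borel_integral_eq_integral(2)[of "{1..\<beta>}" "\<lambda>u. G u x y"] gi[OF Gc]
    by (simp add: set_integrable_def set_lebesgue_integral_def)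
  \<comment> \<open>The length of the range from Cauchy-Schwarz, the reciprocal of the smallest
    mixing weight on it, and the normalization of the mixture.\<close>
  define M where "M = (\<beta> - 1) * (exp (\<beta>\<^sup>2) * sqrt pi)"
  have "f \<in> H"
  proof (rule mem_of_bound)
    show "M \<ge> 0" using \<beta> by (simp add: M_def)
    fix L
    define h where "h u = lin L (\<lambda>x. G u x y)" for u
    define q where "q u = lin L (\<lambda>x. lin L (G u x))" for u
    have hc: "continuous_on S h" for S unfolding h_def by (intro linc Gc)
    have qc: "continuous_on S q" for S unfolding q_def by (intro linc Gc)
    have q0: "q u \<ge> 0" for u unfolding q_def by (rule psd_kernelD[OF psd])
    have hq: "(h u)\<^sup>2 \<le> q u" for u
      using psd_kernel_cauchy_schwarz[OF psd[of u], of L y] by (simp add: h_def q_def G_def norm_minus_commute)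
    have "lin L f = (\<integral>u. lin L (\<lambda>x. ?I u * G u x y) \<partial>lborel)"
      unfolding f_eq by (rule lin_integral(2)[symmetric]) (intro gi Gc)
    then have 1: "lin L f = (\<integral>u. ?I u * h u \<partial>lborel)" by (simp add: lin_cmult h_def)
    \<comment> \<open>Cauchy-Schwarz on the range, from nonnegativity of the integral of (h +
      t)^2.\<close>
    have "(\<integral>u. ?I u * h u \<partial>lborel)\<^sup>2 \<le> (\<integral>u. ?I u * (h u)\<^sup>2 \<partial>lborel) * (\<beta> - 1)"
    proof (rule quadratic_nonneg_discriminant)
      fix t
      have "0 \<le> (\<integral>u. ?I u * (h u + t)\<^sup>2 \<partial>lborel)" by (rule Bochner_Integration.integral_nonneg) simp
      also have "\<dots> = (\<integral>u. ?I u * (h u)\<^sup>2 + 2 * t * (?I u * h u) + t\<^sup>2 * ?I u \<partial>lborel)"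
        by (intro Bochner_Integration.integral_cong) (auto simp: power2_eq_square algebra_simps)
      also have "\<dots> = (\<integral>u. ?I u * (h u)\<^sup>2 \<partial>lborel) + 2 * t * (\<integral>u. ?I u * h u \<partial>lborel) + t\<^sup>2 * (\<beta> - 1)"
      proof -
        have "integrable lborel (\<lambda>u. ?I u * (h u)\<^sup>2)" "integrable lborel (\<lambda>u. ?I u * h u)"
          by (intro gi continuous_intros hc)+
        then show ?thesis using \<beta> by simp
      qed
      finally show "0 \<le> (\<integral>u. ?I u * (h u)\<^sup>2 \<partial>lborel) + 2 * t * (\<integral>u. ?I u * h u \<partial>lborel) + t\<^sup>2 * (\<beta> - 1)" .
    qed
    also have "\<dots> \<le> (exp (\<beta>\<^sup>2) * (sqrt pi * lin L (\<lambda>x. lin L (imq_kernel T x)))) * (\<beta> - 1)"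
    proof (rule mult_right_mono)
      have iq: "integrable lborel (\<lambda>u. exp (- u\<^sup>2) * q u)"
        "(\<integral>u. exp (- u\<^sup>2) * q u \<partial>lborel) = sqrt pi * lin L (\<lambda>x. lin L (imq_kernel T x))"
      proof -
        have 1: "integrable lborel (\<lambda>u. exp (- u\<^sup>2) * G u x z)"
          "(\<integral>u. exp (- u\<^sup>2) * G u x z \<partial>lborel) = sqrt pi * imq_kernel T x z" for x z
          using imq_gaussian_mixture[of "(norm (T x - T z))\<^sup>2"] by (simp_all add: G_def imq_kernel_def)
        have E: "exp (- u\<^sup>2) * q u = lin L (\<lambda>x. lin L (\<lambda>z. exp (- u\<^sup>2) * G u x z))" for u
          by (simp add: q_def lin_cmult)
        show "integrable lborel (\<lambda>u. exp (- u\<^sup>2) * q u)"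
          unfolding E by (intro lin_integral(1) 1)
        have "(\<integral>u. exp (- u\<^sup>2) * q u \<partial>lborel) = lin L (\<lambda>x. lin L (\<lambda>z. sqrt pi * imq_kernel T x z))"
          unfolding E by (simp add: lin_integral 1)
        then show "(\<integral>u. exp (- u\<^sup>2) * q u \<partial>lborel) = sqrt pi * lin L (\<lambda>x. lin L (imq_kernel T x))"
          by (simp only: lin_cmult)
      qed
      have "(\<integral>u. ?I u * (h u)\<^sup>2 \<partial>lborel) \<le> (\<integral>u. exp (\<beta>\<^sup>2) * (exp (- u\<^sup>2) * q u) \<partial>lborel)"
      proof (rule integral_mono)
        show "integrable lborel (\<lambda>u. ?I u * (h u)\<^sup>2)" by (intro gi continuous_intros hc)
        show "integrable lborel (\<lambda>u. exp (\<beta>\<^sup>2) * (exp (- u\<^sup>2) * q u))" using iq(1) by simp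
        fix u
        show "?I u * (h u)\<^sup>2 \<le> exp (\<beta>\<^sup>2) * (exp (- u\<^sup>2) * q u)"
        proof (cases "u \<in> {1..\<beta>}")
          case True
          then have "u\<^sup>2 \<le> \<beta>\<^sup>2" by (intro power_mono) auto
          then have "1 * q u \<le> exp (\<beta>\<^sup>2 - u\<^sup>2) * q u" by (intro mult_right_mono q0) simp
          with hq[of u] True show ?thesis by (simp add: exp_diff exp_minus divide_inverse mult.assoc)
        next
          case False
          then show ?thesis using q0[of u] by simp
        qed
      qed
      also have "\<dots> = exp (\<beta>\<^sup>2) * (sqrt pi * lin L (\<lambda>x. lin L (imq_kernel T x)))" using iq by simp
      finally show "(\<integral>u. ?I u * (h u)\<^sup>2 \<partial>lborel) \<le> exp (\<beta>\<^sup>2) * (sqrt pi * lin L (\<lambda>x. lin L (imq_kernel T x)))" .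
    qed (use \<beta> in simp)
    finally show "(lin L f)\<^sup>2 \<le> M * lin L (\<lambda>x. lin L (imq_kernel T x))"
      by (simp add: 1 M_def mult_ac)
  qed
  then show ?thesis by (simp add: f_def[abs_def] G_def)
qed

text \<open>Keeps the linear factor T x - T y of the Stein equation bounded under the Gaussian
  weight, as dominated convergence requires.\<close>

lemma gaussian_kernel_bound: "exp (- t\<^sup>2) * t \<le> (1::real)"
proof -
  have "t \<le> 1 + t\<^sup>2" using zero_le_power2[of "t - 1"] zero_le_power2[of "t + 1"]
    by (simp add: power2_eq_square algebra_simps)
  also have "\<dots> \<le> exp (t\<^sup>2)" by (rule exp_ge_add_one_self)
  finally show ?thesis by (simp add: exp_minus field_simps)
qed

text \<open>By the fundamental theorem of calculus, the normalized integral over the shrinking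
  interval from 1 tends to the integrand at u = 1. The bounds are uniform in n; the 4 bounds u^2, as
  \<beta> n \<le> 2.\<close>

lemma imq_limit:
  fixes r :: real
  assumes r: "r \<ge> 0" and \<beta>: "\<beta> = (\<lambda>n. 1 + 1 / real (Suc n))"
  defines "\<psi> \<equiv> \<lambda>n r. integral {1..\<beta> n} (\<lambda>u. exp (- u\<^sup>2 * r))"
    and "\<psi>' \<equiv> \<lambda>n r. integral {1..\<beta> n} (\<lambda>u. - u\<^sup>2 * exp (- u\<^sup>2 * r))"
  shows "DERIV (\<psi> n) r :> \<psi>' n r"
    "(\<lambda>n. real (Suc n) * \<psi> n r) \<longlonglongrightarrow> exp (- r)" "(\<lambda>n. real (Suc n) * \<psi>' n r) \<longlonglongrightarrow> - exp (- r)"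
    "\<bar>real (Suc n) * \<psi> n r\<bar> \<le> exp (- r)" "\<bar>real (Suc n) * \<psi>' n r\<bar> \<le> 4 * exp (- r)"
proof -
  have \<beta>1: "\<beta> n \<ge> 1" "\<beta> n \<le> 2" for n unfolding \<beta> by (auto simp: field_simps)
  have "((\<lambda>r. integral (cbox 1 (\<beta> n)) (\<lambda>u. exp (- u\<^sup>2 * r))) has_field_derivative
      integral (cbox 1 (\<beta> n)) (\<lambda>u. - u\<^sup>2 * exp (- u\<^sup>2 * r))) (at r within UNIV)"
  proof (rule leibniz_rule_field_derivative)
    show "((\<lambda>r. exp (- t\<^sup>2 * r)) has_field_derivative - t\<^sup>2 * exp (- t\<^sup>2 * x)) (at x within UNIV)" for x t
      by (auto intro!: derivative_eq_intros)
    show "(\<lambda>u. exp (- u\<^sup>2 * x)) integrable_on cbox 1 (\<beta> n)" for x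
      by (intro integrable_continuous continuous_intros)
    show "continuous_on (UNIV \<times> cbox 1 (\<beta> n)) (\<lambda>(x, t). - t\<^sup>2 * exp (- t\<^sup>2 * x))"
      unfolding split_beta by (intro continuous_intros)
  qed auto
  then show "DERIV (\<psi> n) r :> \<psi>' n r" by (simp add: \<psi>_def \<psi>'_def)
  have lim: "(\<lambda>n. real (Suc n) * integral {1..\<beta> n} g) \<longlonglongrightarrow> g 1" if g: "continuous_on {1..2} g" for g :: "real \<Rightarrow> real"
  proof -
    have "((\<lambda>b. integral {1..b} g) has_vector_derivative g 1) (at 1 within {1..2})"
      by (rule integral_has_vector_derivative[OF g]) simp
    then have "((\<lambda>b. integral {1..b} g) has_field_derivative g 1) (at 1 within {1..2})"
      by (simp add: has_real_derivative_iff_has_vector_derivative)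
    then have "((\<lambda>b. (integral {1..b} g - integral {1..1} g) / (b - 1)) \<longlongrightarrow> g 1) (at 1 within {1..2})"
      by (simp add: has_field_derivative_iff)
    moreover have "filterlim \<beta> (at 1 within {1..2}) sequentially"
      unfolding filterlim_at
    proof
      have "(\<lambda>n. 1 + inverse (real (Suc n))) \<longlonglongrightarrow> 1 + 0" by (intro tendsto_intros LIMSEQ_inverse_real_of_nat)
      then show "\<beta> \<longlonglongrightarrow> 1" by (simp add: \<beta> inverse_eq_divide)
      show "eventually (\<lambda>n. \<beta> n \<in> {1..2} \<and> \<beta> n \<noteq> 1) sequentially"
        using \<beta>1 by (intro always_eventually) (auto simp: \<beta>)
    qed
    ultimately have "(\<lambda>n. (integral {1..\<beta> n} g - integral {1..1} g) / (\<beta> n - 1)) \<longlonglongrightarrow> g 1"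
      by (rule filterlim_compose)
    then show ?thesis by (simp add: \<beta> mult.commute)
  qed
  show "(\<lambda>n. real (Suc n) * \<psi> n r) \<longlonglongrightarrow> exp (- r)"
  proof -
    have "continuous_on {1..2} (\<lambda>u. exp (- u\<^sup>2 * r))" by (intro continuous_intros)
    from lim[OF this] show ?thesis by (simp add: \<psi>_def)
  qed
  show "(\<lambda>n. real (Suc n) * \<psi>' n r) \<longlonglongrightarrow> - exp (- r)"
  proof -
    have "continuous_on {1..2} (\<lambda>u. - u\<^sup>2 * exp (- u\<^sup>2 * r))" by (intro continuous_intros)
    from lim[OF this] show ?thesis by (simp add: \<psi>'_def)
  qed
  have bound: "\<bar>real (Suc n) * integral {1..\<beta> n} g\<bar> \<le> B"
    if g: "continuous_on {1..\<beta> n} g" "\<And>u. u \<in> {1..\<beta> n} \<Longrightarrow> \<bar>g u\<bar> \<le> B" for g B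
  proof -
    have "norm (integral {1..\<beta> n} g) \<le> B * (\<beta> n - 1)"
      by (rule integral_bound) (use \<beta>1 g in auto)
    then have "\<bar>integral {1..\<beta> n} g\<bar> \<le> B / real (Suc n)" by (simp add: \<beta>)
    then have "real (Suc n) * \<bar>integral {1..\<beta> n} g\<bar> \<le> real (Suc n) * (B / real (Suc n))"
      by (intro mult_left_mono) auto
    then show ?thesis by (simp add: abs_mult)
  qed
  have e: "exp (- u\<^sup>2 * r) \<le> exp (- r)" if "u \<in> {1..\<beta> n}" for u
  proof -
    have "1\<^sup>2 \<le> u\<^sup>2" using that by (intro power_mono) auto
    then have "1 * r \<le> u\<^sup>2 * r" using r by (intro mult_right_mono) auto
    then show ?thesis by simp
  qed
  show "\<bar>real (Suc n) * \<psi> n r\<bar> \<le> exp (- r)"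
    unfolding \<psi>_def by (rule bound) (use e in \<open>auto intro!: continuous_intros\<close>)
  show "\<bar>real (Suc n) * \<psi>' n r\<bar> \<le> 4 * exp (- r)"
    unfolding \<psi>'_def
  proof (rule bound)
    fix u assume u: "u \<in> {1..\<beta> n}"
    have "u\<^sup>2 \<le> 2\<^sup>2" using u \<beta>1(2)[of n] by (intro power_mono) auto
    then have "u\<^sup>2 * exp (- u\<^sup>2 * r) \<le> 4 * exp (- r)" using e[OF u] by (intro mult_mono) auto
    then show "\<bar>- u\<^sup>2 * exp (- u\<^sup>2 * r)\<bar> \<le> 4 * exp (- r)" by (simp add: abs_mult)
  qed (auto intro!: continuous_intros)
qed

text \<open>
  For the inverse multiquadric the Gaussian kernel itself is not in the RKHS, but it is the
  limit of the normalized averages of Gaussian kernels over shrinking ranges of the bandwidth,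
  which are.
\<close>

lemma ksd_zero_gaussian:
  fixes C T :: "'a::{real_inner, banach, second_countable_topology} \<Rightarrow>\<^sub>L 'a"
  assumes R: "rkhs k H ip" and k: "k = se_kernel T \<or> k = imq_kernel T" and ksd: "ksd C U H ip Q = 0"
    and C: "nonneg_symmetric C" and e: "complete_onseq e" and Ce: "\<And>i. C (e i) = l i *\<^sub>R e i"
    and Q: "prob_space Q" and sQ[measurable_cong, simp]: "sets Q = sets borel"
    and b: "\<And>i. integrable Q (\<lambda>x. inner x (e i) + l i * inner (e i) (gradient U x))"
  obtains s where "s > 0"
    "\<And>i y. (\<integral>x. (- 2 * s * l i * inner (T x - T y) (T (e i)) - (inner x (e i) + l i * inner (e i) (gradient U x)))
        * exp (- s * (norm (T x - T y))\<^sup>2) \<partial>Q) = 0"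
proof -
  interpret Q: prob_space Q by fact
  have [measurable]: "blinfun_apply T \<in> borel_measurable borel"
    by (intro borel_measurable_continuous_onI continuous_intros)
  show thesis using k
  proof
    assume k: "k = se_kernel T"
    interpret rkhs k H ip by fact
    show thesis
    \<comment> \<open>The exponent of \<open>se_kernel\<close> itself.\<close>
    proof (rule that[of "1 / 2"])
      fix i y
      let ?\<psi> = "\<lambda>r. exp (- (1 / 2) * r)"
      have "(\<lambda>x. ?\<psi> ((norm (T x - T y))\<^sup>2)) \<in> H"
        using kernel_mem[of y] by (simp add: k se_kernel_def)
      moreover have "DERIV ?\<psi> r :> - (1 / 2) * ?\<psi> r" for r
        by (auto intro!: derivative_eq_intros)
      ultimately have "(\<integral>x. 2 * (- (1 / 2) * ?\<psi> ((norm (T x - T y))\<^sup>2)) * l i * inner (T x - T y) (T (e i))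
        - ?\<psi> ((norm (T x - T y))\<^sup>2) * (inner x (e i) + l i * inner (e i) (gradient U x)) \<partial>Q) = 0"
        by (rule ksd_zero_radial[OF R ksd C Ce])
      moreover have "2 * (- (1 / 2) * E) * l i * a - E * d = (- 2 * (1 / 2) * l i * a - d) * E" for E a d :: real
        by (simp add: algebra_simps)
      ultimately show "(\<integral>x. (- 2 * (1 / 2) * l i * inner (T x - T y) (T (e i)) - (inner x (e i) + l i * inner (e i) (gradient U x)))
        * exp (- (1 / 2) * (norm (T x - T y))\<^sup>2) \<partial>Q) = 0" by (simp only:)
    qed simp
  next
    assume k: "k = imq_kernel T"
    show thesis
    \<comment> \<open>The averages concentrate at u = 1, which gives s = 1.\<close>
    proof (rule that[of 1])
      fix i y
      let ?b = "\<lambda>x. inner x (e i) + l i * inner (e i) (gradient U x)" and ?r = "\<lambda>x. (norm (T x - T y))\<^sup>2"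
      have [measurable]: "?b \<in> borel_measurable borel"
        using borel_measurable_integrable[OF b[of i]] by (simp cong: measurable_cong_sets)
      define \<beta> where "\<beta> n = 1 + 1 / real (Suc n)" for n
      define \<psi> where "\<psi> n r = integral {1..\<beta> n} (\<lambda>u. exp (- u\<^sup>2 * r))" for n r
      define \<psi>' where "\<psi>' n r = integral {1..\<beta> n} (\<lambda>u. - u\<^sup>2 * exp (- u\<^sup>2 * r))" for n r
      have \<beta>: "\<beta> = (\<lambda>n. 1 + 1 / real (Suc n))" by (rule ext) (rule \<beta>_def)
      note L = imq_limit[OF _ \<beta>, folded \<psi>_def \<psi>'_def]
      let ?F = "\<lambda>n x. 2 * \<psi>' n (?r x) * l i * inner (T x - T y) (T (e i)) - \<psi> n (?r x) * ?b x"
      let ?F' = "\<lambda>x. 2 * (- exp (- ?r x)) * l i * inner (T x - T y) (T (e i)) - exp (- ?r x) * ?b x"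
      have Z: "(\<integral>x. ?F n x \<partial>Q) = 0" for n
      proof (rule ksd_zero_radial[OF R ksd C Ce])
        show "(\<lambda>x. \<psi> n (?r x)) \<in> H" unfolding \<psi>_def
          by (rule imq_mem[OF R[unfolded k]]) (simp add: \<beta>_def)
        show "DERIV (\<psi> n) r :> \<psi>' n r" if "r \<ge> 0" for r using L(1)[OF that] by simp
      qed
      have lim: "(\<lambda>n. real (Suc n) * ?F n x) \<longlonglongrightarrow> ?F' x" for x
      proof -
        have "(\<lambda>n. 2 * (real (Suc n) * \<psi>' n (?r x)) * l i * inner (T x - T y) (T (e i)) - real (Suc n) * \<psi> n (?r x) * ?b x) \<longlonglongrightarrow> ?F' x"
          by (intro tendsto_intros L(2,3)) auto
        then show ?thesis by (simp add: algebra_simps)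
      qed
      have m\<psi>: "(\<lambda>x. \<psi> n (?r x)) \<in> borel_measurable borel" for n
      proof (rule borel_measurable_continuous_onI, rule continuous_at_imp_continuous_on, rule ballI)
        fix x
        have "((\<lambda>x. \<psi> n (?r x)) has_derivative (\<lambda>h. inner h ((2 * \<psi>' n (?r x)) *\<^sub>R adjoint T (T x - T y)))) (at x)"
          by (rule radial_has_derivative) (use L(1) in simp)
        then show "isCont (\<lambda>x. \<psi> n (?r x)) x" by (rule has_derivative_continuous)
      qed
      have m\<psi>': "(\<lambda>x. \<psi>' n (?r x)) \<in> borel_measurable borel" for n
      proof -
        have "continuous_on UNIV (\<lambda>r. integral (cbox 1 (\<beta> n)) (\<lambda>u. - u\<^sup>2 * exp (- u\<^sup>2 * r)))"
          by (rule integral_continuous_on_param) (auto simp: split_beta intro!: continuous_intros)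
        then have [measurable]: "\<psi>' n \<in> borel_measurable borel"
          by (intro borel_measurable_continuous_onI) (simp add: \<psi>'_def[abs_def])
        show ?thesis by measurable
      qed
      note [measurable] = m\<psi> m\<psi>'
      have "(\<lambda>n. \<integral>x. real (Suc n) * ?F n x \<partial>Q) \<longlonglongrightarrow> (\<integral>x. ?F' x \<partial>Q)"
      proof (rule integral_dominated_convergence)
        \<comment> \<open>The 8 is the factor 2 of the radial derivative times the bound 4 of
          \<open>imq_limit\<close>; the Gaussian absorbs |T x - T y|.\<close>
        show "integrable Q (\<lambda>x. 8 * \<bar>l i\<bar> * norm (T (e i)) + \<bar>?b x\<bar>)" using b[of i] by auto
        show "AE x in Q. (\<lambda>n. real (Suc n) * ?F n x) \<longlonglongrightarrow> ?F' x" using lim by simp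
        fix n
        show "AE x in Q. norm (real (Suc n) * ?F n x) \<le> 8 * \<bar>l i\<bar> * norm (T (e i)) + \<bar>?b x\<bar>"
        proof (rule AE_I2)
          fix x
          let ?p = "real (Suc n) * \<psi>' n (?r x)" and ?q = "real (Suc n) * \<psi> n (?r x)"
          have "\<bar>?p\<bar> * \<bar>inner (T x - T y) (T (e i))\<bar> \<le> (4 * exp (- ?r x)) * (norm (T x - T y) * norm (T (e i)))"
            by (intro mult_mono L(5) Cauchy_Schwarz_ineq2) auto
          also have "\<dots> = 4 * norm (T (e i)) * (exp (- (norm (T x - T y))\<^sup>2) * norm (T x - T y))" by simp
          also have "\<dots> \<le> 4 * norm (T (e i)) * 1" by (intro mult_left_mono gaussian_kernel_bound) auto
          finally have 1: "2 * \<bar>l i\<bar> * (\<bar>?p\<bar> * \<bar>inner (T x - T y) (T (e i))\<bar>) \<le> 2 * \<bar>l i\<bar> * (4 * norm (T (e i)))"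
            by (intro mult_left_mono) auto
          have "\<bar>?q\<bar> \<le> 1" using L(4)[of "?r x" n] by (intro order_trans[of "\<bar>?q\<bar>" "exp (- ?r x)" 1]) auto
          then have 2: "\<bar>?q\<bar> * \<bar>?b x\<bar> \<le> 1 * \<bar>?b x\<bar>" by (intro mult_right_mono) auto
          have "real (Suc n) * ?F n x = 2 * l i * (?p * inner (T x - T y) (T (e i))) - ?q * ?b x"
            by (simp only: right_diff_distrib mult_ac)
          then have "norm (real (Suc n) * ?F n x) \<le> 2 * \<bar>l i\<bar> * (\<bar>?p\<bar> * \<bar>inner (T x - T y) (T (e i))\<bar>) + \<bar>?q\<bar> * \<bar>?b x\<bar>"
            by (simp only: real_norm_def) (rule order_trans[OF abs_triangle_ineq4], simp only: abs_mult abs_numeral order_refl)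
          also have "\<dots> \<le> 2 * \<bar>l i\<bar> * (4 * norm (T (e i))) + 1 * \<bar>?b x\<bar>" by (rule add_mono[OF 1 2])
          finally show "norm (real (Suc n) * ?F n x) \<le> 8 * \<bar>l i\<bar> * norm (T (e i)) + \<bar>?b x\<bar>" by simp
        qed
      qed measurable
      then have "(\<integral>x. ?F' x \<partial>Q) = 0" by (simp add: Z LIMSEQ_const_iff)
      moreover have "2 * (- E) * l i * a - E * d = (- 2 * 1 * l i * a - d) * E" for E a d :: real
        by (simp add: algebra_simps)
      ultimately show "(\<integral>x. (- 2 * 1 * l i * inner (T x - T y) (T (e i)) - ?b x) * exp (- 1 * ?r x) \<partial>Q) = 0"
        by simp
    qed simp
  qed
qed

section \<open>Gaussian integration by parts\<close>

lemma gaussian_inner_integral: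
  fixes h :: "real \<Rightarrow> real"
  assumes N: "centred_gaussian C N" and v: "inner (C e) e = l" "l > 0" and [measurable]: "h \<in> borel_measurable borel"
  shows "integrable N (\<lambda>z. h (inner z e)) \<longleftrightarrow> integrable lborel (\<lambda>t. normal_density 0 (sqrt l) t * h t)"
    "(\<integral>z. h (inner z e) \<partial>N) = (\<integral>t. normal_density 0 (sqrt l) t * h t \<partial>lborel)"
proof -
  have [measurable_cong, simp]: "sets N = sets borel" using N by (simp add: centred_gaussian_def)
  have [measurable]: "(\<lambda>x. inner x e) \<in> borel_measurable borel" 
    by (intro borel_measurable_continuous_onI continuous_intros)
  have d: "distr N borel (\<lambda>x. inner x e) = density lborel (normal_density 0 (sqrt l))"
    using N v by (simp add: centred_gaussian_def normal_law_def)
  have "integrable N (\<lambda>z. h (inner z e)) \<longleftrightarrow> integrable (distr N borel (\<lambda>x. inner x e)) h"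
    by (subst integrable_distr_eq) auto
  also have "\<dots> \<longleftrightarrow> integrable lborel (\<lambda>t. normal_density 0 (sqrt l) t * h t)"
    unfolding d by (subst integrable_density) auto
  finally show "integrable N (\<lambda>z. h (inner z e)) \<longleftrightarrow> integrable lborel (\<lambda>t. normal_density 0 (sqrt l) t * h t)" .
  have "(\<integral>z. h (inner z e) \<partial>N) = (\<integral>t. h t \<partial>distr N borel (\<lambda>x. inner x e))"
    by (subst integral_distr) auto
  also have "\<dots> = (\<integral>t. normal_density 0 (sqrt l) t * h t \<partial>lborel)"
    unfolding d by (subst integral_density) auto
  finally show "(\<integral>z. h (inner z e) \<partial>N) = (\<integral>t. normal_density 0 (sqrt l) t * h t \<partial>lborel)" .
qed

text \<open>Resampling turns the integral into an average over lines of one-dimensional Gaussian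
  integrals. On almost every line the integrand is \<open>l\<close> times the derivative of the
  normal density times f, and \<open>integral_deriv_zero\<close> applies.\<close>

lemma gaussian_integration_by_parts:
  fixes C :: "'a::{real_inner, banach, second_countable_topology} \<Rightarrow>\<^sub>L 'a"
  assumes N: "centred_gaussian C N" and C: "nonneg_symmetric C"
    and e: "norm e = 1" and Ce: "C e = l *\<^sub>R e" and l: "l > 0"
    and [measurable]: "f \<in> borel_measurable borel" "f' \<in> borel_measurable borel"
    and D: "\<And>x. ((\<lambda>s. f (x + s *\<^sub>R e)) has_real_derivative f' x) (at 0)"
    and i: "integrable N f" and i': "integrable N (\<lambda>x. l * f' x - f x * inner x e)"
  shows "(\<integral>x. l * f' x - f x * inner x e \<partial>N) = 0"
proof -
  have [measurable_cong, simp]: "sets N = sets borel" and "prob_space N"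
    using N by (simp_all add: centred_gaussian_def)
  interpret N: prob_space N by fact
  interpret NN: pair_prob_space N N ..
  have ee: "inner e e = 1" using e by (simp add: norm_eq_1)
  let ?F = "\<lambda>x. l * f' x - f x * inner x e" and ?nd = "normal_density 0 (sqrt l)"
  note rs = gaussian_resample[OF N C disjI1[OF e] Ce]
  have tr: "integrable (N \<Otimes>\<^sub>M N) (\<lambda>(x, z). g (resample e x z))"
    "(\<integral>x. g x \<partial>N) = (\<integral>x. (\<integral>z. g (resample e x z) \<partial>N) \<partial>N)"
    if g: "integrable N g" and [measurable]: "g \<in> borel_measurable borel" for g :: "'a \<Rightarrow> real"
  proof -
    have "integrable (distr (N \<Otimes>\<^sub>M N) borel (\<lambda>(x, z). resample e x z)) g" using g by (simp only: rs)
    then show i: "integrable (N \<Otimes>\<^sub>M N) (\<lambda>(x, z). g (resample e x z))"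
      by (subst (asm) integrable_distr_eq) (auto simp: case_prod_beta')
    have "(\<integral>x. g x \<partial>N) = (\<integral>x. g x \<partial>distr (N \<Otimes>\<^sub>M N) borel (\<lambda>(x, z). resample e x z))" by (simp only: rs)
    also have "\<dots> = (\<integral>(x, z). g (resample e x z) \<partial>(N \<Otimes>\<^sub>M N))"
      by (subst integral_distr) (auto simp: case_prod_beta')
    also have "\<dots> = (\<integral>x. (\<integral>z. g (resample e x z) \<partial>N) \<partial>N)" by (rule NN.integral_fst[OF i, symmetric])
    finally show "(\<integral>x. g x \<partial>N) = (\<integral>x. (\<integral>z. g (resample e x z) \<partial>N) \<partial>N)" .
  qed
  have "AE x in N. integrable N (\<lambda>z. f (resample e x z))"
    by (rule NN.AE_integrable_fst[OF tr(1)[OF i]]) simp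
  moreover have "AE x in N. integrable N (\<lambda>z. ?F (resample e x z))"
    by (rule NN.AE_integrable_fst[OF tr(1)[OF i']]) simp
  ultimately have "AE x in N. (\<integral>z. ?F (resample e x z) \<partial>N) = 0"
  proof eventually_elim
    case (elim x)
    define y where "y = x - inner x e *\<^sub>R e"
    have rs: "resample e x z = y + inner z e *\<^sub>R e" for z by (simp add: resample_def y_def)
    have ye: "inner (y + t *\<^sub>R e) e = t" for t by (simp add: y_def inner_add_left inner_diff_left ee)
    let ?G = "\<lambda>t. f (y + t *\<^sub>R e)" and ?G' = "\<lambda>t. f' (y + t *\<^sub>R e)"
    have cl: "inner (C e) e = l" by (simp add: Ce ee)
    note gi = gaussian_inner_integral[OF N cl l]
    have iG: "integrable lborel (\<lambda>t. ?nd t * ?G t)"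
      using elim(1) unfolding rs by (subst (asm) gi(1)[where h = ?G]) auto
    have iG': "integrable lborel (\<lambda>t. ?nd t * (l * ?G' t - ?G t * t))"
      using elim(2) unfolding rs ye by (subst (asm) gi(1)[where h = "\<lambda>t. l * ?G' t - ?G t * t"]) auto
    have dG: "DERIV ?G t :> ?G' t" for t
      using D[of "y + t *\<^sub>R e"] by (simp add: DERIV_def scaleR_add_left add.assoc)
    have dnd: "DERIV ?nd t :> - (t / l) * ?nd t" for t
      unfolding normal_density_def using l by (auto intro!: derivative_eq_intros simp: field_simps)
    have "(\<integral>t. (1 / l) * (?nd t * (l * ?G' t - ?G t * t)) \<partial>lborel) = 0"
    proof (rule integral_deriv_zero)
      show "DERIV (\<lambda>t. ?nd t * ?G t) t :> (1 / l) * (?nd t * (l * ?G' t - ?G t * t))" for t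
        using DERIV_mult[OF dnd dG, of t] l by (simp add: field_simps)
    qed (use iG iG' in auto)
    then have "(\<integral>t. ?nd t * (l * ?G' t - ?G t * t) \<partial>lborel) = 0" using l by simp
    then show ?case unfolding rs ye by (subst gi(2)[where h = "\<lambda>t. l * ?G' t - ?G t * t"]) auto
  qed
  then have "(\<integral>x. (\<integral>z. ?F (resample e x z) \<partial>N) \<partial>N) = 0" by (rule integral_eq_zero_AE)
  then show ?thesis by (subst tr(2)[OF i']) simp_all
qed

text \<open>The Gaussian formula is applied to phi exp(-U), whose derivative supplies the gradient
  term. Integrability is checked under \<open>P\<close>, where phi and its derivative along
  \<open>e\<close> are bounded and the drift is integrable.\<close>

lemma gibbs_integration_by_parts:
  fixes C :: "'a::{real_inner, banach, second_countable_topology} \<Rightarrow>\<^sub>L 'a"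
  assumes N: "centred_gaussian C N" and C: "nonneg_symmetric C"
    and e: "norm e = 1 \<or> e = 0" and Ce: "C e = l *\<^sub>R e" and l: "l \<ge> 0"
    and U: "\<And>x. U differentiable (at x)"
    and P: "prob_space P" "Z > 0" "P = density N (\<lambda>x. ennreal (exp (- U x) / Z))"
    and b: "integrable P (\<lambda>x. inner x e + l * inner e (gradient U x))"
    and D: "\<And>x. (\<phi> has_derivative D x) (at x)" and B: "\<And>x. \<bar>\<phi> x\<bar> \<le> B" "\<And>x. \<bar>D x e\<bar> \<le> B'"
  shows "integrable P (\<lambda>x. l * D x e - \<phi> x * (inner x e + l * inner e (gradient U x)))"
    "(\<integral>x. l * D x e - \<phi> x * (inner x e + l * inner e (gradient U x)) \<partial>P) = 0"
proof -
  have sN[measurable_cong, simp]: "sets N = sets borel" using N by (simp add: centred_gaussian_def)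
  have sP[measurable_cong, simp]: "sets P = sets borel" using P(3) by simp
  interpret P: prob_space P by fact
  have cont: "continuous_on UNIV f" if "\<And>x. (f has_derivative F x) (at x)" for f :: "'a \<Rightarrow> real" and F
    using that by (intro continuous_at_imp_continuous_on ballI has_derivative_continuous)
  have [measurable]: "\<phi> \<in> borel_measurable borel" by (intro borel_measurable_continuous_onI cont[OF D])
  have [measurable]: "U \<in> borel_measurable borel"
    by (intro borel_measurable_continuous_onI cont[OF GDERIV_gradient[OF U]])
  have [measurable]: "(\<lambda>x. D x e) \<in> borel_measurable borel" by (rule directional_derivative_measurable) (rule D)
  have [measurable]: "(\<lambda>x. inner e (gradient U x)) \<in> borel_measurable borel"
    by (rule directional_derivative_measurable[OF GDERIV_gradient[OF U]])
  let ?b = "\<lambda>x. inner x e + l * inner e (gradient U x)"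
  show i: "integrable P (\<lambda>x. l * D x e - \<phi> x * ?b x)"
  proof (rule Bochner_Integration.integrable_diff)
    have "integrable P (\<lambda>x. D x e)" by (rule P.integrable_const_bound[where B = B']) (use B in auto)
    then show "integrable P (\<lambda>x. l * D x e)" by simp
    show "integrable P (\<lambda>x. \<phi> x * ?b x)"
    proof (rule Bochner_Integration.integrable_bound)
      show "integrable P (\<lambda>x. B * ?b x)" using b by simp
      have "\<bar>\<phi> x\<bar> * \<bar>?b x\<bar> \<le> \<bar>B\<bar> * \<bar>?b x\<bar>" for x using B(1)[of x] by (intro mult_right_mono) auto
      then show "AE x in P. norm (\<phi> x * ?b x) \<le> norm (B * ?b x)" by (simp add: abs_mult)
    qed measurable
  qed
  have dens: "integrable P g \<longleftrightarrow> integrable N (\<lambda>x. g x * exp (- U x))"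
    "(\<integral>x. g x \<partial>P) = (\<integral>x. g x * exp (- U x) \<partial>N) / Z"
    if [measurable]: "g \<in> borel_measurable borel" for g :: "'a \<Rightarrow> real"
  proof -
    have "integrable P g \<longleftrightarrow> integrable N (\<lambda>x. (1 / Z) * (g x * exp (- U x)))"
      unfolding P(3) using P(2) by (subst integrable_density) (auto simp: mult.commute)
    also have "\<dots> \<longleftrightarrow> integrable N (\<lambda>x. g x * exp (- U x))"
    proof
      assume "integrable N (\<lambda>x. (1 / Z) * (g x * exp (- U x)))"
      then have "integrable N (\<lambda>x. Z * ((1 / Z) * (g x * exp (- U x))))" by (rule integrable_mult_right)
      then show "integrable N (\<lambda>x. g x * exp (- U x))" using P(2) by simp
    qed (rule integrable_mult_right)
    finally show "integrable P g \<longleftrightarrow> integrable N (\<lambda>x. g x * exp (- U x))" .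
    have "(\<integral>x. g x \<partial>P) = (\<integral>x. (1 / Z) * (g x * exp (- U x)) \<partial>N)"
      unfolding P(3) using P(2) by (subst integral_density) (auto simp: mult.commute)
    then show "(\<integral>x. g x \<partial>P) = (\<integral>x. g x * exp (- U x) \<partial>N) / Z" by simp
  qed
  show "(\<integral>x. l * D x e - \<phi> x * ?b x \<partial>P) = 0"
  proof (cases "e = 0")
    case True
    have "D x 0 = 0" for x using D[of x] by (metis has_derivative_bounded_linear bounded_linear.linear linear_0)
    then show ?thesis using True by simp
  next
    case False
    with e have e1: "norm e = 1" by simp
    show ?thesis
    proof (cases "l = 0")
      case True
      \<comment> \<open>With l = 0 only the coordinate along \<open>e\<close> remains, and it
        vanishes almost surely.\<close>
      have "AE x in N. inner x e = 0" by (rule degenerate_gaussian_direction[OF N]) (simp add: Ce True)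
      then have "AE x in P. inner x e = 0" unfolding P(3) by (subst AE_density) auto
      then have "AE x in P. l * D x e - \<phi> x * ?b x = 0" by eventually_elim (simp add: True)
      then show ?thesis by (rule integral_eq_zero_AE)
    next
      case False
      with l have l: "l > 0" by simp
      let ?f = "\<lambda>x. \<phi> x * exp (- U x)" and ?f' = "\<lambda>x. (D x e - \<phi> x * inner e (gradient U x)) * exp (- U x)"
      have eq: "l * ?f' x - ?f x * inner x e = (l * D x e - \<phi> x * ?b x) * exp (- U x)" for x
        by (simp add: algebra_simps)
      have "(\<integral>x. l * ?f' x - ?f x * inner x e \<partial>N) = 0"
      proof (rule gaussian_integration_by_parts[OF N C e1 Ce l])
        show "((\<lambda>s. ?f (x + s *\<^sub>R e)) has_real_derivative ?f' x) (at 0)" for x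
        proof -
          have 1: "((\<lambda>s. \<phi> (x + s *\<^sub>R e)) has_real_derivative D x e) (at 0)"
            by (rule has_derivative_along_line) (use D in simp)
          have 2: "((\<lambda>s. U (x + s *\<^sub>R e)) has_real_derivative inner e (gradient U x)) (at 0)"
            by (rule has_derivative_along_line) (use GDERIV_gradient[OF U] in simp)
          show ?thesis
            by (rule derivative_eq_intros 1 2 refl)+ (simp add: algebra_simps)
        qed
        show "integrable N ?f"
          by (subst dens(1)[symmetric], simp, rule P.integrable_const_bound[where B = B]) (use B in auto)
        show "integrable N (\<lambda>x. l * ?f' x - ?f x * inner x e)"
          unfolding eq by (subst dens(1)[symmetric]) (use i in auto)
      qed measurable
      then show ?thesis unfolding eq by (subst dens(2)) auto
    qed
  qed
qed

section \<open>Regularity of the RKHS and the Stein identity\<close>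

text \<open>Dyadic difference quotients form a Cauchy sequence, their limit is additive by the bound
  on mixed second differences, and the remainder is quadratic. The criterion yields the derivative
  of a vector-valued \<open>F\<close> from norm estimates alone.\<close>

lemma bounded_second_differences_differentiable:
  fixes F :: "'a::real_normed_vector \<Rightarrow> 'b::banach"
  assumes lip: "\<And>x h. norm (F (x + h) - F x) \<le> L * norm h"
    and sec: "\<And>x h g. norm (F (x + h + g) - F (x + h) - F (x + g) + F x) \<le> M * ((norm h)\<^sup>2 + (norm g)\<^sup>2)"
  obtains A where "(F has_derivative A) (at x)" "\<And>h. norm (A h) \<le> L * norm h"
proof -
  define a where "a n h = 2 ^ n *\<^sub>R (F (x + (1 / 2 ^ n) *\<^sub>R h) - F x)" for n :: nat and h
  have step: "norm (a (Suc n) h - a n h) \<le> M * (norm h)\<^sup>2 * (1 / 2) ^ Suc n" for n h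
  proof -
    \<comment> \<open>Halving the step changes the quotient by a second difference with both
      increments equal to the half step.\<close>
    let ?h = "(1 / 2 ^ Suc n) *\<^sub>R h"
    have hh: "(1 / 2 ^ n) *\<^sub>R h = ?h + ?h" by (simp flip: scaleR_add_left)
    have "a (Suc n) h - a n h = - (2 ^ n *\<^sub>R (F (x + ?h + ?h) - F (x + ?h) - F (x + ?h) + F x))"
      unfolding a_def hh by (simp add: algebra_simps scaleR_2[symmetric] flip: scaleR_add_left)
    then have "norm (a (Suc n) h - a n h) = 2 ^ n * norm (F (x + ?h + ?h) - F (x + ?h) - F (x + ?h) + F x)"
      by simp
    also have "\<dots> \<le> 2 ^ n * (M * ((norm ?h)\<^sup>2 + (norm ?h)\<^sup>2))" by (intro mult_left_mono sec) simp
    also have "\<dots> = M * (norm h)\<^sup>2 * (1 / 2) ^ Suc n"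
      by (simp add: power_mult_distrib power_divide field_simps power2_eq_square)
    finally show ?thesis .
  qed
  have gsum: "(\<lambda>n. M * (norm h)\<^sup>2 * (1 / 2) ^ Suc n) sums (M * (norm h)\<^sup>2 * 1)" for h
    by (intro sums_mult power_half_series)
  have sm: "summable (\<lambda>n. norm (a (Suc n) h - a n h))" for h
    by (rule summable_comparison_test'[OF sums_summable[OF gsum[of h]], of 0]) (use step[of _ h] in auto)
  define A where "A h = a 0 h + (\<Sum>n. a (Suc n) h - a n h)" for h
  have lim: "(\<lambda>n. a n h) \<longlonglongrightarrow> A h" for h
  proof -
    have "(\<lambda>n. a 0 h + (\<Sum>i<n. a (Suc i) h - a i h)) \<longlonglongrightarrow> A h"
      unfolding A_def by (intro tendsto_intros summable_LIMSEQ summable_norm_cancel[OF sm])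
    moreover have "a 0 h + (\<Sum>i<n. a (Suc i) h - a i h) = a n h" for n
      using sum_lessThan_telescope[of "\<lambda>i. a i h" n] by (simp add: algebra_simps)
    ultimately show ?thesis by simp
  qed
  have near: "norm (F (x + h) - F x - A h) \<le> M * (norm h)\<^sup>2" for h
  proof -
    have "F (x + h) - F x - A h = - (\<Sum>n. a (Suc n) h - a n h)" by (simp add: A_def a_def)
    then have "norm (F (x + h) - F x - A h) \<le> (\<Sum>n. norm (a (Suc n) h - a n h))"
      using summable_norm[OF sm] by simp
    also have "\<dots> \<le> (\<Sum>n. M * (norm h)\<^sup>2 * (1 / 2) ^ Suc n)"
      by (rule suminf_le[OF step sm sums_summable[OF gsum]])
    also have "\<dots> = M * (norm h)\<^sup>2" using sums_unique[OF gsum[of h]] by simp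
    finally show ?thesis .
  qed
  have bd: "norm (A h) \<le> L * norm h" for h
  proof (rule Lim_bounded[OF tendsto_norm[OF lim], of 0], intro allI impI)
    fix n
    have "norm (a n h) = 2 ^ n * norm (F (x + (1 / 2 ^ n) *\<^sub>R h) - F x)" by (simp add: a_def)
    also have "\<dots> \<le> 2 ^ n * (L * norm ((1 / 2 ^ n) *\<^sub>R h))" by (intro mult_left_mono lip) simp
    finally show "norm (a n h) \<le> L * norm h" by simp
  qed
  have add: "A (h + g) = A h + A g" for h g
  proof -
    have "(\<lambda>n. a n (h + g) - a n h - a n g) \<longlonglongrightarrow> 0"
    proof (rule Lim_null_comparison)
      show "\<forall>\<^sub>F n in sequentially. norm (a n (h + g) - a n h - a n g) \<le> M * ((norm h)\<^sup>2 + (norm g)\<^sup>2) * (1 / 2) ^ n"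
      proof (rule always_eventually, rule allI)
        fix n
        let ?h = "(1 / 2 ^ n) *\<^sub>R h" and ?g = "(1 / 2 ^ n) *\<^sub>R g"
        have "a n (h + g) - a n h - a n g = 2 ^ n *\<^sub>R (F (x + ?h + ?g) - F (x + ?h) - F (x + ?g) + F x)"
          by (simp add: a_def algebra_simps)
        then have "norm (a n (h + g) - a n h - a n g) = 2 ^ n * norm (F (x + ?h + ?g) - F (x + ?h) - F (x + ?g) + F x)"
          by simp
        also have "\<dots> \<le> 2 ^ n * (M * ((norm ?h)\<^sup>2 + (norm ?g)\<^sup>2))" by (intro mult_left_mono sec) simp
        also have "\<dots> = M * ((norm h)\<^sup>2 + (norm g)\<^sup>2) * (1 / 2) ^ n"
          by (simp add: power_mult_distrib power_divide field_simps power2_eq_square)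
        finally show "norm (a n (h + g) - a n h - a n g) \<le> M * ((norm h)\<^sup>2 + (norm g)\<^sup>2) * (1 / 2) ^ n" .
      qed
      show "(\<lambda>n. M * ((norm h)\<^sup>2 + (norm g)\<^sup>2) * (1 / 2) ^ n) \<longlonglongrightarrow> 0"
        by (intro tendsto_mult_right_zero LIMSEQ_power_zero) simp
    qed
    moreover have "(\<lambda>n. a n (h + g) - a n h - a n g) \<longlonglongrightarrow> A (h + g) - A h - A g" by (intro tendsto_intros lim)
    ultimately have "A (h + g) - A h - A g = 0" by (rule LIMSEQ_unique[rotated])
    then show ?thesis by (simp add: algebra_simps)
  qed
  have scale: "A (r *\<^sub>R h) = r *\<^sub>R A h" for r h
  proof -
    \<comment> \<open>The defect of homogeneity is additive, zero at integers and bounded on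
      [-1, 1]. So n times its value at r is its value at the fractional part of n r, which stays
      bounded as n grows.\<close>
    define \<delta> where "\<delta> r = A (r *\<^sub>R h) - r *\<^sub>R A h" for r
    have \<delta>_add: "\<delta> (r + s) = \<delta> r + \<delta> s" for r s by (simp add: \<delta>_def scaleR_add_left add)
    have \<delta>0: "\<delta> 0 = 0" using \<delta>_add[of 0 0] by simp
    have \<delta>_uminus: "\<delta> (- r) = - \<delta> r" for r using \<delta>_add[of r "- r"] \<delta>0 by (simp add: eq_neg_iff_add_eq_0 add.commute)
    have \<delta>_nat: "\<delta> (real n * r) = real n *\<^sub>R \<delta> r" for n r
      by (induction n) (simp_all add: \<delta>0 distrib_right \<delta>_add scaleR_add_left)
    have \<delta>1: "\<delta> 1 = 0" by (simp add: \<delta>_def)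
    have \<delta>_int: "\<delta> (of_int m) = 0" for m
      by (cases m rule: int_cases2) (use \<delta>_nat[of _ 1] in \<open>simp_all add: \<delta>1 \<delta>_uminus\<close>)
    define K where "K = 2 * \<bar>L\<bar> * norm h"
    have \<delta>_bd: "norm (\<delta> r) \<le> K" if "\<bar>r\<bar> \<le> 1" for r
    proof -
      have A1: "norm (A v) \<le> \<bar>L\<bar> * norm v" for v
        by (rule order_trans[OF bd]) (intro mult_right_mono, auto)
      have "norm (\<delta> r) \<le> norm (A (r *\<^sub>R h)) + norm (r *\<^sub>R A h)" unfolding \<delta>_def by (rule norm_triangle_ineq4)
      also have "\<dots> \<le> \<bar>r\<bar> * (\<bar>L\<bar> * norm h) + \<bar>r\<bar> * (\<bar>L\<bar> * norm h)"
        using A1[of "r *\<^sub>R h"] mult_left_mono[OF A1[of h], of "\<bar>r\<bar>"] by (intro add_mono) (auto simp: mult_ac)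
      also have "\<dots> \<le> 1 * (\<bar>L\<bar> * norm h) + 1 * (\<bar>L\<bar> * norm h)" using that by (intro add_mono mult_right_mono) auto
      finally show ?thesis by (simp add: K_def)
    qed
    have "real n * norm (\<delta> r) \<le> K" for n
    proof -
      have "real n *\<^sub>R \<delta> r = \<delta> (of_int \<lfloor>real n * r\<rfloor> + frac (real n * r))"
        by (simp add: \<delta>_nat flip: \<delta>_nat) (simp add: frac_def)
      also have "\<dots> = \<delta> (frac (real n * r))" by (simp add: \<delta>_add \<delta>_int)
      finally have "norm (real n *\<^sub>R \<delta> r) \<le> K"
        using \<delta>_bd[of "frac (real n * r)"] frac_ge_0[of "real n * r"] frac_lt_1[of "real n * r"] by simp
      then show ?thesis by simp
    qed
    then have "norm (\<delta> r) = 0"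
      by (metis ex_less_of_nat_mult norm_ge_zero not_less order_le_less)
    then show ?thesis by (simp add: \<delta>_def)
  qed
  have bl: "bounded_linear A"
    by (rule bounded_linear_intro[where K = L]) (auto simp: add scale bd mult.commute)
  have "(F has_derivative A) (at x)"
  proof (rule has_derivativeI_sandwich[where e = 1 and H = "\<lambda>y. M * norm (y - x)"])
    show "((\<lambda>y. M * norm (y - x)) \<longlongrightarrow> 0) (at x)"
      by (rule tendsto_eq_intros refl | simp)+
    fix y assume "y \<noteq> x"
    then show "norm (F y - F x - A (y - x)) / norm (y - x) \<le> M * norm (y - x)"
      using near[of "y - x"] by (simp add: field_simps power2_eq_square)
  qed (use bl in auto)
  with bd that show thesis by blast
qed

section \<open>Kernel profiles and difference bounds\<close>

lemma se_profile:
  fixes r :: real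
  assumes "r \<ge> 0" shows "1 - r / 2 \<le> exp (- (1 / 2) * r)" "exp (- (1 / 2) * r) \<le> 1 - r / 2 + r\<^sup>2"
proof -
  show "1 - r / 2 \<le> exp (- (1 / 2) * r)" using exp_ge_add_one_self[of "- (1 / 2) * r"] by simp
  let ?u = "r / 2"
  have "exp (- (1 / 2) * r) = 1 / exp ?u" by (simp add: exp_minus inverse_eq_divide)
  also have "\<dots> \<le> 1 / (1 + ?u)" using assms by (intro divide_left_mono exp_ge_add_one_self) auto
  also have "\<dots> \<le> 1 - ?u + ?u\<^sup>2"
  proof -
    have "(1 - ?u + ?u\<^sup>2) * (1 + ?u) = 1 + ?u ^ 3" by (simp add: power2_eq_square power3_eq_cube field_simps)
    then have "1 \<le> (1 - ?u + ?u\<^sup>2) * (1 + ?u)" using assms by simp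
    then show ?thesis using assms by (subst pos_divide_le_eq) auto
  qed
  also have "\<dots> \<le> 1 - r / 2 + r\<^sup>2" using assms by (simp add: power_divide)
  finally show "exp (- (1 / 2) * r) \<le> 1 - r / 2 + r\<^sup>2" .
qed

lemma imq_profile:
  fixes r :: real
  assumes "r \<ge> 0" shows "1 - r / 2 \<le> (r + 1) powr (- (1 / 2))" "(r + 1) powr (- (1 / 2)) \<le> 1 - r / 2 + r\<^sup>2"
proof -
  have e: "(r + 1) powr (- (1 / 2)) = 1 / sqrt (1 + r)"
    using assms by (subst powr_minus, subst powr_half_sqrt) (simp_all add: inverse_eq_divide add.commute)
  have "sqrt (1 + r) \<le> 1 + r / 2"
    using assms by (intro real_le_lsqrt) (auto simp: power2_eq_square field_simps)
  moreover have "(1 - r / 2) * (1 + r / 2) \<le> 1" by (simp add: field_simps)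
  ultimately have "1 - r / 2 \<le> 1 / sqrt (1 + r)"
  proof (cases "1 - r / 2 \<ge> 0")
    case True
    have "(1 - r / 2) * sqrt (1 + r) \<le> (1 - r / 2) * (1 + r / 2)"
      using True \<open>sqrt (1 + r) \<le> 1 + r / 2\<close> by (intro mult_left_mono)
    also have "\<dots> \<le> 1" by (simp add: field_simps)
    finally show ?thesis using assms by (simp add: pos_le_divide_eq)
  next
    case False
    then have "1 - r / 2 \<le> 0" by simp
    also have "0 \<le> 1 / sqrt (1 + r)" using assms by simp
    finally show ?thesis .
  qed
  then show "1 - r / 2 \<le> (r + 1) powr (- (1 / 2))" by (simp add: e)
  \<comment> \<open>The square of 1 - 1 / sqrt(1 + r) is nonnegative, which reduces the claim to a
    rational function of r.\<close>
  have "1 / sqrt (1 + r) \<le> (1 + 1 / (1 + r)) / 2"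
  proof -
    have "0 \<le> (1 - 1 / sqrt (1 + r))\<^sup>2" by simp
    also have "\<dots> = 1 - 2 * (1 / sqrt (1 + r)) + 1 / (1 + r)"
    proof -
      have "(1 / sqrt (1 + r))\<^sup>2 = 1 / (1 + r)" using assms by (simp add: power_divide)
      then show ?thesis by (simp only: power2_diff) simp
    qed
    finally show ?thesis by simp
  qed
  also have "\<dots> \<le> 1 - r / 2 + r\<^sup>2"
  proof -
    have "(1 - r + r\<^sup>2) * (1 + r) = 1 + r ^ 3" by (simp add: power2_eq_square power3_eq_cube algebra_simps)
    then have "1 \<le> (1 - r + r\<^sup>2) * (1 + r)" using assms by simp
    then have "1 / (1 + r) \<le> 1 - r + r\<^sup>2" using assms by (subst pos_divide_le_eq) auto
    then have "(1 + 1 / (1 + r)) / 2 \<le> (1 + (1 - r + r\<^sup>2)) / 2"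
      by (intro divide_right_mono add_left_mono) auto
    also have "\<dots> = 1 - r / 2 + r\<^sup>2 / 2" by (simp add: field_simps)
    also have "\<dots> \<le> 1 - r / 2 + r\<^sup>2" by simp
    finally show ?thesis .
  qed
  finally show "(r + 1) powr (- (1 / 2)) \<le> 1 - r / 2 + r\<^sup>2" by (simp add: e)
qed

text \<open>Both kernels have the value 1 and the slope -1/2 at 0 with a quadratic error; the
  difference bounds use only this common estimate.\<close>

locale radial_rkhs = rkhs k H ip
  for k :: "'a::{real_inner, banach, second_countable_topology} \<Rightarrow> 'a \<Rightarrow> real" and H ip +
  fixes T :: "'a \<Rightarrow>\<^sub>L 'a" and \<kappa> :: "real \<Rightarrow> real"
  assumes k_eq: "k x y = \<kappa> ((norm (T x - T y))\<^sup>2)"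
    and \<kappa>_ge: "r \<ge> 0 \<Longrightarrow> 1 - r / 2 \<le> \<kappa> r" and \<kappa>_le: "r \<ge> 0 \<Longrightarrow> \<kappa> r \<le> 1 - r / 2 + r\<^sup>2"
begin

lemma \<kappa>0: "\<kappa> 0 = 1"
  using \<kappa>_ge[of 0] \<kappa>_le[of 0] by simp

lemma bound_value: "f \<in> H \<Longrightarrow> (f x)\<^sup>2 \<le> ip f f"
  using ip_cauchy_schwarz[OF _ kernel_mem, of f x] reproducing[of f x] reproducing[OF kernel_mem, of x x]
  by (simp add: k_eq \<kappa>0)

text \<open>The squared norm of the difference of two sections is 2 \<kappa>(0) - 2 \<kappa>(|T
  h|^2), which the lower estimate of the profile bounds by |T h|^2.\<close>

lemma bound_first_difference:
  assumes f: "f \<in> H" shows "(f (x + h) - f x)\<^sup>2 \<le> ip f f * (norm (T h))\<^sup>2"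
proof -
  let ?d = "\<lambda>z. k z (x + h) - k z x"
  have d: "?d \<in> H" by (intro diff_mem kernel_mem)
  have ipd: "ip g ?d = g (x + h) - g x" if "g \<in> H" for g
    using that by (simp add: ip_diff_right kernel_mem reproducing)
  have "ip ?d ?d = (k (x + h) (x + h) - k (x + h) x) - (k x (x + h) - k x x)" by (rule ipd[OF d])
  also have "\<dots> = 2 * \<kappa> 0 - 2 * \<kappa> ((norm (T h))\<^sup>2)"
    by (simp add: k_eq blinfun.add_right norm_minus_commute)
  also have "\<dots> \<le> (norm (T h))\<^sup>2" using \<kappa>_ge[of "(norm (T h))\<^sup>2"] by (simp add: \<kappa>0)
  finally have le: "ip ?d ?d \<le> (norm (T h))\<^sup>2" .
  have "(f (x + h) - f x)\<^sup>2 \<le> ip f f * ip ?d ?d"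
    using ip_cauchy_schwarz[OF f d] by (simp only: ipd[OF f])
  also have "\<dots> \<le> ip f f * (norm (T h))\<^sup>2" by (intro mult_left_mono le ip_nonneg f)
  finally show ?thesis .
qed

text \<open>In the squared norm of the second difference of sections the constants cancel, and so do
  the linear terms by the parallelogram law; only the quadratic errors at \<open>p\<close> and
  \<open>q\<close> survive. The 8 comes from 2 (p + q)^2 with p + q = 2 (a + b).\<close>

lemma bound_second_difference:
  assumes f: "f \<in> H"
  shows "(f (x + h + g) - f (x + h) - f (x + g) + f x)\<^sup>2 \<le> ip f f * (8 * ((norm (T h))\<^sup>2 + (norm (T g))\<^sup>2)\<^sup>2)"
proof -
  let ?d1 = "\<lambda>z. k z (x + h + g) - k z (x + h)" and ?d2 = "\<lambda>z. k z (x + g) - k z x"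
  let ?d = "\<lambda>z. (k z (x + h + g) - k z (x + h)) - (k z (x + g) - k z x)"
  have d12: "?d1 \<in> H" "?d2 \<in> H" by (intro diff_mem kernel_mem)+
  then have d: "?d \<in> H" by (rule diff_mem)
  have ipd: "ip u ?d = (u (x + h + g) - u (x + h)) - (u (x + g) - u x)" if "u \<in> H" for u
    using that by (simp add: ip_diff_right[OF d12] ip_diff_right kernel_mem reproducing)
  define a b where "a = (norm (T h))\<^sup>2" and "b = (norm (T g))\<^sup>2"
  define p q where "p = (norm (T h + T g))\<^sup>2" and "q = (norm (T h - T g))\<^sup>2"
  have pq: "p + q = 2 * (a + b)"
    unfolding p_def q_def a_def b_def power2_norm_eq_inner
    by (simp add: inner_add_left inner_add_right inner_diff_left inner_diff_right inner_commute)
  have nn: "a \<ge> 0" "b \<ge> 0" "p \<ge> 0" "q \<ge> 0" by (simp_all add: a_def b_def p_def q_def)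
  have p': "(norm (T g + T h))\<^sup>2 = p" by (simp add: p_def add.commute)
  have q': "(norm (T g - T h))\<^sup>2 = q" by (simp add: q_def norm_minus_commute)
  have n': "norm (- T h - T g) = norm (T h + T g)" by (metis minus_add_distrib norm_minus_cancel diff_conv_add_uminus)
  have "ip ?d ?d = ((k (x + h + g) (x + h + g) - k (x + h + g) (x + h)) - (k (x + h + g) (x + g) - k (x + h + g) x)
      - ((k (x + h) (x + h + g) - k (x + h) (x + h)) - (k (x + h) (x + g) - k (x + h) x)))
      - ((k (x + g) (x + h + g) - k (x + g) (x + h)) - (k (x + g) (x + g) - k (x + g) x)
      - ((k x (x + h + g) - k x (x + h)) - (k x (x + g) - k x x)))" by (rule ipd[OF d])
  also have "\<dots> = 4 * \<kappa> 0 - 4 * \<kappa> a - 4 * \<kappa> b + 2 * \<kappa> p + 2 * \<kappa> q"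
    by (simp add: k_eq blinfun.add_right a_def[symmetric] b_def[symmetric] p_def[symmetric]
        q_def[symmetric] p' q' n' norm_minus_commute algebra_simps)
  also have "\<dots> \<le> 2 * (p\<^sup>2 + q\<^sup>2)"
    using \<kappa>_ge[OF nn(1)] \<kappa>_ge[OF nn(2)] \<kappa>_le[OF nn(3)] \<kappa>_le[OF nn(4)] pq \<kappa>0 by simp
  also have "\<dots> \<le> 2 * (p + q)\<^sup>2" using nn by (simp add: power2_sum)
  also have "\<dots> = 8 * (a + b)\<^sup>2" unfolding pq power_mult_distrib by simp
  finally have le: "ip ?d ?d \<le> 8 * (a + b)\<^sup>2" .
  have "(f (x + h + g) - f (x + h) - f (x + g) + f x)\<^sup>2 = (ip f ?d)\<^sup>2"
    unfolding ipd[OF f] by (simp add: algebra_simps)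
  also have "\<dots> \<le> ip f f * ip ?d ?d" by (rule ip_cauchy_schwarz[OF f d])
  also have "\<dots> \<le> ip f f * (8 * (a + b)\<^sup>2)" by (intro mult_left_mono le ip_nonneg f)
  finally show ?thesis by (simp add: a_def b_def)
qed

end

lemma radial_rkhs_kernel:
  assumes R: "rkhs k H ip" and k: "k = se_kernel T \<or> k = imq_kernel T"
  obtains \<kappa> where "radial_rkhs k H ip T \<kappa>"
  using k
proof
  assume "k = se_kernel T"
  then have "radial_rkhs k H ip T (\<lambda>r. exp (- (1 / 2) * r))"
    by (intro radial_rkhs.intro R radial_rkhs_axioms.intro se_profile) (simp_all add: se_kernel_def)
  then show thesis by (rule that)
next
  assume "k = imq_kernel T"
  then have "radial_rkhs k H ip T (\<lambda>r. (r + 1) powr (- (1 / 2)))"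
    by (intro radial_rkhs.intro R radial_rkhs_axioms.intro imq_profile) (simp_all add: imq_kernel_def)
  then show thesis by (rule that)
qed

section \<open>The trace in the eigenbasis\<close>

lemma abs_summable_hilbert_basis:
  fixes E :: "'a::real_inner set"
  assumes E: "hilbert_basis E"
  shows "(\<lambda>h. norm (inner a h * inner b h)) summable_on E"
    "(\<Sum>\<^sub>\<infinity>h\<in>E. norm (inner a h * inner b h)) \<le> (norm a)\<^sup>2 + (norm b)\<^sup>2"
proof -
  have le: "(\<Sum>h\<in>F. norm (inner a h * inner b h)) \<le> (norm a)\<^sup>2 + (norm b)\<^sup>2" if F: "finite F" "F \<subseteq> E" for F
  proof -
    have ab: "norm (s * t) \<le> s\<^sup>2 + t\<^sup>2" for s t :: real
    proof -
      have "2 * (\<bar>s\<bar> * \<bar>t\<bar>) \<le> s\<^sup>2 + t\<^sup>2" using zero_le_power2[of "\<bar>s\<bar> - \<bar>t\<bar>"] by (simp add: power2_diff)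
      moreover have "0 \<le> \<bar>s\<bar> * \<bar>t\<bar>" by simp
      ultimately show ?thesis unfolding real_norm_def abs_mult by linarith
    qed
    have "(\<Sum>h\<in>F. norm (inner a h * inner b h)) \<le> (\<Sum>h\<in>F. (inner a h)\<^sup>2 + (inner b h)\<^sup>2)"
      by (intro sum_mono ab)
    also have "\<dots> = (\<Sum>h\<in>F. (inner a h)\<^sup>2) + (\<Sum>h\<in>F. (inner b h)\<^sup>2)" by (rule sum.distrib)
    also have "\<dots> \<le> (norm a)\<^sup>2 + (norm b)\<^sup>2"
      by (intro add_mono bessel_finite F(1)) (use E F(2) in \<open>auto simp: hilbert_basis_def intro: pairwise_subset\<close>)
    finally show ?thesis .
  qed
  show "(\<lambda>h. norm (inner a h * inner b h)) summable_on E"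
    by (rule nonneg_bdd_above_summable_on) (use le in \<open>auto intro!: bdd_aboveI2\<close>)
  then show "(\<Sum>\<^sub>\<infinity>h\<in>E. norm (inner a h * inner b h)) \<le> (norm a)\<^sup>2 + (norm b)\<^sup>2"
    by (rule infsum_le_finite_sums) (use le in auto)
qed

text \<open>\<open>op_trace\<close> refers to an unspecified basis. The double series over that
  basis and the eigenbasis is absolutely summable because the eigenvalues are summable and
  \<open>A\<close> is bounded; the two orders of summation give the two sides.\<close>

lemma op_trace_eigenbasis:
  fixes C :: "'a::{real_inner, banach, second_countable_topology} \<Rightarrow>\<^sub>L 'a"
  assumes C: "nonneg_symmetric C" and e: "complete_onseq e" and Ce: "\<And>i. C (e i) = l i *\<^sub>R e i" "\<And>i. l i \<ge> 0"
    and l: "summable l" and A: "bounded_linear A"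
  shows "(\<lambda>i. l i * inner (A (e i)) (e i)) sums op_trace (\<lambda>h. C (A h))"
proof -
  define E where "E = (SOME E. hilbert_basis (E :: 'a set))"
  have E: "hilbert_basis E" unfolding E_def by (rule hilbert_basis_some)
  have os: "onseq e" using e by (simp add: complete_onseq_def)
  obtain K where K: "K \<ge> 0" "\<And>x. norm (A x) \<le> norm x * K"
    using bounded_linear.nonneg_bounded[OF A] by blast
  \<comment> \<open>The vector \<open>a i\<close> is the adjoint of \<open>A\<close> applied to
    \<open>e i\<close>.\<close>
  have "\<exists>a. \<forall>x. inner (A x) (e i) = inner x a" for i
    using riesz_representation[OF bounded_linear_compose[OF bounded_linear_inner_left A], of "e i"] by metis
  then obtain a where a: "\<And>i x. inner (A x) (e i) = inner x (a i)" by metis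
  have ei: "norm (e i) \<le> 1" for i using os by (metis norm_zero onseq_def order_refl zero_le_one)
  have na: "norm (a i) \<le> K" for i
  proof -
    have "norm (a i) * norm (a i) = inner (A (a i)) (e i)" by (simp add: a dot_square_norm power2_eq_square)
    also have "\<dots> \<le> norm (A (a i)) * norm (e i)" by (rule norm_cauchy_schwarz)
    also have "\<dots> \<le> (norm (a i) * K) * 1" by (intro mult_mono K ei) (use K in auto)
    finally show ?thesis by (cases "a i = 0") (use K in auto)
  qed
  let ?g = "\<lambda>i h. l i * (inner (a i) h * inner (e i) h)"
  have as: "(\<lambda>z. norm (case z of (i, h) \<Rightarrow> ?g i h)) summable_on UNIV \<times> E"
    unfolding Infinite_Sum.abs_summable_on_Sigma_iff
  proof (intro conjI ballI)
    fix i
    show "(\<lambda>h. norm (case (i, h) of (i, h) \<Rightarrow> ?g i h)) summable_on E"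
      using summable_on_cmult_right[OF abs_summable_hilbert_basis(1)[OF E, of "a i" "e i"], of "\<bar>l i\<bar>"]
      by (simp add: abs_mult)
  next
    have n: "infsum (\<lambda>h. norm (case (i, h) of (i, h) \<Rightarrow> ?g i h)) E \<le> l i * (K\<^sup>2 + 1)" for i
    proof -
      have "infsum (\<lambda>h. norm (case (i, h) of (i, h) \<Rightarrow> ?g i h)) E = l i * (\<Sum>\<^sub>\<infinity>h\<in>E. norm (inner (a i) h * inner (e i) h))"
        using Ce(2)[of i] by (simp add: abs_mult infsum_cmult_right')
      also have "\<dots> \<le> l i * ((norm (a i))\<^sup>2 + (norm (e i))\<^sup>2)"
        by (intro mult_left_mono abs_summable_hilbert_basis E Ce)
      also have "\<dots> \<le> l i * (K\<^sup>2 + 1)"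
        using na[of i] ei[of i] by (intro mult_left_mono add_mono power_mono Ce) (auto simp: power_le_one)
      finally show ?thesis .
    qed
    have "summable (\<lambda>i. norm (norm (infsum (\<lambda>h. norm (case (i, h) of (i, h) \<Rightarrow> ?g i h)) E)))"
    proof (rule summable_comparison_test')
      show "summable (\<lambda>i. l i * (K\<^sup>2 + 1))" by (intro summable_mult2 l)
      show "norm (norm (norm (infsum (\<lambda>h. norm (case (i, h) of (i, h) \<Rightarrow> ?g i h)) E))) \<le> l i * (K\<^sup>2 + 1)" for i
        using n[of i] by (simp add: infsum_nonneg)
    qed
    then show "(\<lambda>i. norm (infsum (\<lambda>h. norm (case (i, h) of (i, h) \<Rightarrow> ?g i h)) E)) summable_on UNIV"
      by (rule norm_summable_imp_summable_on)
  qed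
  have row: "(\<Sum>\<^sub>\<infinity>h\<in>E. ?g i h) = l i * inner (A (e i)) (e i)" for i
    using infsum_parseval[OF E, of "a i" "e i"] a[of "e i" i] by (simp add: infsum_cmult_right' inner_commute[of "e i" "a i"])
  have col: "(\<Sum>\<^sub>\<infinity>i\<in>UNIV. ?g i h) = inner (C (A h)) h" for h
  proof -
    have eq: "?g i h = inner (A h) (e i) * inner (C h) (e i)" for i
      using nonneg_symmetricD(1)[OF C, of h "e i"] by (simp add: a Ce inner_commute mult_ac)
    have "((\<lambda>i. inner (A h) (e i) * inner (C h) (e i)) has_sum inner (A h) (C h)) UNIV"
      by (rule norm_summable_imp_has_sum[OF summable_inner_mult[OF os] parseval[OF e]])
    then have "(\<Sum>\<^sub>\<infinity>i\<in>UNIV. ?g i h) = inner (A h) (C h)" unfolding eq by (rule infsumI)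
    then show ?thesis using nonneg_symmetricD(1)[OF C, of "A h" h] by simp
  qed
  have sw: "(\<Sum>\<^sub>\<infinity>i\<in>UNIV. l i * inner (A (e i)) (e i)) = op_trace (\<lambda>h. C (A h))"
    using infsum_swap_banach[OF Infinite_Sum.abs_summable_summable[OF as]] unfolding row col op_trace_def E_def[symmetric] .
  have "(\<lambda>i. l i * inner (A (e i)) (e i)) summable_on UNIV"
  proof (rule norm_summable_imp_summable_on, rule summable_comparison_test')
    show "summable (\<lambda>i. l i * K)" by (intro summable_mult2 l)
    fix i
    have "norm (inner (A (e i)) (e i)) \<le> norm (A (e i)) * norm (e i)" by (simp add: Cauchy_Schwarz_ineq2)
    also have "\<dots> \<le> (1 * K) * 1"
      using K(2)[of "e i"] ei[of i] K(1) by (intro mult_mono order_trans[OF K(2)] mult_right_mono) auto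
    finally show "norm (norm (l i * inner (A (e i)) (e i))) \<le> l i * K"
      using Ce(2)[of i] by (simp add: abs_mult mult_left_mono)
  qed
  then have "((\<lambda>i. l i * inner (A (e i)) (e i)) has_sum op_trace (\<lambda>h. C (A h))) UNIV"
    using sw by (metis has_sum_infsum)
  then show ?thesis by (rule has_sum_imp_sums)
qed

lemma norm_bound_coordinates:
  assumes e: "complete_onseq e" and S: "summable S" and le: "\<And>i. (inner v (e i))\<^sup>2 \<le> S i * t"
  shows "(norm v)\<^sup>2 \<le> suminf S * t"
  by (rule sums_le[OF le parseval_norm[OF e] sums_mult2[OF summable_sums[OF S]]])

text \<open>The squared RKHS norms of the coordinates are summable, so values, first and second
  differences of \<open>F\<close> inherit the scalar estimates with the sum as constant, and the
  second difference criterion applies to \<open>F\<close> as a whole.\<close>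

lemma (in radial_rkhs) vv_rkhs_regularity:
  fixes F :: "'a \<Rightarrow> 'a" and e :: "nat \<Rightarrow> 'a"
  assumes F: "F \<in> vv_rkhs H ip" and e: "complete_onseq e"
  obtains A B where "\<And>x. (F has_derivative A x) (at x)" "\<And>x h. norm (A x h) \<le> B * norm h" "\<And>x. norm (F x) \<le> B"
proof -
  have os: "onseq e" using e by (simp add: complete_onseq_def)
  let ?E = "range e - {0}"
  define f where "f i = (\<lambda>x. inner (F x) (e i))" for i
  define S where "S i = ip (f i) (f i)" for i
  have E: "hilbert_basis ?E" by (rule complete_onseq_hilbert_basis[OF e])
  have H: "f i \<in> H" for i
  proof (cases "e i = 0")
    case True
    then show ?thesis by (simp add: f_def zero_mem)
  next
    case False
    then show ?thesis using F E unfolding vv_rkhs_def f_def by blast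
  qed
  have "summable (\<lambda>i. ip (\<lambda>x. inner (F x) (e i)) (\<lambda>x. inner (F x) (e i)))"
  proof (rule summable_on_onseq[where f = "\<lambda>v. ip (\<lambda>x. inner (F x) v) (\<lambda>x. inner (F x) v)", OF os])
    show "(\<lambda>v. ip (\<lambda>x. inner (F x) v) (\<lambda>x. inner (F x) v)) summable_on ?E"
      using F E unfolding vv_rkhs_def by blast
    show "ip (\<lambda>x. inner (F x) 0) (\<lambda>x. inner (F x) 0) = 0"
      using ip_scale[OF zero_mem zero_mem, of 0] by simp
  qed
  moreover have "S = (\<lambda>i. ip (\<lambda>x. inner (F x) (e i)) (\<lambda>x. inner (F x) (e i)))"
    by (rule ext) (simp add: S_def f_def)
  ultimately have S: "summable S" by simp
  define s where "s = suminf S"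
  have s0: "s \<ge> 0" unfolding s_def by (intro suminf_nonneg S) (simp add: S_def ip_nonneg H)
  have val: "(norm (F x))\<^sup>2 \<le> s * 1" for x unfolding s_def
    by (rule norm_bound_coordinates[OF e S]) (use bound_value[OF H] in \<open>simp add: f_def S_def\<close>)
  have lip: "norm (F (x + h) - F x) \<le> (sqrt s * norm T) * norm h" for x h
  proof -
    have "(norm (F (x + h) - F x))\<^sup>2 \<le> s * (norm (T h))\<^sup>2" unfolding s_def
      by (rule norm_bound_coordinates[OF e S])
        (use bound_first_difference[OF H] in \<open>simp add: f_def S_def inner_diff_left\<close>)
    also have "\<dots> \<le> s * (norm T * norm h)\<^sup>2" by (intro mult_left_mono power_mono norm_blinfun s0) auto
    also have "\<dots> = ((sqrt s * norm T) * norm h)\<^sup>2" using s0 by (simp add: power_mult_distrib)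
    finally show ?thesis by (rule power2_le_imp_le) (use s0 in auto)
  qed
  define M where "M = sqrt (8 * s) * (norm T)\<^sup>2"
  have sec: "norm (F (x + h + g) - F (x + h) - F (x + g) + F x) \<le> M * ((norm h)\<^sup>2 + (norm g)\<^sup>2)" for x h g
  proof -
    have "(norm (F (x + h + g) - F (x + h) - F (x + g) + F x))\<^sup>2 \<le> s * (8 * ((norm (T h))\<^sup>2 + (norm (T g))\<^sup>2)\<^sup>2)"
      unfolding s_def
      by (rule norm_bound_coordinates[OF e S])
        (use bound_second_difference[OF H] in \<open>simp add: f_def S_def inner_diff_left inner_add_left\<close>)
    also have "\<dots> \<le> s * (8 * ((norm T * norm h)\<^sup>2 + (norm T * norm g)\<^sup>2)\<^sup>2)"
      by (intro mult_left_mono power_mono add_mono norm_blinfun s0) auto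
    also have "\<dots> = (M * ((norm h)\<^sup>2 + (norm g)\<^sup>2))\<^sup>2"
      using s0 by (simp add: M_def power_mult_distrib flip: distrib_left)
    finally show ?thesis by (rule power2_le_imp_le) (use s0 in \<open>auto simp: M_def\<close>)
  qed
  have "\<exists>A. (F has_derivative A) (at x) \<and> (\<forall>h. norm (A h) \<le> (sqrt s * norm T) * norm h)" for x
    using bounded_second_differences_differentiable[OF lip sec] by metis
  then obtain A where A: "\<And>x. (F has_derivative A x) (at x)" "\<And>x h. norm (A x h) \<le> (sqrt s * norm T) * norm h"
    by metis
  define B where "B = max (sqrt s * norm T) (sqrt s)"
  show thesis
  proof (rule that[OF A(1)])
    show "norm (A x h) \<le> B * norm h" for x h
      by (rule order_trans[OF A(2)]) (intro mult_right_mono, auto simp: B_def)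
    have "norm (F x) \<le> sqrt s" for x
      using val[of x] by (simp add: real_le_rsqrt)
    then show "norm (F x) \<le> B" for x by (simp add: B_def le_max_iff_disj)
  qed
qed

text \<open>Each eigendirection contributes zero by integration by parts. The partial sums over
  directions converge to the Stein operator, by the eigenbasis formula for the trace and by
  Parseval.\<close>

lemma stein_identity:
  fixes C T :: "'a::{real_inner, banach, second_countable_topology} \<Rightarrow>\<^sub>L 'a"
  assumes R: "rkhs k H ip" and k: "k = se_kernel T \<or> k = imq_kernel T"
    and C: "nonneg_symmetric C" and e: "complete_onseq e" and Ce: "\<And>i. C (e i) = l i *\<^sub>R e i" "\<And>i. l i \<ge> 0" "summable l"
    and N: "centred_gaussian C N" and U: "\<And>x. U differentiable (at x)"
    and P: "prob_space P" "Z > 0" "P = density N (\<lambda>x. ennreal (exp (- U x) / Z))"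
    and b: "\<And>i. integrable P (\<lambda>x. inner x (e i) + l i * inner (e i) (gradient U x))"
    and nP: "integrable P norm" "integrable P (\<lambda>x. norm (C (gradient U x)))"
    and F: "F \<in> vv_rkhs H ip"
  shows "(\<integral>x. stein_op C U F x \<partial>P) = 0"
proof -
  obtain \<kappa> where "radial_rkhs k H ip T \<kappa>" using radial_rkhs_kernel[OF R k] .
  then interpret radial_rkhs k H ip T \<kappa> .
  obtain A B where A: "\<And>x. (F has_derivative A x) (at x)" "\<And>x h. norm (A x h) \<le> B * norm h" "\<And>x. norm (F x) \<le> B"
    using vv_rkhs_regularity[OF F e] by metis
  interpret P: prob_space P by fact
  have B: "B \<ge> 0" using norm_ge_zero[of "F 0"] A(3)[of 0] by linarith
  have os: "onseq e" using e by (simp add: complete_onseq_def)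
  have ei: "norm (e i) = 1 \<or> e i = 0" for i using os by (simp add: onseq_def)
  then have ei1: "norm (e i) \<le> 1" for i by (metis norm_zero order_refl zero_le_one)
  let ?b = "\<lambda>i x. inner x (e i) + l i * inner (e i) (gradient U x)"
  let ?t = "\<lambda>i x. l i * inner (A x (e i)) (e i) - inner (F x) (e i) * ?b i x"
  have ibp: "integrable P (?t i)" "(\<integral>x. ?t i x \<partial>P) = 0" for i
  proof -
    have D: "((\<lambda>x. inner (F x) (e i)) has_derivative (\<lambda>h. inner (A x h) (e i))) (at x)" for x
      by (rule has_derivative_inner_left[OF A(1)])
    have b1: "\<bar>inner (F x) (e i)\<bar> \<le> B" for x
      by (rule order_trans[OF Cauchy_Schwarz_ineq2]) (use A(3)[of x] ei1[of i] B in \<open>intro order_trans[OF mult_mono[OF A(3) ei1]], auto\<close>)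
    have b2: "\<bar>inner (A x (e i)) (e i)\<bar> \<le> B" for x
    proof -
      have "norm (A x (e i)) \<le> B * 1" by (rule order_trans[OF A(2)]) (intro mult_left_mono ei1 B)
      then have "norm (A x (e i)) * norm (e i) \<le> (B * 1) * 1" by (intro mult_mono ei1) (use B in auto)
      then show ?thesis using Cauchy_Schwarz_ineq2[of "A x (e i)" "e i"] by simp
    qed
    show "integrable P (?t i)" "(\<integral>x. ?t i x \<partial>P) = 0"
      using gibbs_integration_by_parts[OF N C ei Ce(1,2) U P b D b1 b2] by simp_all
  qed
  have be: "inner (x + C (gradient U x)) (e i) = ?b i x" for x i
    using nonneg_symmetricD(1)[OF C, of "gradient U x" "e i"] unfolding inner_add_left Ce by (simp add: inner_commute[of "gradient U x" "e i"])
  have sums: "(\<lambda>i. ?t i x) sums stein_op C U F x" for x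
  proof -
    have "frechet_derivative F (at x) = A x" using frechet_derivative_at[OF A(1)] by simp
    then have "stein_op C U F x = op_trace (\<lambda>h. C (A x h)) - inner (F x) (x + C (gradient U x))"
      by (simp add: stein_op_def)
    moreover have "(\<lambda>i. l i * inner (A x (e i)) (e i)) sums op_trace (\<lambda>h. C (A x h))"
      by (rule op_trace_eigenbasis[OF C e Ce has_derivative_bounded_linear[OF A(1)]])
    moreover have "(\<lambda>i. inner (F x) (e i) * ?b i x) sums inner (F x) (x + C (gradient U x))"
      using parseval[OF e, of "F x" "x + C (gradient U x)"] by (simp only: be)
    ultimately show ?thesis by (simp only: sums_diff)
  qed
  have "(\<lambda>n. \<integral>x. (\<Sum>i<n. ?t i x) \<partial>P) \<longlonglongrightarrow> (\<integral>x. stein_op C U F x \<partial>P)"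
  proof (rule integral_dominated_convergence)
    show m: "(\<lambda>x. \<Sum>i<n. ?t i x) \<in> borel_measurable P" for n
      by (intro borel_measurable_sum borel_measurable_integrable ibp)
    show "stein_op C U F \<in> borel_measurable P"
      by (rule borel_measurable_LIMSEQ_real[OF _ m]) (use sums in \<open>simp add: sums_def\<close>)
    show "AE x in P. (\<lambda>n. \<Sum>i<n. ?t i x) \<longlonglongrightarrow> stein_op C U F x"
      using sums by (simp add: sums_def)
    \<comment> \<open>The trace part is bounded through the sum of the eigenvalues; the other part
      is an inner product with a projection, whose norm does not grow with n.\<close>
    let ?w = "\<lambda>x. B * suminf l + B * (norm x + norm (C (gradient U x)))"
    show "integrable P ?w" using nP by simp
    fix n
    show "AE x in P. norm (\<Sum>i<n. ?t i x) \<le> ?w x"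
    proof (rule AE_I2)
      fix x
      have "norm (\<Sum>i<n. l i * inner (A x (e i)) (e i)) \<le> (\<Sum>i<n. l i * B)"
      proof (rule sum_norm_le)
        fix i
        have "norm (A x (e i)) \<le> B * 1" by (rule order_trans[OF A(2)]) (intro mult_left_mono ei1 B)
        then have "norm (A x (e i)) * norm (e i) \<le> (B * 1) * 1" by (intro mult_mono ei1) (use B in auto)
        then have "\<bar>inner (A x (e i)) (e i)\<bar> \<le> B" using Cauchy_Schwarz_ineq2[of "A x (e i)" "e i"] by simp
        then show "norm (l i * inner (A x (e i)) (e i)) \<le> l i * B"
          using Ce(2)[of i] by (simp add: abs_mult mult_left_mono)
      qed
      also have "\<dots> \<le> suminf l * B" unfolding sum_distrib_right[symmetric]
        using Ce B by (intro mult_right_mono sum_le_suminf) auto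
      finally have 1: "norm (\<Sum>i<n. l i * inner (A x (e i)) (e i)) \<le> B * suminf l" by (simp add: mult.commute)
      let ?v = "x + C (gradient U x)"
      have "(\<Sum>i<n. inner (F x) (e i) * ?b i x) = inner (F x) (proj_upto e n ?v)"
        by (simp only: inner_proj_upto_right be)
      also have "\<bar>\<dots>\<bar> \<le> norm (F x) * norm (proj_upto e n ?v)" by (rule Cauchy_Schwarz_ineq2)
      also have "\<dots> \<le> B * norm ?v" by (intro mult_mono A norm_proj_upto_le[OF os]) (use B in auto)
      also have "\<dots> \<le> B * (norm x + norm (C (gradient U x)))" by (intro mult_left_mono norm_triangle_ineq B)
      finally have 2: "norm (\<Sum>i<n. inner (F x) (e i) * ?b i x) \<le> B * (norm x + norm (C (gradient U x)))" by simp
      show "norm (\<Sum>i<n. ?t i x) \<le> ?w x"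
        unfolding sum_subtractf by (rule order_trans[OF norm_triangle_ineq4 add_mono[OF 1 2]])
    qed
  qed
  moreover have "(\<integral>x. (\<Sum>i<n. ?t i x) \<partial>P) = 0" for n
    using ibp by (subst Bochner_Integration.integral_sum) auto
  ultimately show ?thesis by (simp add: LIMSEQ_const_iff)
qed

section \<open>Both implications\<close>

theorem theorem4p3:
  fixes C T :: "'a::{real_inner, banach, second_countable_topology} \<Rightarrow>\<^sub>L 'a"
    and U :: "'a \<Rightarrow> real"
    and N P Q :: "'a measure"
    and k :: "'a \<Rightarrow> 'a \<Rightarrow> real"
    and H :: "('a \<Rightarrow> real) set"
    and ip :: "('a \<Rightarrow> real) \<Rightarrow> ('a \<Rightarrow> real) \<Rightarrow> real"
  assumes "C \<in> L1_plus"
    and "centred_gaussian C N"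
    and "\<And>x. U differentiable (at x)"
    and "prob_space P" and "sets P = sets borel"
    and "prob_space Q" and "sets Q = sets borel"
    and "\<exists>Z>0. P = density N (\<lambda>x. ennreal (exp (- U x) / Z))"
    and "integrable Q (\<lambda>x. (norm x)\<^sup>2)"
    and "integrable Q (\<lambda>x. norm (C (gradient U x)))"
    and "(\<lambda>x. exp (- U x / 2)) \<in> malliavin_sobolev C N"
    and "integrable N (\<lambda>x. (norm (op_sqrt C (gradient U x)))\<^sup>2)"
    and "surj (adjoint (blinfun_apply T))"
    and "k = se_kernel T \<or> k = imq_kernel T"
    and "rkhs k H ip"
  shows "ksd C U H ip Q = 0 \<longleftrightarrow> Q = P"
proof -
  note C = assms(1) and N = assms(2) and U = assms(3) and P = assms(4) and Q = assms(6) and sQ = assms(7)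
    and nC = assms(10) and T = assms(13) and k = assms(14) and R = assms(15)
  note [measurable_cong, simp] = sQ
  have ns: "nonneg_symmetric C" using C by (simp add: L1_plus_def)
  have "prob_space N" and sN: "sets N = sets borel" using N by (simp_all add: centred_gaussian_def)
  obtain Z where Z: "Z > 0" "P = density N (\<lambda>x. ennreal (exp (- U x) / Z))" using assms(8) by blast
  obtain e :: "nat \<Rightarrow> 'a" and l where e: "complete_onseq e"
    and Ce: "\<And>i. C (e i) = l i *\<^sub>R e i" "\<And>i. l i \<ge> 0" "summable l"
    using L1_plus_eigenbasis[OF C] by metis
  have os: "onseq e" using e by (simp add: complete_onseq_def)
  have nQ: "integrable Q norm" by (rule integrable_norm_of_square[OF Q sQ assms(9)])
  \<comment> \<open>The gradient term is the coordinate along \<open>e i\<close> of \<open>C\<close>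
    applied to the gradient, so the moment condition on the latter controls it.\<close>
  have b: "integrable Q (\<lambda>x. inner x (e i) + l i * inner (e i) (gradient U x))" for i
  proof -
    have [measurable]: "(\<lambda>x. inner (e i) (gradient U x)) \<in> borel_measurable borel"
      by (rule directional_derivative_measurable[OF GDERIV_gradient[OF U]])
    have ei: "norm (e i) \<le> 1" using os by (metis norm_zero onseq_def order_refl zero_le_one)
    have le: "\<bar>inner v (e i)\<bar> \<le> norm v" for v
      using Cauchy_Schwarz_ineq2[of v "e i"] mult_left_le[OF ei, of "norm v"] by simp
    have "integrable Q (\<lambda>x. inner x (e i))"
      by (rule Bochner_Integration.integrable_bound[OF nQ]) (use le in auto)
    moreover have "integrable Q (\<lambda>x. l i * inner (e i) (gradient U x))"
    proof (rule Bochner_Integration.integrable_bound[OF nC])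
      have "l i * inner (e i) (gradient U x) = inner (C (gradient U x)) (e i)" for x
        using nonneg_symmetricD(1)[OF ns, of "gradient U x" "e i"] by (simp add: Ce inner_commute)
      then show "AE x in Q. norm (l i * inner (e i) (gradient U x)) \<le> norm (norm (C (gradient U x)))"
        using le by simp
    qed measurable
    ultimately show ?thesis by (rule Bochner_Integration.integrable_add)
  qed
  show ?thesis
  proof
    assume ksd: "ksd C U H ip Q = 0"
    obtain s where s: "s > 0"
      "\<And>i y. (\<integral>x. (- 2 * s * l i * inner (T x - T y) (T (e i)) - (inner x (e i) + l i * inner (e i) (gradient U x)))
        * exp (- s * (norm (T x - T y))\<^sup>2) \<partial>Q) = 0"
      using ksd_zero_gaussian[OF R k ksd ns e Ce(1) Q sQ b] by blast
    have "continuous_on UNIV U"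
      using U by (intro continuous_at_imp_continuous_on ballI differentiable_imp_continuous_within)
    then show "Q = P"
      by (rule gibbs_unique[OF e \<open>prob_space N\<close> sN Q sQ gaussian_resample_invariant[OF N ns os Ce(1)]
        stein_resample_invariant[OF N e Ce(1,2) U Q sQ nQ T s(1) b s(2)] _ P Z])
  next
    assume "Q = P"
    \<comment> \<open>With Q = P the moment conditions on \<open>Q\<close> become those required of
      \<open>P\<close>.\<close>
    then have "(\<integral>x. stein_op C U F x \<partial>Q) = 0" if "F \<in> vv_rkhs H ip" for F
      using stein_identity[OF R k ns e Ce N U P Z _ _ _ that] b nQ nC by simp
    then show "ksd C U H ip Q = 0"
      unfolding ksd_def by (intro antisym SUP_least) auto
  qed
qed

end
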